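(* Let $n\ge2$ and $\theta\in\mathbb{S}^{n-1}$. For every $0<\beta<\infty$, setting $\alpha_0:=\min(\beta+1,\;2\beta-(n-4)/2)$, there is a radial, real-valued and compactly supported function $g_\beta$ on $\mathbb{R}^n$ such that $g_\beta\in W^{\gamma,2}(\mathbb{R}^n)$ for every $\gamma<\beta$, and such that (i) $Q_{\theta,2}(g_\beta)\in W^{\alpha,2}_{loc}(\mathbb{R}^n)$ only if $\alpha<\alpha_0$; (ii) $Q_{F,2}(g_\beta)\in W^{\alpha,2}_{loc}(\mathbb{R}^n)$ only if $\alpha<\alpha_0$.
   Context: Fourier transform: $\widehat f(\xi)=\int_{\mathbb{R}^n}e^{-ix\cdot\xi}f(x)\,dx$. Let $\langle\xi\rangle=(1+|\xi|^2)^{1/2}$. $W^{\alpha,2}(\mathbb{R}^n)=\{f\in\mathcal S':\langle\xi\rangle^\alpha\widehat f\in L^2\}$, and $f\in W^{\alpha,2}_{loc}$ means $\phi f\in W^{\alpha,2}$ for every $\phi\in C_c^\infty(\mathbb{R}^n)$. Double dispersion operators. For $\theta\in\mathbb{S}^{n-1}$ let $H_\theta=\{\eta\in\mathbb{R}^n:\eta\cdot\theta<0\}$; for $\eta\in H_\theta$ put $k=k(\eta,\theta)=-\frac{|\eta|^2}{2\theta\cdot\eta}>0$ and $\theta'=\theta'(\eta,\theta)=k^{-1}(\eta+k\theta)\in\mathbb{S}^{n-1}$, so that $\eta=k(\theta'-\theta)$. With $R_k$ the outgoing resolvent, $\widehat{R_k(f)}(\xi)=(-|\xi|^2+k^2+i0)^{-1}\widehat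 f(\xi)$, define $$B_{\theta,2}(q)(\eta)=\int_{\mathbb{R}^n}e^{-ik\theta'\cdot y}\,q(y)\,R_k\big(q\,e^{ik\theta\cdot(\cdot)}\big)(y)\,dy\quad\text{if }\eta\in H_\theta,\qquad B_{\theta,2}(q)(\eta)=0\quad\text{if }\eta\notin H_\theta.$$ On the Fourier side this means, for $\eta\in H_\theta$, $$B_{\theta,2}(q)(\eta)=(2\pi)^{-n}\lim_{\varepsilon\to0^+}\int_{\mathbb{R}^n}\frac{\widehat q(k\theta'-\zeta)\,\widehat q(\zeta-k\theta)}{-|\zeta|^2+k^2+i\varepsilon}\,d\zeta.$$ The double dispersion operator of fixed angle scattering is defined by $\widehat{Q_{\theta,2}(q)}(\eta)=B_{\theta,2}(q)(\eta)+B_{-\theta,2}(q)(\eta)$, and that of full data scattering by averaging over all directions: $$\widehat{Q_{F,2}(q)}(\eta)=\frac{1}{|\mathbb{S}^{n-1}|}\int_{\mathbb{S}^{n-1}}\widehat{Q_{\theta,2}(q)}(\eta)\,d\sigma(\theta).$$ *)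

theory Defs
  imports "HOL-Analysis.Analysis"
begin

subsection \<open>Smooth functions and Schwartz functions\<close>

text \<open>A multi-index is a list of basis vectors; the last entry is differentiated first.\<close>

primrec partial_deriv :: "'a::euclidean_space list \<Rightarrow> ('a \<Rightarrow> complex) \<Rightarrow> 'a \<Rightarrow> complex" where
  "partial_deriv [] f = f"
| "partial_deriv (b # bs) f = (\<lambda>x. frechet_derivative (partial_deriv bs f) (at x) b)"

definition smooth :: "('a::euclidean_space \<Rightarrow> complex) \<Rightarrow> bool" where
  "smooth f \<longleftrightarrow> (\<forall>bs \<in> lists Basis. partial_deriv bs f differentiable_on UNIV)"

definition compactly_supported :: "('a::euclidean_space \<Rightarrow> 'b::zero) \<Rightarrow> bool" where
  "compactly_supported f \<longleftrightarrow> compact (closure {x. f x \<noteq> 0})"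

definition test_functions :: "('a::euclidean_space \<Rightarrow> complex) set" where
  "test_functions = {\<phi>. smooth \<phi> \<and> compactly_supported \<phi>}"

definition jbracket :: "'a::euclidean_space \<Rightarrow> real" where
  "jbracket x = (1 + (norm x)\<^sup>2) powr (1/2)"

definition schwartz :: "('a::euclidean_space \<Rightarrow> complex) set" where
  "schwartz = {\<phi>. smooth \<phi> \<and>
     (\<forall>bs \<in> lists Basis. \<forall>N::nat. bounded (range (\<lambda>x. of_real (jbracket x ^ N) * partial_deriv bs \<phi> x)))}"

definition schwartz_norm :: "nat \<Rightarrow> ('a::euclidean_space \<Rightarrow> complex) \<Rightarrow> real" where
  "schwartz_norm N \<phi> =
     (\<Sum>bs \<in> {bs. set bs \<subseteq> Basis \<and> length bs \<le> N}. SUP x. jbracket x ^ N * norm (partial_deriv bs \<phi> x))"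


subsection \<open>Tempered distributions\<close>

text \<open>Distributions are represented as functionals on all functions; only their values
  on Schwartz functions are meaningful.\<close>

type_synonym 'a dist = "('a \<Rightarrow> complex) \<Rightarrow> complex"

definition tempered_distributions :: "'a::euclidean_space dist set" where
  "tempered_distributions = {T.
     (\<forall>\<phi>\<in>schwartz. \<forall>\<psi>\<in>schwartz. T (\<lambda>x. \<phi> x + \<psi> x) = T \<phi> + T \<psi>) \<and>
     (\<forall>c. \<forall>\<phi>\<in>schwartz. T (\<lambda>x. c * \<phi> x) = c * T \<phi>) \<and>
     (\<exists>C N. \<forall>\<phi>\<in>schwartz. norm (T \<phi>) \<le> C * schwartz_norm N \<phi>)}"

definition fun_dist :: "('a::euclidean_space \<Rightarrow> complex) \<Rightarrow> 'a dist" where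
  "fun_dist f = (\<lambda>\<phi>. LINT x|lborel. f x * \<phi> x)"

definition mult_dist :: "('a::euclidean_space \<Rightarrow> complex) \<Rightarrow> 'a dist \<Rightarrow> 'a dist" where
  "mult_dist m T = (\<lambda>\<phi>. T (\<lambda>x. m x * \<phi> x))"

definition fourier :: "('a::euclidean_space \<Rightarrow> complex) \<Rightarrow> 'a \<Rightarrow> complex" where
  "fourier f \<xi> = (LINT x|lborel. exp (- (\<i> * of_real (x \<bullet> \<xi>))) * f x)"

definition inv_fourier :: "('a::euclidean_space \<Rightarrow> complex) \<Rightarrow> 'a \<Rightarrow> complex" where
  "inv_fourier f x = (LINT \<xi>|lborel. exp (\<i> * of_real (x \<bullet> \<xi>)) * f \<xi>) / of_real ((2 * pi) ^ DIM('a))"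

definition fourier_dist :: "'a::euclidean_space dist \<Rightarrow> 'a dist" where
  "fourier_dist T = (\<lambda>\<phi>. T (fourier \<phi>))"

definition inv_fourier_dist :: "'a::euclidean_space dist \<Rightarrow> 'a dist" where
  "inv_fourier_dist T = (\<lambda>\<phi>. T (inv_fourier \<phi>))"


subsection \<open>Sobolev spaces\<close>

definition is_L2_dist :: "'a::euclidean_space dist \<Rightarrow> bool" where
  "is_L2_dist T \<longleftrightarrow> (\<exists>u. u \<in> borel_measurable lborel \<and> integrable lborel (\<lambda>x. (norm (u x))\<^sup>2) \<and>
     (\<forall>\<phi>\<in>schwartz. T \<phi> = fun_dist u \<phi>))"

definition sobolev :: "real \<Rightarrow> 'a::euclidean_space dist set" where
  "sobolev \<alpha> = {T \<in> tempered_distributions.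
     is_L2_dist (mult_dist (\<lambda>\<xi>. of_real (jbracket \<xi> powr \<alpha>)) (fourier_dist T))}"

definition sobolev_loc :: "real \<Rightarrow> 'a::euclidean_space dist set" where
  "sobolev_loc \<alpha> = {T \<in> tempered_distributions. \<forall>\<phi>\<in>test_functions. mult_dist \<phi> T \<in> sobolev \<alpha>}"

text \<open>The integrability condition ensures that \<^term>\<open>fun_dist f\<close> is really given by
  integration against \<^term>\<open>f\<close>, as the Bochner integral of a non-integrable function is 0.\<close>

definition sobolev_fun :: "real \<Rightarrow> ('a::euclidean_space \<Rightarrow> complex) set" where
  "sobolev_fun \<alpha> = {f. (\<forall>\<phi>\<in>schwartz. integrable lborel (\<lambda>x. f x * \<phi> x)) \<and> fun_dist f \<in> sobolev \<alpha>}"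

definition radial :: "('a::euclidean_space \<Rightarrow> 'b) \<Rightarrow> bool" where
  "radial f \<longleftrightarrow> (\<forall>x y. norm x = norm y \<longrightarrow> f x = f y)"


subsection \<open>Double dispersion operators\<close>

text \<open>Surface measure on the unit sphere by polar coordinates: the measure of a set \<open>A\<close> is
  \<open>n\<close> times the volume of the cone \<open>{r \<omega> | \<omega> \<in> A, 0 < r < 1}\<close>.
  Note \<^term>\<open>sgn x = x /\<^sub>R norm x\<close>; the extra point \<^term>\<open>sgn 0 = 0\<close> has measure 0.\<close>

definition surface_measure :: "'a::euclidean_space measure" where
  "surface_measure =
     scale_measure (of_nat DIM('a)) (distr (restrict_space lborel (ball 0 1)) borel sgn)"

definition half_space :: "'a::euclidean_space \<Rightarrow> 'a set" where
  "half_space \<theta> = {\<eta>. \<eta> \<bullet> \<theta> < 0}"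

definition wave_number :: "'a::euclidean_space \<Rightarrow> 'a \<Rightarrow> real" where
  "wave_number \<eta> \<theta> = - ((norm \<eta>)\<^sup>2 / (2 * (\<theta> \<bullet> \<eta>)))"

definition out_direction :: "'a::euclidean_space \<Rightarrow> 'a \<Rightarrow> 'a" where
  "out_direction \<eta> \<theta> = (1 / wave_number \<eta> \<theta>) *\<^sub>R (\<eta> + wave_number \<eta> \<theta> *\<^sub>R \<theta>)"

text \<open>The integral of \<open>exp (-i k \<theta>' \<cdot> y) q(y) R\<^sub>k(q exp (i k \<theta> \<cdot> _))(y)\<close> over \<open>y\<close>, written on the
  Fourier side, where the outgoing resolvent \<open>R\<^sub>k\<close> is the multiplier
  \<open>(-|\<zeta>|\<^sup>2 + k\<^sup>2 + i0)\<^sup>-\<^sup>1\<close>, the limit of \<open>(-|\<zeta>|\<^sup>2 + k\<^sup>2 + i\<epsilon>)\<^sup>-\<^sup>1\<close> for \<open>\<epsilon> \<rightarrow> 0\<^sup>+\<close>.\<close>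

definition B2 :: "'a::euclidean_space \<Rightarrow> ('a \<Rightarrow> complex) \<Rightarrow> 'a \<Rightarrow> complex" where
  "B2 \<theta> q \<eta> =
     (if \<eta> \<in> half_space \<theta> then
        let k = wave_number \<eta> \<theta>; \<theta>' = out_direction \<eta> \<theta> in
        Lim (at_right 0) (\<lambda>\<epsilon>::real.
          LINT \<zeta>|lborel. fourier q (k *\<^sub>R \<theta>' - \<zeta>) * fourier q (\<zeta> - k *\<^sub>R \<theta>)
            / (of_real (- (norm \<zeta>)\<^sup>2 + k\<^sup>2) + \<i> * of_real \<epsilon>))
        / of_real ((2 * pi) ^ DIM('a))
      else 0)"

definition Q_fixed_hat :: "'a::euclidean_space \<Rightarrow> ('a \<Rightarrow> complex) \<Rightarrow> 'a \<Rightarrow> complex" where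
  "Q_fixed_hat \<theta> q \<eta> = B2 \<theta> q \<eta> + B2 (- \<theta>) q \<eta>"

definition Q_full_hat :: "('a::euclidean_space \<Rightarrow> complex) \<Rightarrow> 'a \<Rightarrow> complex" where
  "Q_full_hat q \<eta> =
     (LINT \<theta>:sphere 0 1|surface_measure. Q_fixed_hat \<theta> q \<eta>)
       / of_real (measure (surface_measure :: 'a measure) (sphere 0 1))"

definition Q_fixed :: "'a::euclidean_space \<Rightarrow> ('a \<Rightarrow> complex) \<Rightarrow> 'a dist" where
  "Q_fixed \<theta> q = inv_fourier_dist (fun_dist (Q_fixed_hat \<theta> q))"

definition Q_full :: "('a::euclidean_space \<Rightarrow> complex) \<Rightarrow> 'a dist" where
  "Q_full q = inv_fourier_dist (fun_dist (Q_full_hat q))"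

end

theory Submission
  imports Defs
begin

text \<open>Let \<open>n\<close> be the dimension and \<open>s = \<beta> + n/2\<close>. The potential is chosen so that its Fourier
  transform \<open>Q\<close> is real, strictly positive and comparable to \<open>\<langle>\<xi>\<rangle>\<^sup>-\<^sup>s\<close>. Such a potential lies in
  \<open>W\<^sup>\<gamma>\<^sup>,\<^sup>2\<close> for \<open>\<gamma> < \<beta>\<close>. It is an average of \<open>L\<^sup>1\<close>-normalised dilates of a self-convolution \<open>\<chi> * \<chi>\<close>,
  where \<open>\<chi>\<close> is a radial bump; the Fourier transform of \<open>\<chi> * \<chi>\<close> is a square, which gives
  positivity, and the dilates give the decay (\<open>potential_hat_bounds\<close>).

  That the double dispersion operators are not smoother than claimed is a matter of signs.
  The imaginary part of the outgoing multiplier \<open>(k\<^sup>2 - |\<zeta>|\<^sup>2 + i0)\<^sup>-\<^sup>1\<close> is \<open>-\<pi>\<close> times the delta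
  function of \<open>k\<^sup>2 - |\<zeta>|\<^sup>2\<close>. As \<open>Q\<close> is positive, the imaginary part of \<open>B\<^sub>\<theta>\<^sub>,\<^sub>2(\<eta>)\<close> is a negative
  multiple of \<open>k\<^sup>n\<^sup>-\<^sup>2\<close> times the integral of \<open>Q(k\<theta>' - k\<omega>) Q(k\<omega> - k\<theta>)\<close> over the unit sphere. It
  is nonpositive for every \<open>\<eta>\<close> and \<open>\<theta>\<close>, so nothing can cancel: neither in the sum over \<open>\<plusminus>\<theta>\<close>, nor
  in the average over all directions, nor in a convolution with a nonnegative function.

  Where \<open>k\<close> is comparable to \<open>|\<eta>|\<close>, two parts of the sphere bound this integral from below
  (\<open>born_limit\<close>). On the part where \<open>k\<omega>\<close> is within unit distance of \<open>k\<theta>\<close> one factor is bounded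
  below and the other one is comparable to \<open>|\<eta>|\<^sup>-\<^sup>s\<close>, which contributes \<open>|\<eta>|\<^sup>-\<^sup>1\<^sup>-\<^sup>s\<close>. On the
  whole sphere both factors are at least a multiple of \<open>k\<^sup>-\<^sup>s\<close>, which contributes
  \<open>|\<eta>|\<^sup>n\<^sup>-\<^sup>2\<^sup>-\<^sup>2\<^sup>s\<close>. The larger of the two is \<open>|\<eta>|\<close> to the power \<open>-\<alpha>\<^sub>0 - n/2\<close>.

  The limit defining \<open>B\<^sub>\<theta>\<^sub>,\<^sub>2\<close> must also exist and be controlled, since otherwise integrating
  it against a rapidly decreasing function makes no sense. This is \<open>limiting_absorption\<close>,
  which gives the bound \<open>C (1 + 1/k)\<close>. Since \<open>k \<ge> |\<eta>|/2\<close>, it is uniform as \<open>k\<close> tends to infinity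
  at the boundary of the half space and locally integrable at \<open>\<eta> = 0\<close>, because \<open>n \<ge> 2\<close>.

  Finally, \<open>not_in_sobolev_loc\<close> localises with the test function \<open>\<chi> * \<chi>\<close>. On the Fourier side
  this is convolution with a nonnegative function and preserves both the sign and the size
  of the imaginary part. If the localised distribution were in \<open>W\<^sup>\<alpha>\<^sup>,\<^sup>2\<close>, pairing it with a
  bump of size \<open>R\<close> at distance \<open>R\<close> from the origin would give at least a multiple of \<open>R\<close> to the
  power \<open>\<alpha> - \<alpha>\<^sub>0 + n/2\<close>, but only \<open>o(R\<^sup>n\<^sup>/\<^sup>2)\<close> because the tail of an \<open>L\<^sup>2\<close> function has small
  norm. Hence \<open>\<alpha> < \<alpha>\<^sub>0\<close>.\<close>

section \<open>Integration in polar coordinates\<close>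

lemma nn_integral_lborel_affine:
  fixes f :: "'a::euclidean_space \<Rightarrow> ennreal"
  assumes [measurable]: "f \<in> borel_measurable borel" and c: "c \<noteq> 0"
  shows "(\<integral>\<^sup>+x. f x \<partial>lborel) = ennreal (\<bar>c\<bar> ^ DIM('a)) * (\<integral>\<^sup>+x. f (t + c *\<^sub>R x) \<partial>lborel)"
  by (subst lborel_affine[OF c, of t])
     (simp add: nn_integral_density nn_integral_distr nn_integral_cmult)

lemma sgn_measurable_euclidean [measurable]: "(sgn :: 'a::euclidean_space \<Rightarrow> 'a) \<in> borel_measurable borel"
  unfolding sgn_div_norm by measurable

lemma sets_surface_measure [simp, measurable_cong]:
  "sets (surface_measure :: 'a::euclidean_space measure) = sets borel"
  by (simp add: surface_measure_def)

lemma space_surface_measure [simp]: "space (surface_measure :: 'a::euclidean_space measure) = UNIV"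
  by (simp add: surface_measure_def space_scale_measure)

lemma nn_integral_surface_measure:
  fixes f :: "'a::euclidean_space \<Rightarrow> ennreal"
  assumes [measurable]: "f \<in> borel_measurable borel"
  shows "(\<integral>\<^sup>+x. f x \<partial>surface_measure)
    = ennreal (real DIM('a)) * (\<integral>\<^sup>+x. f (sgn x) * indicator (ball 0 1) x \<partial>lborel)"
proof -
  have [measurable]: "sgn \<in> measurable (restrict_space lborel (ball (0::'a) 1)) borel"
    by (rule measurable_restrict_space1) simp
  have "(\<integral>\<^sup>+x. f x \<partial>surface_measure) = of_nat DIM('a) * (\<integral>\<^sup>+x. f x \<partial>distr (restrict_space lborel (ball 0 1)) borel sgn)"
    unfolding surface_measure_def by (rule nn_integral_scale_measure) simp
  also have "(\<integral>\<^sup>+x. f x \<partial>distr (restrict_space lborel (ball 0 1)) borel sgn) = (\<integral>\<^sup>+x. f (sgn x) * indicator (ball 0 1) x \<partial>lborel)"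
    by (subst nn_integral_distr) (auto simp: nn_integral_restrict_space)
  finally show ?thesis by (simp add: ennreal_of_nat_eq_real_of_nat)
qed

lemma nn_integral_inverse_power_tail:
  fixes a :: real assumes "a > 0" "n > (0::nat)"
  shows "(\<integral>\<^sup>+t. ennreal (real n / t ^ (n + 1)) * indicator {a<..} t \<partial>lborel) = ennreal (1 / a ^ n)"
proof -
  have "(\<integral>\<^sup>+t. ennreal (real n / t ^ (n + 1)) * indicator {a<..} t \<partial>lborel)
      = (\<integral>\<^sup>+t. ennreal (real n / t ^ (n + 1)) * indicator {a..} t \<partial>lborel)"
    by (rule nn_integral_cong_AE) (use AE_lborel_singleton[of a] in eventually_elim, auto split: split_indicator)
  also have "\<dots> = ennreal (0 - (- (1 / a ^ n)))"
  proof (rule nn_integral_FTC_atLeast)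
    show "((\<lambda>t. - (1 / t ^ n)) has_real_derivative real n / x ^ (n + 1)) (at x)" if "a \<le> x" for x
      using that assms by (auto intro!: derivative_eq_intros simp: field_simps power_eq_if[of _ "2*n"] mult_2_right power_add[symmetric] simp flip: power_Suc)
    show "((\<lambda>t::real. - (1 / t ^ n)) \<longlongrightarrow> 0) at_top"
    proof -
      have "((\<lambda>t. (inverse t)^n) \<longlongrightarrow> (0::real)^n) at_top"
        by (intro tendsto_intros tendsto_inverse_0_at_top filterlim_ident)
      then have "((\<lambda>t. - ((inverse t)^n)) \<longlongrightarrow> - ((0::real)^n)) at_top" by (rule tendsto_minus)
      then show ?thesis using assms by (simp add: power_inverse inverse_eq_divide power_one_over zero_power)
    qed
  qed (use assms in auto)
  finally show ?thesis by simp
qed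

text \<open>The surface measure is the distribution of the direction of a point \<open>x\<close> of the unit ball,
  so the right-hand side is an integral over \<open>r\<close> and \<open>x\<close>. For fixed \<open>x\<close>, the substitution \<open>r = t|x|\<close>
  turns \<open>f (r sgn x)\<close> into \<open>f (t x)\<close>. For fixed \<open>t\<close>, the substitution \<open>y = t x\<close> then leaves in front
  of \<open>f y\<close> the product of \<open>|y|\<^sup>n\<close> and the integral of \<open>n t\<^sup>-\<^sup>n\<^sup>-\<^sup>1\<close> over \<open>t > |y|\<close>, which is 1.\<close>

theorem nn_integral_polar:
  fixes f :: "'a::euclidean_space \<Rightarrow> ennreal"
  assumes [measurable]: "f \<in> borel_measurable borel"
  shows "(\<integral>\<^sup>+x. f x \<partial>lborel) =
    (\<integral>\<^sup>+r. ennreal (r ^ (DIM('a) - 1)) * indicator {0<..} r * (\<integral>\<^sup>+\<omega>. f (r *\<^sub>R \<omega>) \<partial>surface_measure) \<partial>lborel)"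
proof -
  define n where "n = DIM('a)"
  have n: "n > 0" by (simp add: n_def)
  have [measurable]: "ball (0::'a) 1 \<in> sets borel" by simp
  define p where "p r = ennreal (r ^ (n - 1)) * indicator {0<..} r" for r :: real
  have [measurable]: "p \<in> borel_measurable borel" unfolding p_def by measurable
  have "(\<integral>\<^sup>+r. p r * (\<integral>\<^sup>+\<omega>. f (r *\<^sub>R \<omega>) \<partial>surface_measure) \<partial>lborel)
    = (\<integral>\<^sup>+r. (\<integral>\<^sup>+x. ennreal (real n) * p r * f (r *\<^sub>R sgn x) * indicator (ball 0 1) x \<partial>lborel) \<partial>lborel)"
  proof (rule nn_integral_cong)
    fix r :: real
    have "(\<integral>\<^sup>+x. ennreal (real n) * p r * f (r *\<^sub>R sgn x) * indicator (ball 0 1) x \<partial>lborel)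
      = ennreal (real n) * p r * (\<integral>\<^sup>+x. f (r *\<^sub>R sgn x) * indicator (ball 0 1) x \<partial>lborel)"
      by (subst nn_integral_cmult[symmetric]) (simp_all add: mult.assoc)
    then show "p r * (\<integral>\<^sup>+\<omega>. f (r *\<^sub>R \<omega>) \<partial>surface_measure)
      = (\<integral>\<^sup>+x. ennreal (real n) * p r * f (r *\<^sub>R sgn x) * indicator (ball 0 1) x \<partial>lborel)"
      by (simp add: nn_integral_surface_measure n_def mult_ac)
  qed
  also have "\<dots> = (\<integral>\<^sup>+x. (\<integral>\<^sup>+r. ennreal (real n) * p r * f (r *\<^sub>R sgn x) * indicator (ball 0 1) x \<partial>lborel) \<partial>(lborel :: 'a measure))"
    by (rule lborel_pair.Fubini') measurable
  also have "\<dots> = (\<integral>\<^sup>+x. (\<integral>\<^sup>+t. ennreal (real n) * p t * ennreal (norm x ^ n) * f (t *\<^sub>R x) * indicator (ball 0 1) x \<partial>lborel) \<partial>(lborel :: 'a measure))"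
  proof (rule nn_integral_cong_AE, use AE_lborel_singleton[of 0] in eventually_elim)
    fix x :: 'a assume x: "x \<noteq> 0"
    have p: "ennreal (norm x) * p (norm x * t) = ennreal (norm x ^ n) * p t" for t
    proof (cases "t > 0")
      case True
      have "norm x * (norm x * t) ^ (n - 1) = norm x ^ n * t ^ (n - 1)"
        using n by (cases n) (auto simp: power_mult_distrib)
      with True x show ?thesis by (simp add: p_def ennreal_mult''[symmetric] zero_less_mult_iff)
    next
      case False
      with x show ?thesis by (simp add: p_def zero_less_mult_iff)
    qed
    have "(\<integral>\<^sup>+r. ennreal (real n) * p r * f (r *\<^sub>R sgn x) * indicator (ball 0 1) x \<partial>lborel)
      = ennreal \<bar>norm x\<bar> * (\<integral>\<^sup>+t. ennreal (real n) * p (0 + norm x * t) * f ((0 + norm x * t) *\<^sub>R sgn x) * indicator (ball 0 1) x \<partial>lborel)"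
      by (rule nn_integral_real_affine) (use x in auto)
    also have "\<dots> = (\<integral>\<^sup>+t. ennreal (real n) * (ennreal (norm x) * p (norm x * t)) * f (t *\<^sub>R x) * indicator (ball 0 1) x \<partial>lborel)"
      by (subst nn_integral_cmult[symmetric]) (use x in \<open>simp_all add: sgn_div_norm mult_ac\<close>)
    finally show "(\<integral>\<^sup>+r. ennreal (real n) * p r * f (r *\<^sub>R sgn x) * indicator (ball 0 1) x \<partial>lborel)
      = (\<integral>\<^sup>+t. ennreal (real n) * p t * ennreal (norm x ^ n) * f (t *\<^sub>R x) * indicator (ball 0 1) x \<partial>lborel)"
      unfolding p by (simp only: mult_ac)
  qed
  also have "\<dots> = (\<integral>\<^sup>+t. (\<integral>\<^sup>+x. ennreal (real n) * p t * ennreal (norm x ^ n) * f (t *\<^sub>R x) * indicator (ball 0 1) x \<partial>(lborel :: 'a measure)) \<partial>lborel)"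
    by (rule lborel_pair.Fubini'[symmetric]) measurable
  also have "\<dots> = (\<integral>\<^sup>+t. (\<integral>\<^sup>+y. ennreal (real n / t ^ (n + 1)) * (if norm y < t then 1 else 0) * (ennreal (norm y ^ n) * f y) \<partial>(lborel :: 'a measure)) \<partial>lborel)"
  proof (rule nn_integral_cong)
    fix t :: real
    show "(\<integral>\<^sup>+x. ennreal (real n) * p t * ennreal (norm x ^ n) * f (t *\<^sub>R x) * indicator (ball 0 1) x \<partial>(lborel :: 'a measure))
      = (\<integral>\<^sup>+y. ennreal (real n / t ^ (n + 1)) * (if norm y < t then 1 else 0) * (ennreal (norm y ^ n) * f y) \<partial>(lborel :: 'a measure))"
    proof (cases "t > 0")
      case False
      then have "\<not> norm y < t" for y :: 'a using norm_ge_zero[of y] by linarith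
      with False show ?thesis by (simp add: p_def)
    next
      case True
      have "(\<integral>\<^sup>+y. ennreal (real n / t ^ (n + 1)) * (if norm y < t then 1 else 0) * (ennreal (norm y ^ n) * f y) \<partial>(lborel :: 'a measure))
        = ennreal (\<bar>t\<bar> ^ DIM('a)) * (\<integral>\<^sup>+y. ennreal (real n / t ^ (n + 1)) * (if norm (0 + t *\<^sub>R y) < t then 1 else 0) * (ennreal (norm (0 + t *\<^sub>R y) ^ n) * f (0 + t *\<^sub>R y)) \<partial>(lborel :: 'a measure))"
        by (rule nn_integral_lborel_affine) (use True in auto)
      also have "\<dots> = (\<integral>\<^sup>+y. (ennreal (t ^ n) * ennreal (real n / t ^ (n + 1))) * (if norm (t *\<^sub>R y) < t then 1 else 0) * (ennreal (norm (t *\<^sub>R y) ^ n) * f (t *\<^sub>R y)) \<partial>(lborel :: 'a measure))"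
        by (subst nn_integral_cmult[symmetric]) (use True in \<open>simp_all add: n_def mult.assoc\<close>)
      also have "\<dots> = (\<integral>\<^sup>+x. ennreal (real n) * p t * ennreal (norm x ^ n) * f (t *\<^sub>R x) * indicator (ball 0 1) x \<partial>(lborel :: 'a measure))"
      proof (rule nn_integral_cong)
        fix y :: 'a
        have "ennreal (t ^ n) * ennreal (real n / t ^ (n + 1)) * ennreal (norm (t *\<^sub>R y) ^ n) = ennreal (real n) * ennreal (t ^ (n - 1)) * ennreal (norm y ^ n)"
        proof -
          obtain m where m: "n = Suc m" using n by (cases n) auto
          have "t ^ n * (real n / t ^ (n + 1)) * norm (t *\<^sub>R y) ^ n = real n * t ^ (n - 1) * norm y ^ n"
            using True unfolding m by (simp add: power_mult_distrib)
          moreover have "0 \<le> t ^ n * (real n / t ^ (n + 1))" "0 \<le> real n * t ^ (n - 1)" using True by auto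
          ultimately show ?thesis
            using True by ((subst ennreal_mult[symmetric], simp, simp)+, simp only:)
        qed
        moreover have "(if norm (t *\<^sub>R y) < t then 1 else 0) = (indicator (ball 0 1) y :: ennreal)"
          using True by (auto split: split_indicator)
        moreover have "p t = ennreal (t ^ (n - 1))" using True by (simp add: p_def)
        moreover have "(A * B) * D * (E * F) = (A * B * E) * D * F" for A B D E F :: ennreal by (simp only: mult_ac)
        moreover have "n' * q * N * F * D = (n' * q * N) * D * F" for n' q N D F :: ennreal by (simp only: mult_ac)
        ultimately show "(ennreal (t ^ n) * ennreal (real n / t ^ (n + 1))) * (if norm (t *\<^sub>R y) < t then 1 else 0) * (ennreal (norm (t *\<^sub>R y) ^ n) * f (t *\<^sub>R y))
          = ennreal (real n) * p t * ennreal (norm y ^ n) * f (t *\<^sub>R y) * indicator (ball 0 1) y"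
          by simp
      qed
      finally show ?thesis by simp
    qed
  qed
  also have "\<dots> = (\<integral>\<^sup>+y. (\<integral>\<^sup>+t. ennreal (real n / t ^ (n + 1)) * (if norm y < t then 1 else 0) * (ennreal (norm y ^ n) * f y) \<partial>lborel) \<partial>(lborel :: 'a measure))"
    by (rule lborel_pair.Fubini') measurable
  also have "\<dots> = (\<integral>\<^sup>+y. f y \<partial>lborel)"
  proof (rule nn_integral_cong_AE, use AE_lborel_singleton[of 0] in eventually_elim)
    fix y :: 'a assume y: "y \<noteq> 0"
    have "(\<integral>\<^sup>+t. ennreal (real n / t ^ (n + 1)) * (if norm y < t then 1 else 0) * (ennreal (norm y ^ n) * f y) \<partial>lborel)
      = ennreal (1 / norm y ^ n) * (ennreal (norm y ^ n) * f y)"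
      using nn_integral_inverse_power_tail[of "norm y" n] y n
      by (subst nn_integral_multc) (auto simp: indicator_def of_bool_def)
    also have "\<dots> = f y" using y by (simp add: mult.assoc[symmetric] ennreal_mult''[symmetric])
    finally show "(\<integral>\<^sup>+t. ennreal (real n / t ^ (n + 1)) * (if norm y < t then 1 else 0) * (ennreal (norm y ^ n) * f y) \<partial>lborel) = f y" .
  qed
  finally show ?thesis by (simp add: p_def n_def)
qed

section \<open>An algebra of smooth cut-off functions\<close>

text \<open>All powers \<open>m\<close> are needed because differentiation raises \<open>m\<close>.\<close>

definition flat :: "nat \<Rightarrow> real \<Rightarrow> real" where
  "flat m t = (if t \<le> 0 then 0 else exp (- inverse t) * inverse t ^ m)"

lemma power_le_fact_exp: "x ^ k \<le> fact k * exp x" if "x \<ge> 0" for x :: real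
proof -
  have "x ^ k /\<^sub>R fact k \<le> exp x"
    unfolding exp_def using sum_le_suminf[OF summable_exp_generic[of x], of "{k}"] that by simp
  then show ?thesis by (simp add: field_simps)
qed

lemma flat_nonneg: "0 \<le> flat m t" by (simp add: flat_def)

text \<open>The quadratic bound makes the difference quotients at \<open>t = 0\<close>, the only critical point,
  tend to 0.\<close>

lemma flat_le_square: "flat m t \<le> fact (m + 2) * t\<^sup>2"
proof (cases "t > 0")
  case True
  have "(1 / t) ^ (m + 2) \<le> fact (m + 2) * exp (1 / t)" by (rule power_le_fact_exp) (use True in auto)
  then have "exp (- (1 / t)) * ((1 / t) ^ (m + 2)) \<le> exp (- (1 / t)) * (fact (m + 2) * exp (1 / t))"
    by (intro mult_left_mono) auto
  also have "\<dots> = fact (m + 2)" by (simp add: exp_minus field_simps)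
  finally have "exp (- (1 / t)) * ((1 / t) ^ (m + 2)) * t\<^sup>2 \<le> fact (m + 2) * t\<^sup>2"
    by (intro mult_right_mono) auto
  moreover have "exp (- (1 / t)) * ((1 / t) ^ (m + 2)) * t\<^sup>2 = flat m t"
    using True by (simp add: flat_def power_add power2_eq_square inverse_eq_divide)
  ultimately show ?thesis by simp
qed (simp add: flat_def)

lemma flat_DERIV: "(flat m has_real_derivative flat (m + 2) t - real m * flat (m + 1) t) (at t)"
proof (cases t "0 :: real" rule: linorder_cases)
  case less
  have "((\<lambda>_. 0) has_real_derivative flat (m + 2) t - real m * flat (m + 1) t) (at t)"
    using less by (simp add: flat_def)
  then show ?thesis
    by (rule has_field_derivative_transform_within_open[where S = "{..<0}"]) (use less in \<open>auto simp: flat_def\<close>)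
next
  case greater
  have "((\<lambda>t. exp (- inverse t) * inverse t ^ m) has_real_derivative flat (m + 2) t - real m * flat (m + 1) t) (at t)"
  proof -
    have "((\<lambda>t. exp (- inverse t) * inverse t ^ m) has_real_derivative
       exp (- inverse t) * (inverse t)\<^sup>2 * inverse t ^ m
        - exp (- inverse t) * (real m * inverse t ^ (m - 1) * (inverse t)\<^sup>2)) (at t)"
      using greater by (auto intro!: derivative_eq_intros simp: power2_eq_square)
    also have "exp (- inverse t) * (inverse t)\<^sup>2 * inverse t ^ m
        - exp (- inverse t) * (real m * inverse t ^ (m - 1) * (inverse t)\<^sup>2)
      = flat (m + 2) t - real m * flat (m + 1) t"
      using greater by (cases m) (simp_all add: flat_def power2_eq_square algebra_simps)
    finally show ?thesis .
  qed
  then show ?thesis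
    by (rule has_field_derivative_transform_within_open[where S = "{0<..}"]) (use greater in \<open>auto simp: flat_def\<close>)
next
  case equal
  have "(\<lambda>h. (flat m (0 + h) - flat m 0) / h) \<midarrow>0\<rightarrow> 0"
  proof (rule Lim_null_comparison)
    show "\<forall>\<^sub>F h in at 0. norm ((flat m (0 + h) - flat m 0) / h) \<le> fact (m + 2) * \<bar>h\<bar>"
    proof (intro always_eventually allI)
      fix h :: real
      have "\<bar>flat m h\<bar> \<le> fact (m + 2) * h\<^sup>2" using flat_le_square[of m h] flat_nonneg[of m h] by simp
      then have "\<bar>flat m h\<bar> / \<bar>h\<bar> \<le> fact (m + 2) * h\<^sup>2 / \<bar>h\<bar>" by (intro divide_right_mono) auto
      also have "\<dots> = fact (m + 2) * \<bar>h\<bar>" by (cases "h = 0") (auto simp: power2_eq_square abs_if field_simps)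
      finally show "norm ((flat m (0 + h) - flat m 0) / h) \<le> fact (m + 2) * \<bar>h\<bar>" by (simp add: flat_def)
    qed
    show "(\<lambda>h. fact (m + 2) * \<bar>h\<bar>) \<midarrow>0\<rightarrow> (0::real)" by (auto intro!: tendsto_eq_intros)
  qed
  then show ?thesis using equal by (simp add: DERIV_def flat_def)
qed

text \<open>To show that a function is smooth, it suffices to place it in a class of differentiable
  functions that is stable under partial derivatives. By the chain rule, a derivative of a
  cut-off profile is a combination of two further profiles with affine coefficients; closing
  under sums and products therefore gives such a class.\<close>

inductive_set flat_algebra :: "('a::euclidean_space \<Rightarrow> complex) set" where
  const: "(\<lambda>x. c) \<in> flat_algebra"
| coord: "(\<lambda>x. of_real (x \<bullet> b)) \<in> flat_algebra"
| cutoff: "(\<lambda>x. of_real (flat m (1 - c * (norm (x - a))\<^sup>2))) \<in> flat_algebra"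
| add: "f \<in> flat_algebra \<Longrightarrow> g \<in> flat_algebra \<Longrightarrow> (\<lambda>x. f x + g x) \<in> flat_algebra"
| mult: "f \<in> flat_algebra \<Longrightarrow> g \<in> flat_algebra \<Longrightarrow> (\<lambda>x. f x * g x) \<in> flat_algebra"

lemma flat_algebra_derivative:
  assumes "f \<in> flat_algebra"
  shows "\<exists>D. (\<forall>x. (f has_derivative D x) (at x)) \<and> (\<forall>b. (\<lambda>x. D x b) \<in> flat_algebra)"
  using assms
proof induction
  case (const c)
  show ?case by (rule exI[of _ "\<lambda>x h. 0"]) (auto intro: flat_algebra.const)
next
  case (coord b)
  show ?case by (rule exI[of _ "\<lambda>x h. of_real (h \<bullet> b)"]) (auto intro!: flat_algebra.const derivative_eq_intros)
next
  case (cutoff m c a)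
  let ?u = "\<lambda>x. 1 - c * (norm (x - a))\<^sup>2"
  let ?D = "\<lambda>x h. (complex_of_real (flat (m + 2) (?u x)) + of_real (- real m) * of_real (flat (m + 1) (?u x)))
       * (of_real (- (2 * c)) * of_real (x \<bullet> h) + of_real (2 * c * (a \<bullet> h)))"
  have u: "(?u has_derivative (\<lambda>h. - (2 * c) * ((x - a) \<bullet> h))) (at x)" for x
    unfolding power2_norm_eq_inner
    by (auto intro!: derivative_eq_intros ext simp: inner_commute)
  show ?case
  proof (rule exI[of _ ?D], intro conjI allI)
    fix x :: 'a
    have "((\<lambda>x. flat m (?u x)) has_derivative
        (\<lambda>h. (- (2 * c) * ((x - a) \<bullet> h)) * (flat (m + 2) (?u x) - real m * flat (m + 1) (?u x)))) (at x)"
      using has_derivative_compose[OF u flat_DERIV[unfolded has_field_derivative_def]] by (simp add: mult.commute)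
    from has_derivative_of_real[OF this]
    have "((\<lambda>x. complex_of_real (flat m (?u x))) has_derivative
        (\<lambda>h. complex_of_real ((- (2 * c) * ((x - a) \<bullet> h)) * (flat (m + 2) (?u x) - real m * flat (m + 1) (?u x))))) (at x)" .
    also have "(\<lambda>h. complex_of_real ((- (2 * c) * ((x - a) \<bullet> h)) * (flat (m + 2) (?u x) - real m * flat (m + 1) (?u x)))) = ?D x"
      by (rule ext) (simp add: inner_diff_left algebra_simps)
    finally show "((\<lambda>x. complex_of_real (flat m (?u x))) has_derivative ?D x) (at x)" .
  next
    fix b
    show "(\<lambda>x. ?D x b) \<in> flat_algebra" by (intro flat_algebra.intros)
  qed
next
  case (add f g)
  then obtain D E where "\<forall>x. (f has_derivative D x) (at x)" "\<forall>b. (\<lambda>x. D x b) \<in> flat_algebra"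
    "\<forall>x. (g has_derivative E x) (at x)" "\<forall>b. (\<lambda>x. E x b) \<in> flat_algebra" by blast
  then show ?case by (intro exI[of _ "\<lambda>x h. D x h + E x h"]) (auto intro!: flat_algebra.add has_derivative_add)
next
  case (mult f g)
  then obtain D E where *: "\<forall>x. (f has_derivative D x) (at x)" "\<forall>b. (\<lambda>x. D x b) \<in> flat_algebra"
    "\<forall>x. (g has_derivative E x) (at x)" "\<forall>b. (\<lambda>x. E x b) \<in> flat_algebra" by blast
  show ?case
    by (rule exI[of _ "\<lambda>x h. f x * E x h + D x h * g x"])
       (use * mult in \<open>auto intro!: flat_algebra.add flat_algebra.mult has_derivative_mult\<close>)
qed

lemma partial_deriv_flat_algebra:
  assumes "f \<in> flat_algebra"
  shows "partial_deriv bs f \<in> flat_algebra"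
proof (induction bs)
  case (Cons b bs)
  then obtain D where D: "\<forall>x. (partial_deriv bs f has_derivative D x) (at x)" "\<forall>b. (\<lambda>x. D x b) \<in> flat_algebra"
    using flat_algebra_derivative by blast
  then have "frechet_derivative (partial_deriv bs f) (at x) = D x" for x
    using frechet_derivative_at by metis
  with D show ?case by simp
qed (use assms in simp)

lemma flat_algebra_differentiable: "f \<in> flat_algebra \<Longrightarrow> f differentiable (at x)"
  using flat_algebra_derivative differentiable_def by blast

lemma flat_algebra_continuous: "f \<in> flat_algebra \<Longrightarrow> continuous_on S f"
  by (meson flat_algebra_differentiable differentiable_imp_continuous_within continuous_at_imp_continuous_on)

lemma flat_algebra_smooth: "f \<in> flat_algebra \<Longrightarrow> smooth f"
  unfolding smooth_def differentiable_on_def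
  using partial_deriv_flat_algebra flat_algebra_differentiable by (metis iso_tuple_UNIV_I)

lemma frechet_derivative_flat_algebra:
  assumes "f \<in> flat_algebra"
  shows "(f has_derivative (\<lambda>h. frechet_derivative f (at x) h)) (at x)"
    and "(\<lambda>x. frechet_derivative f (at x) b) \<in> flat_algebra"
  using flat_algebra_differentiable[OF assms] frechet_derivative_works partial_deriv_flat_algebra[OF assms, of "[b]"]
  by auto

lemma partial_deriv_eq_0_outside:
  fixes f :: "'a::euclidean_space \<Rightarrow> complex"
  assumes "\<And>x. R < norm x \<Longrightarrow> f x = 0" "R < norm x"
  shows "partial_deriv bs f x = 0"
  using assms(2)
proof (induction bs arbitrary: x)
  case (Cons b bs)
  have "open {x::'a. R < norm x}" by (intro open_Collect_less continuous_intros)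
  then have "(partial_deriv bs f has_derivative (\<lambda>_. 0)) (at x)"
    using Cons by (intro has_derivative_transform_within_open[OF has_derivative_const[of 0]]) auto
  then have "frechet_derivative (partial_deriv bs f) (at x) = (\<lambda>_. 0)" using frechet_derivative_at by metis
  then show ?case by simp
qed (use assms in simp)

lemma bounded_range_compact_support:
  fixes f :: "'a::euclidean_space \<Rightarrow> 'b::real_normed_vector"
  assumes "continuous_on UNIV f" "\<And>x. R < norm x \<Longrightarrow> f x = 0"
  shows "bounded (range f)"
proof -
  have "bounded (f ` cball 0 R)"
    by (intro compact_imp_bounded compact_continuous_image continuous_on_subset[OF assms(1)]) auto
  then have "bounded (insert 0 (f ` cball 0 R))" by simp
  moreover have "range f \<subseteq> insert 0 (f ` cball 0 R)"
    using assms(2) by (force simp: not_le[symmetric])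
  ultimately show ?thesis by (rule bounded_subset)
qed

lemma integrable_compact_support:
  fixes f :: "'a::euclidean_space \<Rightarrow> 'b::euclidean_space"
  assumes "continuous_on UNIV f" "\<And>x. R < norm x \<Longrightarrow> f x = 0"
  shows "integrable lborel f"
proof -
  have "integrable lborel (\<lambda>x. indicator (cball 0 R) x *\<^sub>R f x)"
    by (rule borel_integrable_compact) (use continuous_on_subset[OF assms(1)] in auto)
  moreover have "(\<lambda>x. indicator (cball 0 R) x *\<^sub>R f x) = f"
    using assms(2) by (auto simp: fun_eq_iff not_le[symmetric] split: split_indicator)
  ultimately show ?thesis by simp
qed

lemma continuous_on_jbracket [continuous_intros]: "continuous_on S (jbracket :: 'a::euclidean_space \<Rightarrow> real)"
proof -
  have *: "jbracket = (\<lambda>x::'a. sqrt (1 + (norm x)\<^sup>2))"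
    by (auto simp: jbracket_def fun_eq_iff powr_half_sqrt)
  show ?thesis unfolding * by (intro continuous_intros)
qed

lemma smooth_compact_support_schwartz:
  fixes f :: "'a::euclidean_space \<Rightarrow> complex"
  assumes "smooth f" "\<And>x. R < norm x \<Longrightarrow> f x = 0"
  shows "f \<in> schwartz"
  unfolding schwartz_def
proof (intro CollectI conjI ballI allI)
  fix bs :: "'a list" and N :: nat
  assume "bs \<in> lists Basis"
  then have "continuous_on UNIV (partial_deriv bs f)"
    using assms(1) differentiable_imp_continuous_on unfolding smooth_def by blast
  then show "bounded (range (\<lambda>x. of_real (jbracket x ^ N) * partial_deriv bs f x))"
    by (intro bounded_range_compact_support[where R = R] continuous_intros)
       (auto simp: partial_deriv_eq_0_outside[OF assms(2)])
qed fact

lemma smooth_compact_support_test: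
  fixes f :: "'a::euclidean_space \<Rightarrow> complex"
  assumes "smooth f" "\<And>x. R < norm x \<Longrightarrow> f x = 0"
  shows "f \<in> test_functions"
proof -
  have "{x. f x \<noteq> 0} \<subseteq> cball 0 R" using assms(2) by (force simp: not_le[symmetric])
  then have "compact (closure {x. f x \<noteq> 0})"
    unfolding compact_closure by (rule bounded_subset[OF bounded_cball])
  then show ?thesis using assms(1) by (simp add: test_functions_def compactly_supported_def)
qed

section \<open>Convolution and decay of the Fourier transform\<close>

definition convolution :: "('a::euclidean_space \<Rightarrow> complex) \<Rightarrow> ('a \<Rightarrow> complex) \<Rightarrow> 'a \<Rightarrow> complex" where
  "convolution f g x = (LINT y|lborel. f (x - y) * g y)"

lemma integrable_bounded_mult:
  fixes f g :: "'a::euclidean_space \<Rightarrow> complex"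
  assumes f: "f \<in> borel_measurable borel" and L: "\<And>x. norm (f x) \<le> L" and g: "integrable lborel g"
  shows "integrable lborel (\<lambda>y. f y * g y)"
proof (rule Bochner_Integration.integrable_bound[of lborel "\<lambda>y. L * norm (g y)"])
  have "0 \<le> L" using order_trans[OF norm_ge_zero L] .
  then show "AE x in lborel. norm (f x * g x) \<le> norm (L * norm (g x))"
    by (auto simp: norm_mult intro!: mult_right_mono L)
  show "(\<lambda>y. f y * g y) \<in> borel_measurable lborel" using f g by simp
qed (use g in simp)

text \<open>The difference quotients of \<open>f\<close> are bounded by its Lipschitz constant \<open>L\<close>, so dominated
  convergence with majorant \<open>2 L |g|\<close> moves the derivative onto the factor \<open>f\<close>.\<close>

lemma convolution_has_derivative:
  fixes f g :: "'a::euclidean_space \<Rightarrow> complex"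
  assumes D: "\<And>x. (f has_derivative D x) (at x)" and Dc: "\<And>b. continuous_on UNIV (\<lambda>x. D x b)"
    and supp: "\<And>x. R < norm x \<Longrightarrow> f x = 0" and g: "integrable lborel g"
  shows "(convolution f g has_derivative (\<lambda>h. convolution (\<lambda>x. D x h) g x)) (at x)"
proof -
  have fc: "continuous_on UNIV f"
    using D has_derivative_continuous continuous_at_imp_continuous_on by blast
  have D0: "D x = (\<lambda>_. 0)" if "R < norm x" for x
  proof -
    have "open {x::'a. R < norm x}" by (intro open_Collect_less continuous_intros)
    then have "(f has_derivative (\<lambda>_. 0)) (at x)"
      using that supp by (intro has_derivative_transform_within_open[OF has_derivative_const[of 0]]) auto
    then show ?thesis using D has_derivative_unique by blast
  qed
  have lin: "bounded_linear (D x)" for x using D has_derivative_bounded_linear by blast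
  have "\<exists>B. \<forall>x. norm (D x b) \<le> B" for b
    using bounded_range_compact_support[OF Dc[of b], of R] D0 by (auto simp: bounded_iff)
  then obtain B where B: "\<And>x b. norm (D x b) \<le> B b" by metis
  define L where "L = (\<Sum>b\<in>Basis. B b)"
  have DL: "norm (D x h) \<le> L * norm h" for x h
  proof -
    interpret D: bounded_linear "D x" by (rule lin)
    have "D x h = D x (\<Sum>b\<in>Basis. (h \<bullet> b) *\<^sub>R b)" by (simp add: euclidean_representation)
    also have "\<dots> = (\<Sum>b\<in>Basis. (h \<bullet> b) *\<^sub>R D x b)" by (simp add: D.sum D.scaleR)
    also have "norm \<dots> \<le> (\<Sum>b\<in>Basis. norm h * B b)"
      by (rule sum_norm_le) (auto intro!: mult_mono B simp: Basis_le_norm)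
    finally show ?thesis by (simp add: L_def sum_distrib_left sum_distrib_right mult.commute)
  qed
  have L0: "0 \<le> L" using B[of 0] order_trans[OF norm_ge_zero B] by (auto simp: L_def intro!: sum_nonneg)
  have lip: "norm (f (z + h) - f z) \<le> L * norm h" for z h
  proof -
    have "norm (f (z + h) - f z) \<le> L * norm (z + h - z)"
      by (rule differentiable_bound[of UNIV f D]) (use D DL in \<open>auto intro!: onorm_le\<close>)
    then show ?thesis by simp
  qed
  have fm: "f \<in> borel_measurable borel" "\<And>b. (\<lambda>x. D x b) \<in> borel_measurable borel"
    using fc Dc borel_measurable_continuous_onI by blast+
  note [measurable] = fm borel_measurable_integrable[OF g]
  obtain B0 where B0: "\<And>x. norm (f x) \<le> B0"
    using bounded_range_compact_support[OF fc supp] by (auto simp: bounded_iff)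
  have if1: "integrable lborel (\<lambda>y. f (z - y) * g y)" for z
    by (rule integrable_bounded_mult[where L = B0, OF _ B0 g]) measurable
  have if2: "integrable lborel (\<lambda>y. D (z - y) h * g y)" for z h
    by (rule integrable_bounded_mult[where L = "L * norm h", OF _ DL g]) measurable
  let ?E = "\<lambda>h. convolution (\<lambda>x. D x h) g x"
  have E: "bounded_linear ?E"
  proof (rule bounded_linear_intro)
    show "?E (h + k) = ?E h + ?E k" for h k
      unfolding convolution_def by (subst Bochner_Integration.integral_add[symmetric])
        (rule if2, rule if2, simp add: linear_add[OF bounded_linear.linear[OF lin]] distrib_right)
    show "?E (r *\<^sub>R h) = r *\<^sub>R ?E h" for r h
      unfolding convolution_def by (subst Bochner_Integration.integral_scaleR_right[symmetric])
        (auto simp: linear_cmul[OF bounded_linear.linear[OF lin]])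
    show "norm (?E h) \<le> norm h * (L * (LINT y|lborel. norm (g y)))" for h
    proof -
      have "norm (?E h) \<le> (LINT y|lborel. norm h * L * norm (g y))"
        unfolding convolution_def
        by (rule Bochner_Integration.integral_norm_bound_integral[OF if2]) 
           (use g in \<open>auto simp: norm_mult mult.commute[of "norm h"] intro!: mult_right_mono DL\<close>)
      then show ?thesis by (simp add: mult.assoc)
    qed
  qed
  show ?thesis
    unfolding has_derivative_at
  proof (rule conjI[OF E])
    show "(\<lambda>h. norm (convolution f g (x + h) - convolution f g x - ?E h) / norm h) \<midarrow>0\<rightarrow> 0"
      unfolding tendsto_at_iff_sequentially
    proof (intro allI impI)
      fix X :: "nat \<Rightarrow> 'a" assume X: "\<forall>i. X i \<in> UNIV - {0}" "X \<longlonglongrightarrow> 0"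
      let ?r = "\<lambda>i y. (f (x - y + X i) - f (x - y) - D (x - y) (X i)) /\<^sub>R norm (X i)"
      have lim: "(\<lambda>i. LINT y|lborel. ?r i y * g y) \<longlonglongrightarrow> (LINT y|(lborel::'a measure). 0)"
      proof (rule integral_dominated_convergence[where w = "\<lambda>y. 2 * L * norm (g y)"])
        show "AE y in lborel. (\<lambda>i. ?r i y * g y) \<longlonglongrightarrow> 0"
        proof (rule AE_I2)
          fix y
          have "(\<lambda>h. norm (f (x - y + h) - f (x - y) - D (x - y) h) / norm h) \<midarrow>0\<rightarrow> 0"
            using D[of "x - y"] unfolding has_derivative_at by blast
          then have "(\<lambda>i. norm (?r i y)) \<longlonglongrightarrow> 0"
            unfolding tendsto_at_iff_sequentially using X by (simp add: o_def divide_inverse mult.commute)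
          then show "(\<lambda>i. ?r i y * g y) \<longlonglongrightarrow> 0" by (intro tendsto_mult_left_zero) (simp only: tendsto_norm_zero_iff)
        qed
        show "AE y in lborel. norm (?r i y * g y) \<le> 2 * L * norm (g y)" for i
        proof (rule AE_I2)
          fix y
          have "norm (f (x - y + X i) - f (x - y) - D (x - y) (X i)) \<le> L * norm (X i) + L * norm (X i)"
            by (rule order_trans[OF norm_triangle_ineq4 add_mono[OF lip DL]])
          then have "norm (?r i y) \<le> 2 * L" 
            using X(1) unfolding norm_scaleR by (simp add: pos_divide_le_eq divide_inverse[symmetric] mult.commute[of "inverse _"])
          then show "norm (?r i y * g y) \<le> 2 * L * norm (g y)"
            by (simp only: norm_mult) (rule mult_right_mono, auto)
        qed
        show "integrable lborel (\<lambda>y. 2 * L * norm (g y))" using g by simp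
      qed measurable
      have "(\<lambda>i. norm (LINT y|lborel. ?r i y * g y)) \<longlonglongrightarrow> 0" using tendsto_norm[OF lim] by simp
      moreover have "norm (LINT y|lborel. ?r i y * g y) = norm (convolution f g (x + X i) - convolution f g x - ?E (X i)) / norm (X i)" for i
      proof -
        have "(LINT y|lborel. ?r i y * g y) = (LINT y|lborel. (f (x + X i - y) * g y - f (x - y) * g y - D (x - y) (X i) * g y) /\<^sub>R norm (X i))"
          by (rule Bochner_Integration.integral_cong) (auto simp: algebra_simps scaleR_conv_of_real)
        also have "\<dots> = (convolution f g (x + X i) - convolution f g x - ?E (X i)) /\<^sub>R norm (X i)"
          unfolding convolution_def by (simp add: if1 if2)
        finally have "norm (LINT y|lborel. ?r i y * g y) = norm ((convolution f g (x + X i) - convolution f g x - ?E (X i)) /\<^sub>R norm (X i))"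
          by (rule arg_cong)
        also have "norm (v /\<^sub>R norm (X i)) = norm v / norm (X i)" for v :: complex
          by (simp add: divide_inverse mult.commute)
        finally show ?thesis .
      qed
      ultimately show "((\<lambda>h. norm (convolution f g (x + h) - convolution f g x - ?E h) / norm h) \<circ> X) \<longlonglongrightarrow> 0"
        by (simp only: o_def)
    qed
  qed
qed

lemma integral_translation:
  fixes f :: "'a::euclidean_space \<Rightarrow> 'b::euclidean_space"
  assumes [measurable]: "f \<in> borel_measurable borel"
  shows "(LINT x|lborel. f (a + x)) = (LINT x|lborel. f x)"
proof -
  have "(LINT x|lborel. f x) = (LINT x|distr lborel borel ((+) a). f x)" by (simp add: lborel_distr_plus)
  also have "\<dots> = (LINT x|lborel. f (a + x))" by (subst integral_distr) auto
  finally show ?thesis by simp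
qed

lemma integral_reflect:
  fixes f :: "'a::euclidean_space \<Rightarrow> 'b::euclidean_space"
  assumes [measurable]: "f \<in> borel_measurable borel"
  shows "(LINT x|lborel. f (a - x)) = (LINT x|lborel. f x)"
proof -
  have "(lborel :: 'a measure) = density (distr lborel borel (\<lambda>x. a + (-1) *\<^sub>R x)) (\<lambda>_. 1)"
    using lborel_affine[of "-1" a] by simp
  also have "\<dots> = distr lborel borel (\<lambda>x. a + (-1) *\<^sub>R x)" by (simp add: density_1)
  finally have "(LINT x|lborel. f x) = (LINT x|distr lborel borel (\<lambda>x. a + (-1) *\<^sub>R x). f x)" by simp
  also have "\<dots> = (LINT x|lborel. f (a - x))" by (subst integral_distr) auto
  finally show ?thesis by simp
qed

text \<open>The convolution of \<open>f\<close> with the indicator of a ball of radius \<open>R + 1\<close> is constant on the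
  unit ball, where that ball covers the translated support. The claim is that its derivative
  at the origin vanishes.\<close>

lemma integral_derivative_compact_support:
  fixes f :: "'a::euclidean_space \<Rightarrow> complex"
  assumes D: "\<And>x. (f has_derivative D x) (at x)" and Dc: "\<And>b. continuous_on UNIV (\<lambda>x. D x b)"
    and supp: "\<And>x. R < norm x \<Longrightarrow> f x = 0"
  shows "(LINT x|lborel. D x b) = 0"
proof -
  let ?B = "cball (0::'a) (R + 1)"
  have fc: "continuous_on UNIV f"
    using D has_derivative_continuous continuous_at_imp_continuous_on by blast
  then have fm: "f \<in> borel_measurable borel" by (rule borel_measurable_continuous_onI)
  have D0: "D x = (\<lambda>_. 0)" if "R < norm x" for x
  proof -
    have "open {x::'a. R < norm x}" by (intro open_Collect_less continuous_intros)
    then have "(f has_derivative (\<lambda>_. 0)) (at x)"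
      using that supp by (intro has_derivative_transform_within_open[OF has_derivative_const[of 0]]) auto
    then show ?thesis using D has_derivative_unique by blast
  qed
  have g: "integrable lborel (indicator ?B :: 'a \<Rightarrow> complex)"
  proof -
    have "integrable lborel (\<lambda>x. complex_of_real (indicator ?B x))"
      using emeasure_lborel_cball_finite[of "0::'a" "R + 1"] by (intro integrable_of_real integrable_real_indicator) auto
    also have "(\<lambda>x. complex_of_real (indicator ?B x)) = indicator ?B" by (auto split: split_indicator)
    finally show ?thesis .
  qed
  have convolution_const: "convolution F (indicator ?B) x = (LINT y|lborel. F y)"
    if "norm x < 1" "\<And>x. R < norm x \<Longrightarrow> F x = 0" "continuous_on UNIV F" for F x
  proof -
    have "convolution F (indicator ?B) x = (LINT y|lborel. F (x - y))"
      unfolding convolution_def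
    proof (rule Bochner_Integration.integral_cong)
      fix y :: 'a
      have "norm y \<le> norm (x - y) + norm x" using norm_triangle_ineq4[of x "x - y"] by simp
      then show "F (x - y) * indicator ?B y = F (x - y)"
        using that by (auto split: split_indicator)
    qed simp
    also have "\<dots> = (LINT y|lborel. F y)"
      by (rule integral_reflect) (rule borel_measurable_continuous_onI, fact)
    finally show ?thesis .
  qed
  have "(convolution f (indicator ?B) has_derivative (\<lambda>h. convolution (\<lambda>x. D x h) (indicator ?B) 0)) (at 0)"
    by (rule convolution_has_derivative[OF D Dc supp g])
  moreover have "(convolution f (indicator ?B) has_derivative (\<lambda>_. 0)) (at 0)"
    by (rule has_derivative_transform_within_open[OF has_derivative_const, of "ball 0 1"])
       (auto simp: convolution_const fc supp)
  ultimately have "(\<lambda>h. convolution (\<lambda>x. D x h) (indicator ?B) 0) = (\<lambda>_. 0)" by (rule has_derivative_unique)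
  then have "convolution (\<lambda>x. D x b) (indicator ?B) 0 = 0" by metis
  then show ?thesis by (subst (asm) convolution_const) (auto simp: D0 Dc)
qed

lemma partial_deriv_convolution:
  assumes f: "f \<in> flat_algebra" and supp: "\<And>x. R < norm x \<Longrightarrow> f x = 0" and g: "integrable lborel g"
  shows "partial_deriv bs (convolution f g) = convolution (partial_deriv bs f) g"
    and "convolution (partial_deriv bs f) g differentiable (at x)"
proof -
  have *: "(convolution (partial_deriv bs f) g has_derivative
      (\<lambda>h. convolution (\<lambda>x. frechet_derivative (partial_deriv bs f) (at x) h) g x)) (at x)" for bs x
    using partial_deriv_flat_algebra[OF f, of bs]
    by (intro convolution_has_derivative[where R = R] g frechet_derivative_flat_algebra flat_algebra_continuous
        partial_deriv_eq_0_outside[OF supp]) auto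
  then show "convolution (partial_deriv bs f) g differentiable (at x)" using differentiable_def by blast
  show "partial_deriv bs (convolution f g) = convolution (partial_deriv bs f) g"
  proof (induction bs)
    case (Cons b bs)
    then show ?case using frechet_derivative_at[OF *[of bs]] by (auto simp: fun_eq_iff) metis
  qed simp
qed

lemma smooth_convolution:
  assumes "f \<in> flat_algebra" "\<And>x. R < norm x \<Longrightarrow> f x = 0" "integrable lborel g"
  shows "smooth (convolution f g)"
  unfolding smooth_def differentiable_on_def
  using partial_deriv_convolution[OF assms] by (simp add: differentiable_at_withinI)

text \<open>Integration by parts: the derivative of \<open>exp (-i x \<bullet> \<xi>) f x\<close> in the direction \<open>b\<close> has
  integral 0.\<close>

lemma fourier_partial_deriv:
  fixes f :: "'a::euclidean_space \<Rightarrow> complex"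
  assumes f: "f \<in> flat_algebra" and supp: "\<And>x. R < norm x \<Longrightarrow> f x = 0"
  shows "fourier (partial_deriv [b] f) \<xi> = \<i> * of_real (b \<bullet> \<xi>) * fourier f \<xi>"
proof -
  let ?e = "\<lambda>x::'a. exp (- (\<i> * of_real (x \<bullet> \<xi>)))"
  let ?D = "\<lambda>x h. ?e x * frechet_derivative f (at x) h + ?e x * (- (\<i> * of_real (h \<bullet> \<xi>))) * f x"
  have ec: "continuous_on UNIV ?e" by (intro continuous_intros)
  have fc: "continuous_on UNIV f" "\<And>h. continuous_on UNIV (\<lambda>x. frechet_derivative f (at x) h)"
    using f frechet_derivative_flat_algebra(2) flat_algebra_continuous by blast+
  have "((\<lambda>x. exp (- (\<i> * complex_of_real (x \<bullet> \<xi>)))) has_derivative (\<lambda>h. ?e x * (- (\<i> * of_real (h \<bullet> \<xi>))))) (at x)" for x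
  proof -
    have "((\<lambda>x. - (\<i> * complex_of_real (x \<bullet> \<xi>))) has_derivative (\<lambda>h. - (\<i> * of_real (h \<bullet> \<xi>)))) (at x)"
      by (auto intro!: derivative_eq_intros)
    from has_derivative_compose[OF this DERIV_exp[unfolded has_field_derivative_def]]
    show ?thesis by simp
  qed
  from has_derivative_mult[OF this frechet_derivative_flat_algebra(1)[OF f]]
  have D: "((\<lambda>x. ?e x * f x) has_derivative ?D x) (at x)" for x .
  have "(LINT x|lborel. ?D x b) = 0"
    by (rule integral_derivative_compact_support[OF D, of R])
       (auto intro!: continuous_intros fc ec simp: supp)
  moreover have "integrable lborel (\<lambda>x. ?e x * frechet_derivative f (at x) b)"
    by (rule integrable_compact_support[of _ R])
       (use partial_deriv_eq_0_outside[OF supp, where bs = "[b]"] in \<open>auto intro!: continuous_intros ec fc\<close>)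
  moreover have "integrable lborel (\<lambda>x. ?e x * f x)"
    by (rule integrable_compact_support[of _ R]) (auto intro!: continuous_intros ec fc simp: supp)
  moreover have "(LINT x|lborel. ?e x * (- (\<i> * of_real (b \<bullet> \<xi>))) * f x) = - (\<i> * of_real (b \<bullet> \<xi>)) * fourier f \<xi>"
    unfolding fourier_def by (subst integral_mult_right_zero[symmetric]) (simp add: mult_ac)
  moreover have "integrable lborel (\<lambda>x. ?e x * (- (\<i> * of_real (b \<bullet> \<xi>))) * f x)"
    by (rule integrable_compact_support[of _ R]) (auto intro!: continuous_intros ec fc simp: supp)
  ultimately show ?thesis by (simp add: fourier_def)
qed

lemma fourier_partial_deriv_power:
  fixes f :: "'a::euclidean_space \<Rightarrow> complex"
  assumes f: "f \<in> flat_algebra" and supp: "\<And>x. R < norm x \<Longrightarrow> f x = 0"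
  shows "fourier (partial_deriv (replicate N b) f) \<xi> = (\<i> * of_real (b \<bullet> \<xi>)) ^ N * fourier f \<xi>"
proof (induction N)
  case (Suc N)
  have "fourier (partial_deriv [b] (partial_deriv (replicate N b) f)) \<xi>
      = \<i> * of_real (b \<bullet> \<xi>) * fourier (partial_deriv (replicate N b) f) \<xi>"
    by (rule fourier_partial_deriv[OF partial_deriv_flat_algebra[OF f] partial_deriv_eq_0_outside[OF supp]])
  with Suc show ?case by (simp add: mult.assoc)
qed simp

lemma norm_fourier_le:
  assumes "integrable lborel f"
  shows "norm (fourier f \<xi>) \<le> (LINT x|lborel. norm (f x))"
proof -
  have "norm (fourier f \<xi>) \<le> (LINT x|lborel. norm (exp (- (\<i> * of_real (x \<bullet> \<xi>))) * f x))"
    unfolding fourier_def by (rule integral_norm_bound)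
  then show ?thesis by (simp add: norm_mult)
qed

lemma jbracket_eq: "jbracket x = sqrt (1 + (norm x)\<^sup>2)"
  by (simp add: jbracket_def powr_half_sqrt)

lemma jbracket_ge_1: "1 \<le> jbracket x" by (simp add: jbracket_eq)

lemma jbracket_pos [simp]: "0 < jbracket x" using jbracket_ge_1[of x] by linarith

lemma norm_le_jbracket: "norm x \<le> jbracket x"
  unfolding jbracket_eq by (rule real_le_rsqrt) simp

lemma jbracket_le: "jbracket x \<le> 1 + norm x"
  unfolding jbracket_eq by (rule real_le_lsqrt) (auto simp: power2_eq_square algebra_simps)

text \<open>Peetre's inequality at unit scale: powers of the bracket vary slowly, which later
  allows spheres to be thickened to shells.\<close>

lemma jbracket_shift: "norm (x - y) \<le> 1 \<Longrightarrow> jbracket y \<le> 2 * jbracket x"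
proof -
  assume "norm (x - y) \<le> 1"
  then have "norm y \<le> norm x + 1" using norm_triangle_ineq4[of x "x - y"] by simp
  then have "(norm y)\<^sup>2 \<le> (norm x + 1)\<^sup>2" by (intro power_mono) auto
  also have "\<dots> \<le> 2 * (norm x)\<^sup>2 + 2" using sum_squares_ge_zero[of "norm x - 1" 0]
    by (simp add: power2_eq_square algebra_simps)
  finally have "(norm y)\<^sup>2 \<le> 2 * (norm x)\<^sup>2 + 2" .
  moreover have "0 \<le> (norm x)\<^sup>2" by simp
  ultimately have "1 + (norm y)\<^sup>2 \<le> 4 * (1 + (norm x)\<^sup>2)" unfolding distrib_left by linarith
  then have "sqrt (1 + (norm y)\<^sup>2) \<le> sqrt (4 * (1 + (norm x)\<^sup>2))" by (rule real_sqrt_le_mono)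
  then show ?thesis unfolding jbracket_eq real_sqrt_mult real_sqrt_four .
qed

text \<open>Up to a dimensional factor, the bracket of \<open>\<xi>\<close> is bounded by 1 or by one of the
  coordinates of \<open>\<xi>\<close>. Hence it is enough to differentiate \<open>N\<close> times in a single coordinate
  direction.\<close>

lemma fourier_rapid_decay:
  fixes f :: "'a::euclidean_space \<Rightarrow> complex"
  assumes f: "f \<in> flat_algebra" and supp: "\<And>x. R < norm x \<Longrightarrow> f x = 0"
  shows "\<exists>C>0. \<forall>\<xi>. jbracket \<xi> ^ N * norm (fourier f \<xi>) \<le> C"
proof -
  define c where "c b = (LINT x|lborel. norm (partial_deriv (replicate N b) f x))" for b
  have int: "integrable lborel (partial_deriv bs f)" for bs
    by (rule integrable_compact_support[of _ R])
       (auto intro!: flat_algebra_continuous partial_deriv_flat_algebra f partial_deriv_eq_0_outside[OF supp])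
  have 1: "\<bar>b \<bullet> \<xi>\<bar> ^ N * norm (fourier f \<xi>) \<le> c b" for b \<xi>
    using norm_fourier_le[OF int[of "replicate N b"], of \<xi>] fourier_partial_deriv_power[of f R N b \<xi>, OF f supp]
    by (simp add: c_def norm_mult norm_power)
  define c0 where "c0 = (LINT x|lborel. norm (f x))"
  have 0: "norm (fourier f \<xi>) \<le> c0" for \<xi>
    unfolding c0_def by (rule norm_fourier_le) (use int[of "[]"] in simp)
  have c: "0 \<le> c0" "0 \<le> c b" for b unfolding c0_def c_def by auto
  define M where "M = real (DIM('a) + 1) ^ N * (c0 + (\<Sum>b\<in>Basis. c b))"
  have "jbracket \<xi> ^ N * norm (fourier f \<xi>) \<le> M" for \<xi>
  proof -
    define m where "m = Max (insert 1 ((\<lambda>b. \<bar>b \<bullet> \<xi>\<bar>) ` Basis))"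
    have m: "1 \<le> m" "\<And>b. b \<in> Basis \<Longrightarrow> \<bar>b \<bullet> \<xi>\<bar> \<le> m" unfolding m_def by (rule Max_ge; simp)+
    have mem: "m \<in> insert 1 ((\<lambda>b. \<bar>b \<bullet> \<xi>\<bar>) ` Basis)" unfolding m_def by (rule Max_in) auto
    have "norm \<xi> \<le> (\<Sum>b\<in>Basis. \<bar>\<xi> \<bullet> b\<bar>)" by (rule norm_le_l1)
    also have "\<dots> \<le> (\<Sum>b\<in>(Basis::'a set). m)" by (rule sum_mono) (use m in \<open>auto simp: inner_commute\<close>)
    finally have "jbracket \<xi> \<le> real (DIM('a) + 1) * m" using m(1) jbracket_le[of \<xi>] by (simp add: algebra_simps)
    then have "jbracket \<xi> ^ N \<le> (real (DIM('a) + 1) * m) ^ N" by (intro power_mono) (auto intro: less_imp_le)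
    then have "jbracket \<xi> ^ N * norm (fourier f \<xi>) \<le> real (DIM('a) + 1) ^ N * (m ^ N * norm (fourier f \<xi>))"
      by (metis mult.assoc mult_right_mono norm_ge_zero power_mult_distrib)
    also have "m ^ N * norm (fourier f \<xi>) \<le> c0 + (\<Sum>b\<in>Basis. c b)"
    proof -
      consider "m = 1" | b where "b \<in> Basis" "m = \<bar>b \<bullet> \<xi>\<bar>" using mem by auto
      then show ?thesis
      proof cases
        case 1 then show ?thesis using 0[of \<xi>] c by (simp add: add_increasing2 sum_nonneg)
      next
        case 2
        then have "m ^ N * norm (fourier f \<xi>) \<le> c b" using 1 by simp
        also have "\<dots> \<le> (\<Sum>b\<in>Basis. c b)" by (rule member_le_sum) (use 2 c in auto)
        finally show ?thesis using c by simp
      qed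
    qed
    finally show ?thesis by (simp add: M_def mult_left_mono)
  qed
  then have "\<forall>\<xi>. jbracket \<xi> ^ N * norm (fourier f \<xi>) \<le> max M 1" by (auto simp: le_max_iff_disj)
  then show ?thesis by (intro exI[of _ "max M 1"]) auto
qed

section \<open>A radial test function with nonnegative Fourier transform\<close>

text \<open>The argument depends only on \<open>|x - a|/r\<close>, so lower bounds hold with constants that do not
  depend on \<open>r\<close>.\<close>

definition bump :: "'a::euclidean_space \<Rightarrow> real \<Rightarrow> 'a \<Rightarrow> real" where
  "bump a r x = flat 0 (1 - inverse (r\<^sup>2) * (norm (x - a))\<^sup>2)"

lemma bump_flat_algebra: "(\<lambda>x. complex_of_real (bump a r x)) \<in> flat_algebra"
  unfolding bump_def by (rule flat_algebra.cutoff)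

lemma bump_bounds: "0 \<le> bump a r x" "bump a r x \<le> 1"
  by (auto simp: bump_def flat_def)

lemma bump_eq_0: "0 < r \<Longrightarrow> r \<le> norm (x - a) \<Longrightarrow> bump a r x = 0"
  using power_mono[of r "norm (x - a)" 2] by (simp add: bump_def flat_def field_simps)

lemma bump_lower:
  assumes "0 < r" "norm (x - a) \<le> r / 2"
  shows "exp (- 2) \<le> bump a r x"
proof -
  define t where "t = 1 - inverse (r\<^sup>2) * (norm (x - a))\<^sup>2"
  have "(norm (x - a))\<^sup>2 \<le> (r / 2)\<^sup>2" using assms by (intro power_mono) auto
  then have "inverse (r\<^sup>2) * (norm (x - a))\<^sup>2 \<le> inverse (r\<^sup>2) * (r / 2)\<^sup>2"
    by (intro mult_left_mono) auto
  also have "\<dots> = 1 / 4" using assms(1) by (simp add: power_divide)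
  finally have "1 / 2 \<le> t" by (simp add: t_def)
  then have "inverse t \<le> inverse (1 / 2)" by (intro le_imp_inverse_le) auto
  then show ?thesis using \<open>1 / 2 \<le> t\<close> by (simp add: bump_def t_def[symmetric] flat_def)
qed

lemma continuous_on_bump: "continuous_on S (bump a r)"
proof -
  have "continuous_on S (\<lambda>x. Re (complex_of_real (bump a r x)))"
    by (intro continuous_intros flat_algebra_continuous bump_flat_algebra)
  then show ?thesis by simp
qed

lemma continuous_on_bump_comp [continuous_intros]:
  "continuous_on S f \<Longrightarrow> continuous_on S (\<lambda>x. bump a r (f x))"
  using continuous_on_compose2[OF continuous_on_bump[of UNIV a r]] by blast

lemma borel_measurable_bump [measurable]: "bump a r \<in> borel_measurable borel"
  by (rule borel_measurable_continuous_onI[OF continuous_on_bump])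

lemma bump_schwartz:
  fixes a :: "'a::euclidean_space"
  assumes "0 < r" shows "(\<lambda>x. complex_of_real (bump a r x)) \<in> schwartz"
proof (rule smooth_compact_support_schwartz)
  fix x :: 'a assume "norm a + r < norm x"
  then show "complex_of_real (bump a r x) = 0"
    using bump_eq_0[OF assms, of x a] norm_triangle_sub[of x a] by simp
qed (rule flat_algebra_smooth[OF bump_flat_algebra])

lemma integrable_translation:
  fixes f :: "'a::euclidean_space \<Rightarrow> 'b::euclidean_space"
  assumes "integrable lborel f"
  shows "integrable lborel (\<lambda>x. f (a + x))"
proof -
  have "integrable (distr lborel borel ((+) a)) f" using assms by (simp add: lborel_distr_plus)
  then show ?thesis by (rule integrable_distr[rotated]) simp
qed

text \<open>Uniqueness of translation-invariant measures. Let \<open>\<mu>\<close> be the image of Lebesgue measure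
  and \<open>B\<close> the unit ball. Integrating \<open>1\<^sub>A(x) 1\<^sub>B(x + y)\<close> against \<open>d\<mu>(x) dy\<close> gives \<open>\<mu>(A) |B|\<close> if \<open>y\<close> is
  integrated first, and \<open>|A| \<mu>(B)\<close> if \<open>x\<close> is first translated by \<open>-y\<close>. As \<open>T\<close> preserves \<open>B\<close>, the two
  measures of \<open>B\<close> cancel.\<close>

lemma lborel_isometry:
  fixes T :: "'a::euclidean_space \<Rightarrow> 'a"
  assumes add: "\<And>x y. T (x + y) = T x + T y" and norm: "\<And>x. norm (T x) = norm x"
    and inv: "\<And>x. T (T x) = x" and [measurable]: "T \<in> borel_measurable borel"
  shows "distr lborel borel T = lborel"
proof (rule measure_eqI)
  define \<mu> where "\<mu> = distr lborel borel T"
  have sets_mu [simp, measurable_cong]: "sets \<mu> = sets borel" by (simp add: \<mu>_def)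
  interpret mu: sigma_finite_measure \<mu>
  proof (rule sigma_finite_measure.intro, intro exI conjI ballI)
    show "countable (range (\<lambda>n. ball (0::'a) (real n)))" by simp
    show "range (\<lambda>n. ball (0::'a) (real n)) \<subseteq> sets \<mu>" by auto
    show "\<Union> (range (\<lambda>n. ball (0::'a) (real n))) = space \<mu>"
      by (auto simp: \<mu>_def intro: reals_Archimedean2)
    fix A assume "A \<in> range (\<lambda>n. ball (0::'a) (real n))"
    then obtain n where A: "A = ball 0 (real n)" by auto
    have "emeasure \<mu> A = emeasure lborel (T -` A)" unfolding \<mu>_def A by (subst emeasure_distr) auto
    also have "T -` A = A" unfolding A using norm by auto
    finally show "emeasure \<mu> A \<noteq> \<infinity>" unfolding A using emeasure_lborel_ball_finite[of "0::'a" "real n"] by auto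
  qed
  interpret pair_sigma_finite \<mu> "lborel :: 'a measure" ..
  have mu_nn: "(\<integral>\<^sup>+x. f x \<partial>\<mu>) = (\<integral>\<^sup>+x. f (T x) \<partial>lborel)" if "f \<in> borel_measurable borel" for f :: "'a \<Rightarrow> ennreal"
    unfolding \<mu>_def by (rule nn_integral_distr) (use that in auto)
  have trans: "(\<integral>\<^sup>+x. f (a + x) \<partial>lborel) = (\<integral>\<^sup>+x. f x \<partial>lborel)" if "f \<in> borel_measurable borel" for f :: "'a \<Rightarrow> ennreal" and a
    using nn_integral_lborel_affine[OF that, of 1 a] by simp
  have refl: "(\<integral>\<^sup>+x. f (a - x) \<partial>lborel) = (\<integral>\<^sup>+x. f x \<partial>lborel)" if "f \<in> borel_measurable borel" for f :: "'a \<Rightarrow> ennreal" and a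
    using nn_integral_lborel_affine[OF that, of "-1" a] by simp
  have mu_trans: "(\<integral>\<^sup>+x. f (a + x) \<partial>\<mu>) = (\<integral>\<^sup>+x. f x \<partial>\<mu>)" if [measurable]: "f \<in> borel_measurable borel" for f :: "'a \<Rightarrow> ennreal" and a
  proof -
    have "(\<integral>\<^sup>+x. f (a + x) \<partial>\<mu>) = (\<integral>\<^sup>+x. f (T (T a + x)) \<partial>lborel)" by (subst mu_nn) (auto simp: add inv)
    also have "\<dots> = (\<integral>\<^sup>+x. f (T x) \<partial>lborel)" by (rule trans) simp
    finally show ?thesis by (simp add: mu_nn)
  qed
  let ?B = "ball (0::'a) 1"
  show "emeasure (distr lborel borel T) A = emeasure lborel A" if "A \<in> sets (distr lborel borel T)" for A
  proof -
    have [measurable]: "A \<in> sets borel" using that by simp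
    have [measurable]: "?B \<in> sets borel" by simp
    let ?i = "\<lambda>S x. indicator S x :: ennreal"
    have "(\<integral>\<^sup>+x. (\<integral>\<^sup>+y. ?i A x * ?i ?B (x + y) \<partial>lborel) \<partial>\<mu>) = (\<integral>\<^sup>+x. ?i A x * emeasure lborel ?B \<partial>\<mu>)"
      by (subst nn_integral_cmult) (auto simp: trans)
    also have "\<dots> = emeasure \<mu> A * emeasure lborel ?B" by (subst nn_integral_multc) auto
    finally have 1: "(\<integral>\<^sup>+x. (\<integral>\<^sup>+y. ?i A x * ?i ?B (x + y) \<partial>lborel) \<partial>\<mu>) = emeasure \<mu> A * emeasure lborel ?B" .
    have "(\<integral>\<^sup>+x. (\<integral>\<^sup>+y. ?i A x * ?i ?B (x + y) \<partial>lborel) \<partial>\<mu>) = (\<integral>\<^sup>+y. (\<integral>\<^sup>+x. ?i A x * ?i ?B (x + y) \<partial>\<mu>) \<partial>lborel)"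
      by (rule Fubini'[symmetric]) measurable
    also have "\<dots> = (\<integral>\<^sup>+y. (\<integral>\<^sup>+x. ?i A (x - y) * ?i ?B x \<partial>\<mu>) \<partial>lborel)"
    proof (rule nn_integral_cong)
      fix y
      show "(\<integral>\<^sup>+x. ?i A x * ?i ?B (x + y) \<partial>\<mu>) = (\<integral>\<^sup>+x. ?i A (x - y) * ?i ?B x \<partial>\<mu>)"
        using mu_trans[of "\<lambda>x. ?i A (x - y) * ?i ?B x" y] by (simp add: add.commute)
    qed
    also have "\<dots> = (\<integral>\<^sup>+x. (\<integral>\<^sup>+y. ?i A (x - y) * ?i ?B x \<partial>lborel) \<partial>\<mu>)" by (rule Fubini') measurable
    also have "\<dots> = (\<integral>\<^sup>+x. emeasure lborel A * ?i ?B x \<partial>\<mu>)"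
      by (subst nn_integral_multc) (auto simp: refl)
    also have "\<dots> = emeasure lborel A * emeasure \<mu> ?B" by (subst nn_integral_cmult) auto
    also have "emeasure \<mu> ?B = emeasure lborel ?B"
    proof -
      have "T -` ?B = ?B" using norm by auto
      then show ?thesis unfolding \<mu>_def by (subst emeasure_distr) auto
    qed
    finally have "emeasure lborel ?B * emeasure \<mu> A = emeasure lborel ?B * emeasure lborel A"
      unfolding 1 by (simp add: mult.commute)
    moreover have "emeasure lborel ?B \<noteq> 0"
      using content_ball_pos[of 1 "0::'a"] by (auto simp: measure_def)
    moreover have "emeasure lborel ?B \<noteq> top" using emeasure_lborel_ball_finite[of "0::'a" 1] by auto
    ultimately show ?thesis by (simp add: ennreal_mult_cancel_left \<mu>_def)
  qed
qed simp

text \<open>The name refers to the Fourier side: the transform of this self-convolution is the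
  square of that of the bump.\<close>

definition bump_square :: "'a::euclidean_space \<Rightarrow> real" where
  "bump_square x = (LINT y|lborel. bump 0 1 (x - y) * bump 0 1 y)"

lemma bump_square_convolution:
  "complex_of_real (bump_square x) = convolution (\<lambda>x. of_real (bump 0 1 x)) (\<lambda>x. of_real (bump 0 1 x)) x"
  unfolding bump_square_def convolution_def by (simp flip: integral_complex_of_real)

lemma integrable_bump: "integrable lborel (\<lambda>x. complex_of_real (bump 0 1 x))"
  by (rule integrable_compact_support[of _ 1])
     (auto intro!: continuous_intros simp: bump_eq_0)

lemma bump_square_eq_0: "2 < norm x \<Longrightarrow> bump_square x = 0"
proof -
  assume x: "2 < norm x"
  have "bump 0 1 (x - y) * bump 0 1 y = 0" for y
  proof (cases "norm y \<ge> 1")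
    case False
    then have "1 \<le> norm (x - y)" using x norm_triangle_ineq2[of x y] by linarith
    then show ?thesis by (simp add: bump_eq_0)
  qed (simp add: bump_eq_0)
  then show ?thesis unfolding bump_square_def by (simp only: integral_zero)
qed

lemma bump_square_smooth: "smooth (\<lambda>x. complex_of_real (bump_square x))"
  unfolding bump_square_convolution
  by (rule smooth_convolution[of _ 1]) (auto intro: bump_flat_algebra integrable_bump simp: bump_eq_0)

lemma bump_square_test: "(\<lambda>x. complex_of_real (bump_square x)) \<in> test_functions"
  by (rule smooth_compact_support_test[of _ 2]) (auto intro: bump_square_smooth simp: bump_square_eq_0)

lemma continuous_on_bump_square: "continuous_on S bump_square"
proof -
  have "continuous_on UNIV (partial_deriv [] (\<lambda>x. complex_of_real (bump_square x)))"
    using bump_square_smooth unfolding smooth_def by (intro differentiable_imp_continuous_on) (drule bspec[of _ _ "[]"], auto)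
  then have "continuous_on UNIV (\<lambda>x. Re (complex_of_real (bump_square x)))" by (intro continuous_intros) simp
  then show ?thesis using continuous_on_subset by fastforce
qed

text \<open>If \<open>|x| = |y|\<close>, the reflection in the hyperplane orthogonal to \<open>x - y\<close> maps \<open>x\<close> to \<open>y\<close>, and it
  preserves Lebesgue measure and the bump.\<close>

lemma radial_bump_square: "radial (bump_square :: 'a::euclidean_space \<Rightarrow> real)"
  unfolding radial_def
proof (intro allI impI)
  fix x y :: 'a assume xy: "norm x = norm y"
  show "bump_square x = bump_square y"
  proof (cases "x = y")
    case False
    define u where "u = x - y"
    define T where "T z = z - (2 * (z \<bullet> u) / (u \<bullet> u)) *\<^sub>R u" for z
    have u: "u \<bullet> u \<noteq> 0" using False by (simp add: u_def)
    have add: "T (v + w) = T v + T w" for v w by (simp add: T_def inner_add_left add_divide_distrib algebra_simps)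
    have scale: "T (c *\<^sub>R v) = c *\<^sub>R T v" for c v by (simp add: T_def algebra_simps)
    have Tu: "T u = - u" using u by (simp add: T_def scaleR_2)
    have inv: "T (T v) = v" for v
    proof -
      have "T (T v) = T (v + (- (2 * (v \<bullet> u) / (u \<bullet> u))) *\<^sub>R u)" by (simp add: T_def)
      also have "\<dots> = v" unfolding add scale Tu by (simp add: T_def)
      finally show ?thesis .
    qed
    have "T v \<bullet> T v = v \<bullet> v" for v
      using u by (simp add: T_def inner_diff_left inner_diff_right inner_commute[of u v] field_simps power2_eq_square)
    then have nrm: "norm (T v) = norm v" for v by (simp add: norm_eq)
    have Tm[measurable]: "T \<in> borel_measurable borel" unfolding T_def by measurable
    have Tx: "T x = y"
    proof -
      have "x \<bullet> x = y \<bullet> y" using xy by (simp add: norm_eq)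
      then have "2 * (x \<bullet> u) = u \<bullet> u" by (simp add: u_def inner_diff_left inner_diff_right inner_commute)
      then show ?thesis using u by (simp add: T_def) (simp add: u_def)
    qed
    have diff: "T (v - w) = T v - T w" for v w using add[of "v - w" w] by (simp add: algebra_simps)
    have bT: "bump 0 1 (T v) = bump 0 1 v" for v by (simp add: bump_def nrm)
    have "bump_square y = (LINT z|distr lborel borel T. bump 0 1 (y - z) * bump 0 1 z)"
      unfolding bump_square_def lborel_isometry[of T, OF add nrm inv Tm] ..
    also have "\<dots> = (LINT z|lborel. bump 0 1 (y - T z) * bump 0 1 (T z))" by (rule integral_distr) auto
    also have "\<dots> = bump_square x"
      unfolding bump_square_def Tx[symmetric] diff[symmetric] bT ..
    finally show ?thesis by simp
  qed simp
qed

lemma fourier_convolution: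
  fixes f g :: "'a::euclidean_space \<Rightarrow> complex"
  assumes f: "integrable lborel f" and g: "integrable lborel g"
  shows "fourier (convolution f g) \<xi> = fourier f \<xi> * fourier g \<xi>"
proof -
  note [measurable] = borel_measurable_integrable[OF f] borel_measurable_integrable[OF g]
  let ?e = "\<lambda>x::'a. exp (- (\<i> * of_real (x \<bullet> \<xi>)))"
  have fs: "integrable lborel (\<lambda>x. f (x - y))" for y
    using integrable_translation[OF f, of "- y"] by simp
  have e_meas: "?e \<in> borel_measurable borel" by (intro borel_measurable_continuous_onI continuous_intros)
  note [measurable] = e_meas
  have efs: "integrable lborel (\<lambda>x. ?e x * f (x - y))" for y
    by (rule integrable_bounded_mult[where L = 1, OF e_meas _ fs]) simp
  have "integrable (lborel \<Otimes>\<^sub>M lborel) (\<lambda>(y, x). ?e x * f (x - y) * g y)"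
  proof (rule lborel_pair.Fubini_integrable)
    have "(LINT x|lborel. norm (f (x - y))) = (LINT x|lborel. norm (f x))" for y
      using integral_translation[of "\<lambda>x. norm (f x)" "- y"] by simp
    then show "integrable lborel (\<lambda>y. LINT x|lborel. norm (case (y, x) of (y, x) \<Rightarrow> ?e x * f (x - y) * g y))"
      using g by (simp add: norm_mult)
    show "AE y in lborel. integrable lborel (\<lambda>x. case (y, x) of (y, x) \<Rightarrow> ?e x * f (x - y) * g y)"
      using efs by simp
  qed measurable
  then have "(LINT x|lborel. LINT y|lborel. ?e x * f (x - y) * g y) = (LINT y|lborel. LINT x|lborel. ?e x * f (x - y) * g y)"
    by (rule lborel_pair.Fubini_integral)
  moreover have "(LINT x|lborel. ?e x * f (x - y) * g y) = fourier f \<xi> * (?e y * g y)" for y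
  proof -
    have "(LINT x|lborel. ?e x * f (x - y)) = (LINT x|lborel. ?e (y + x) * f (y + x - y))"
      by (rule integral_translation[symmetric, of "\<lambda>x. ?e x * f (x - y)"]) measurable
    also have "\<dots> = (LINT x|lborel. ?e y * (?e x * f x))"
    proof -
      have "?e (y + x) = ?e y * ?e x" for x
        by (simp add: inner_add_left distrib_left exp_add[symmetric])
      then show ?thesis by (simp add: mult.assoc)
    qed
    also have "\<dots> = ?e y * fourier f \<xi>" unfolding fourier_def by (rule integral_mult_right_zero)
    finally have "(LINT x|lborel. ?e x * f (x - y)) * g y = ?e y * fourier f \<xi> * g y" by simp
    then show ?thesis by (subst (asm) integral_mult_left_zero[symmetric]) (simp add: mult_ac)
  qed
  ultimately show ?thesis by (simp add: fourier_def convolution_def mult.assoc)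
qed

lemma norm_exp_i_diff_le: "norm (exp (- (\<i> * complex_of_real a)) - exp (- (\<i> * of_real b))) \<le> \<bar>a - b\<bar>"
proof -
  have "exp (- (\<i> * complex_of_real a)) - exp (- (\<i> * of_real b))
      = exp (- (\<i> * of_real b)) * (exp (\<i> * of_real (b - a)) - 1)"
    by (simp add: algebra_simps exp_add[symmetric] exp_diff exp_minus field_simps)
  then have "norm (exp (- (\<i> * complex_of_real a)) - exp (- (\<i> * of_real b))) = 2 * \<bar>sin ((b - a) / 2)\<bar>"
    by (simp only: norm_mult dist_exp_i_1) simp
  also have "\<dots> \<le> \<bar>a - b\<bar>" using abs_sin_x_le_abs_x[of "(b - a) / 2"] by simp
  finally show ?thesis .
qed

lemma fourier_lipschitz:
  fixes f :: "'a::euclidean_space \<Rightarrow> complex"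
  assumes f: "integrable lborel f" "integrable lborel (\<lambda>x. norm x * norm (f x))"
  shows "norm (fourier f \<xi> - fourier f \<eta>) \<le> norm (\<xi> - \<eta>) * (LINT x|lborel. norm x * norm (f x))"
proof -
  have int: "integrable lborel (\<lambda>x. exp (- (\<i> * of_real (x \<bullet> \<xi>))) * f x)" for \<xi>
    by (rule integrable_bounded_mult[where L = 1, OF _ _ f(1)])
       (auto intro!: borel_measurable_continuous_onI continuous_intros)
  have "fourier f \<xi> - fourier f \<eta> = (LINT x|lborel. exp (- (\<i> * of_real (x \<bullet> \<xi>))) * f x - exp (- (\<i> * of_real (x \<bullet> \<eta>))) * f x)"
    unfolding fourier_def by (rule Bochner_Integration.integral_diff[symmetric]) (rule int)+
  also have "norm \<dots> \<le> (LINT x|lborel. norm (\<xi> - \<eta>) * (norm x * norm (f x)))"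
  proof (rule Bochner_Integration.integral_norm_bound_integral)
    fix x :: 'a
    have "norm (exp (- (\<i> * complex_of_real (x \<bullet> \<xi>))) - exp (- (\<i> * of_real (x \<bullet> \<eta>)))) \<le> \<bar>x \<bullet> (\<xi> - \<eta>)\<bar>"
      using norm_exp_i_diff_le[of "x \<bullet> \<xi>" "x \<bullet> \<eta>"] by (simp add: inner_diff_right)
    also have "\<dots> \<le> norm x * norm (\<xi> - \<eta>)" by (rule Cauchy_Schwarz_ineq2)
    finally show "norm (exp (- (\<i> * of_real (x \<bullet> \<xi>))) * f x - exp (- (\<i> * of_real (x \<bullet> \<eta>))) * f x) \<le> norm (\<xi> - \<eta>) * (norm x * norm (f x))"
      unfolding left_diff_distrib[symmetric] norm_mult
      by (simp add: mult.assoc[symmetric] mult.commute[of "norm (\<xi> - \<eta>)"] mult_right_mono)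
  qed (use f int in auto)
  finally show ?thesis by simp
qed

lemma fourier_even_real:
  fixes f :: "'a::euclidean_space \<Rightarrow> real"
  assumes [measurable]: "f \<in> borel_measurable borel" and even: "\<And>x. f (- x) = f x"
  shows "cnj (fourier (\<lambda>x. of_real (f x)) \<xi>) = fourier (\<lambda>x. of_real (f x)) \<xi>"
proof -
  have e_meas: "(\<lambda>x. exp (- (\<i> * complex_of_real (x \<bullet> \<xi>)))) \<in> borel_measurable borel"
    by (intro borel_measurable_continuous_onI continuous_intros)
  have "cnj (fourier (\<lambda>x. of_real (f x)) \<xi>) = (LINT x|lborel. cnj (exp (- (\<i> * of_real (x \<bullet> \<xi>))) * of_real (f x)))"
    unfolding fourier_def by (rule Bochner_Integration.integral_cnj[symmetric])
  also have "\<dots> = (LINT x|lborel. exp (- (\<i> * of_real ((0 - x) \<bullet> \<xi>))) * of_real (f (0 - x)))"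
    by (simp add: exp_cnj even)
  also have "\<dots> = fourier (\<lambda>x. of_real (f x)) \<xi>"
    unfolding fourier_def
    by (rule integral_reflect[of "\<lambda>x. exp (- (\<i> * of_real (x \<bullet> \<xi>))) * of_real (f x)"])
       (use e_meas in measurable)
  finally show ?thesis .
qed

section \<open>A potential whose Fourier transform is comparable to a power\<close>

lemma integral_lborel_affine:
  fixes f :: "'a::euclidean_space \<Rightarrow> 'b::{banach, second_countable_topology}"
  assumes f: "integrable lborel f" and c: "c \<noteq> 0"
  shows "integrable lborel (\<lambda>x. f (t + c *\<^sub>R x))"
    and "(LINT x|lborel. f x) = \<bar>c\<bar> ^ DIM('a) *\<^sub>R (LINT x|lborel. f (t + c *\<^sub>R x))"
proof -
  note [measurable] = borel_measurable_integrable[OF f]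
  have eq: "(lborel :: 'a measure) = density (distr lborel borel (\<lambda>x. t + c *\<^sub>R x)) (\<lambda>_. ennreal (\<bar>c\<bar> ^ DIM('a)))"
    using lborel_affine[OF c, of t] by simp
  have "integrable (density (distr lborel borel (\<lambda>x. t + c *\<^sub>R x)) (\<lambda>_. ennreal (\<bar>c\<bar> ^ DIM('a)))) f"
    using f eq by metis
  then have "integrable (distr lborel borel (\<lambda>x. t + c *\<^sub>R x)) (\<lambda>x. \<bar>c\<bar> ^ DIM('a) *\<^sub>R f x)"
    by (subst (asm) integrable_density) auto
  then have "integrable lborel (\<lambda>x. \<bar>c\<bar> ^ DIM('a) *\<^sub>R f (t + c *\<^sub>R x))"
    by (subst (asm) integrable_distr_eq) auto
  then have "integrable lborel (\<lambda>x. inverse (\<bar>c\<bar> ^ DIM('a)) *\<^sub>R (\<bar>c\<bar> ^ DIM('a) *\<^sub>R f (t + c *\<^sub>R x)))"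
    by (rule integrable_scaleR_right)
  then show "integrable lborel (\<lambda>x. f (t + c *\<^sub>R x))" using c by simp
  have "(LINT x|lborel. f x) = (LINT x|density (distr lborel borel (\<lambda>x. t + c *\<^sub>R x)) (\<lambda>_. ennreal (\<bar>c\<bar> ^ DIM('a))). f x)"
    using eq by metis
  also have "\<dots> = (LINT x|distr lborel borel (\<lambda>x. t + c *\<^sub>R x). \<bar>c\<bar> ^ DIM('a) *\<^sub>R f x)"
    by (subst integral_density) auto
  also have "\<dots> = (LINT x|lborel. \<bar>c\<bar> ^ DIM('a) *\<^sub>R f (t + c *\<^sub>R x))"
    by (subst integral_distr) auto
  finally show "(LINT x|lborel. f x) = \<bar>c\<bar> ^ DIM('a) *\<^sub>R (LINT x|lborel. f (t + c *\<^sub>R x))" by simp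
qed

lemma jbracket_nonzero [simp]: "jbracket x \<noteq> 0" using jbracket_pos[of x] by linarith

definition bump_hat :: "'a::euclidean_space \<Rightarrow> real" where
  "bump_hat \<xi> = Re (fourier (\<lambda>x. of_real (bump 0 1 x)) \<xi>)"

lemma fourier_bump: "fourier (\<lambda>x. of_real (bump 0 1 x)) \<xi> = of_real (bump_hat \<xi>)"
proof -
  have "cnj (fourier (\<lambda>x. of_real (bump 0 1 x)) \<xi>) = fourier (\<lambda>x. of_real (bump 0 1 x)) \<xi>"
    by (rule fourier_even_real[OF borel_measurable_bump]) (simp add: bump_def)
  then have "fourier (\<lambda>x. of_real (bump 0 1 x)) \<xi> \<in> \<real>" by (simp add: Reals_cnj_iff)
  then show ?thesis unfolding bump_hat_def by (simp add: of_real_Re)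
qed

lemma fourier_bump_square: "fourier (\<lambda>x. of_real (bump_square x)) \<xi> = of_real ((bump_hat \<xi>)\<^sup>2)"
  unfolding bump_square_convolution
  using fourier_convolution[OF integrable_bump integrable_bump, of \<xi>]
  by (simp add: fourier_bump power2_eq_square)

lemma bump_hat_decay: "\<exists>C>0. \<forall>\<xi>::'a::euclidean_space. \<bar>bump_hat \<xi>\<bar> \<le> C / jbracket \<xi> ^ N"
proof -
  have "\<exists>C>0. \<forall>\<xi>::'a. jbracket \<xi> ^ N * norm (fourier (\<lambda>x. of_real (bump 0 1 x)) \<xi>) \<le> C"
    by (rule fourier_rapid_decay[OF bump_flat_algebra, of 1]) (simp add: bump_eq_0)
  then obtain C where C: "C > 0" "\<And>\<xi>::'a. jbracket \<xi> ^ N * norm (fourier (\<lambda>x. of_real (bump 0 1 x)) \<xi>) \<le> C"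
    by blast
  show ?thesis
    using C by (intro exI[of _ C]) (auto simp: fourier_bump field_simps)
qed

lemma bump_hat_lipschitz: "\<exists>L>0. \<forall>\<xi> \<eta>::'a::euclidean_space. \<bar>bump_hat \<xi> - bump_hat \<eta>\<bar> \<le> L * norm (\<xi> - \<eta>)"
proof -
  define L where "L = (LINT x::'a|lborel. norm x * norm (complex_of_real (bump 0 1 x)))"
  have "integrable lborel (\<lambda>x::'a. norm x * norm (complex_of_real (bump 0 1 x)))"
    by (rule integrable_compact_support[of _ 1]) (auto intro!: continuous_intros simp: bump_eq_0)
  from fourier_lipschitz[OF integrable_bump this]
  have "\<bar>bump_hat \<xi> - bump_hat \<eta>\<bar> \<le> norm (\<xi> - \<eta>) * L" for \<xi> \<eta> :: 'a
    unfolding fourier_bump L_def by (simp only: of_real_diff[symmetric] norm_of_real)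
  then have "\<bar>bump_hat \<xi> - bump_hat \<eta>\<bar> \<le> (\<bar>L\<bar> + 1) * norm (\<xi> - \<eta>)" for \<xi> \<eta> :: 'a
    by (rule order_trans, subst mult.commute, intro mult_right_mono) auto
  then show ?thesis by (intro exI[of _ "\<bar>L\<bar> + 1"] conjI allI) auto
qed

text \<open>In the factorisation of a difference of squares one factor is controlled by the
  Lipschitz constant and the other one by the decay, so the increments decay as fast as the
  function.\<close>

lemma bump_hat_square_decay:
  "\<exists>C>0. \<forall>\<xi>::'a::euclidean_space. (bump_hat \<xi>)\<^sup>2 \<le> C / jbracket \<xi> ^ N \<and>
     (\<forall>\<eta>. norm (\<xi> - \<eta>) \<le> 1 \<longrightarrow> \<bar>(bump_hat \<xi>)\<^sup>2 - (bump_hat \<eta>)\<^sup>2\<bar> \<le> C * norm (\<xi> - \<eta>) / jbracket \<xi> ^ N)"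
proof -
  obtain C where C: "C > 0" "\<And>\<xi>::'a. \<bar>bump_hat \<xi>\<bar> \<le> C / jbracket \<xi> ^ N" using bump_hat_decay by blast
  obtain L where L: "L > 0" "\<And>\<xi> \<eta>::'a. \<bar>bump_hat \<xi> - bump_hat \<eta>\<bar> \<le> L * norm (\<xi> - \<eta>)" using bump_hat_lipschitz by blast
  define K where "K = C\<^sup>2 + L * (C + C * 2 ^ N)"
  have K: "C\<^sup>2 \<le> K" "L * (C + C * 2 ^ N) \<le> K" "0 < K" using C L by (auto simp: K_def add_pos_pos)
  have "(bump_hat \<xi>)\<^sup>2 \<le> K / jbracket \<xi> ^ N" for \<xi> :: 'a
  proof -
    have "(bump_hat \<xi>)\<^sup>2 \<le> (C / jbracket \<xi> ^ N)\<^sup>2" using power_mono[OF C(2)[of \<xi>], of 2] by simp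
    also have "\<dots> = C\<^sup>2 / (jbracket \<xi> ^ N * jbracket \<xi> ^ N)" by (simp add: power2_eq_square)
    also have "\<dots> \<le> C\<^sup>2 / jbracket \<xi> ^ N"
    proof (rule divide_left_mono)
      show "jbracket \<xi> ^ N \<le> jbracket \<xi> ^ N * jbracket \<xi> ^ N"
        using one_le_power[OF jbracket_ge_1[of \<xi>], of N] by simp
    qed auto
    also have "\<dots> \<le> K / jbracket \<xi> ^ N" using K by (intro divide_right_mono) (auto intro: less_imp_le)
    finally show ?thesis .
  qed
  moreover have "\<bar>(bump_hat \<xi>)\<^sup>2 - (bump_hat \<eta>)\<^sup>2\<bar> \<le> K * norm (\<xi> - \<eta>) / jbracket \<xi> ^ N" if "norm (\<xi> - \<eta>) \<le> 1" for \<xi> \<eta> :: 'a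
  proof -
    have "jbracket \<xi> \<le> 2 * jbracket \<eta>" by (rule jbracket_shift) (use that in \<open>simp add: norm_minus_commute\<close>)
    then have "jbracket \<xi> ^ N \<le> 2 ^ N * jbracket \<eta> ^ N"
      using power_mono[of "jbracket \<xi>" "2 * jbracket \<eta>" N] by (simp add: power_mult_distrib less_imp_le)
    then have "C / jbracket \<eta> ^ N \<le> C * 2 ^ N / jbracket \<xi> ^ N"
      using C(1) by (simp add: field_simps)
    then have 1: "\<bar>bump_hat \<xi> + bump_hat \<eta>\<bar> \<le> (C + C * 2 ^ N) / jbracket \<xi> ^ N"
      using C(2)[of \<xi>] C(2)[of \<eta>] by (simp add: add_divide_distrib)
    have "\<bar>(bump_hat \<xi>)\<^sup>2 - (bump_hat \<eta>)\<^sup>2\<bar> = \<bar>bump_hat \<xi> - bump_hat \<eta>\<bar> * \<bar>bump_hat \<xi> + bump_hat \<eta>\<bar>"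
      by (simp add: abs_mult[symmetric] power2_eq_square algebra_simps)
    also have "\<dots> \<le> (L * norm (\<xi> - \<eta>)) * ((C + C * 2 ^ N) / jbracket \<xi> ^ N)"
      by (rule mult_mono[OF L(2) 1]) (use L(1) in auto)
    also have "\<dots> = L * (C + C * 2 ^ N) * norm (\<xi> - \<eta>) / jbracket \<xi> ^ N" by simp
    also have "\<dots> \<le> K * norm (\<xi> - \<eta>) / jbracket \<xi> ^ N"
      using K by (intro divide_right_mono mult_right_mono) (auto intro: less_imp_le)
    finally show ?thesis .
  qed
  ultimately show ?thesis using K(3) by blast
qed

lemma bump_hat_square_lower:
  "\<exists>c>0. \<exists>\<rho>>0. \<rho> \<le> 1 \<and> (\<forall>\<xi>::'a::euclidean_space. norm \<xi> \<le> \<rho> \<longrightarrow> c \<le> (bump_hat \<xi>)\<^sup>2)"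
proof -
  obtain L where L: "L > 0" "\<And>\<xi> \<eta>::'a. \<bar>bump_hat \<xi> - bump_hat \<eta>\<bar> \<le> L * norm (\<xi> - \<eta>)" using bump_hat_lipschitz by blast
  have "0 < exp (- 2) * measure lborel (cball (0::'a) (1/2))"
    by (simp add: content_cball_pos)
  also have "\<dots> = (LINT x|lborel. exp (- 2) * indicator (cball (0::'a) (1/2)) x)" by simp
  also have "\<dots> \<le> (LINT x::'a|lborel. bump 0 1 x)"
  proof (rule integral_mono)
    show "integrable lborel (\<lambda>x. exp (- 2) * indicator (cball (0::'a) (1/2)) x :: real)"
      using emeasure_lborel_cball_finite[of "0::'a" "1/2"] by simp
    show "integrable lborel (bump (0::'a) 1)"
      by (rule integrable_compact_support[of _ 1]) (auto intro!: continuous_on_bump simp: bump_eq_0)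
    show "exp (- 2) * indicator (cball (0::'a) (1/2)) x \<le> bump 0 1 x" for x
      using bump_lower[of 1 x 0] bump_bounds(1)[of 0 1 x] by (auto split: split_indicator)
  qed
  also have "(LINT x::'a|lborel. bump 0 1 x) = bump_hat (0::'a)" by (simp add: bump_hat_def fourier_def)
  finally have b0: "0 < bump_hat (0::'a)" .
  define b where "b = bump_hat (0::'a)"
  define \<rho> where "\<rho> = min 1 (b / (2 * L))"
  have \<rho>: "\<rho> > 0" "\<rho> \<le> 1" using b0 L(1) by (auto simp: \<rho>_def b_def)
  have "(b / 2)\<^sup>2 \<le> (bump_hat \<xi>)\<^sup>2" if "norm \<xi> \<le> \<rho>" for \<xi> :: 'a
  proof -
    have "L * norm \<xi> \<le> L * (b / (2 * L))" using that L(1) by (intro mult_left_mono) (auto simp: \<rho>_def)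
    then have "L * norm \<xi> \<le> b / 2" using L(1) by simp
    then have "b / 2 \<le> bump_hat \<xi>" using L(2)[of \<xi> 0] by (simp add: b_def)
    then show ?thesis using b0 by (intro power_mono) (auto simp: b_def)
  qed
  then show ?thesis using \<rho> b0 by (intro exI[of _ "(b / 2)\<^sup>2"] exI[of _ \<rho>] conjI) (auto simp: b_def)
qed

text \<open>With \<open>v = t\<^sup>s\<close> this is the average of the \<open>L\<^sup>1\<close>-normalised dilates \<open>t\<^sup>-\<^sup>n h(x/t)\<close> of
  \<open>h = bump_square\<close> over \<open>0 < t < 1\<close> with density \<open>s t\<^sup>s\<^sup>-\<^sup>1\<close>. The Fourier transform of the dilate
  is of size 1 for \<open>|\<xi>| < 1/t\<close> and negligible beyond, so that of the average is of size
  \<open>|\<xi>|\<^sup>-\<^sup>s\<close>.\<close>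

definition potential :: "real \<Rightarrow> 'a::euclidean_space \<Rightarrow> real" where
  "potential s x = (LINT v|lborel. indicator {0<..<1} v *
     ((v powr (- (1 / s))) ^ DIM('a) * bump_square (v powr (- (1 / s)) *\<^sub>R x)))"

definition potential_hat :: "real \<Rightarrow> 'a::euclidean_space \<Rightarrow> real" where
  "potential_hat s \<xi> = (LINT v|lborel. indicator {0<..<1} v * (bump_hat (v powr (1 / s) *\<^sub>R \<xi>))\<^sup>2)"

lemma radial_potential: "radial (potential s :: 'a::euclidean_space \<Rightarrow> real)"
  unfolding radial_def
proof (intro allI impI)
  fix x y :: 'a assume "norm x = norm y"
  then have "bump_square (c *\<^sub>R x) = bump_square (c *\<^sub>R y)" for c
    using radial_bump_square[where 'a = 'a] by (simp add: radial_def)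
  then show "potential s x = potential s y" by (simp add: potential_def)
qed

lemma potential_eq_0:
  fixes x :: "'a::euclidean_space"
  assumes "s > 0" "2 < norm x"
  shows "potential s x = 0"
proof -
  have "indicator {0<..<1} v * ((v powr (- (1 / s))) ^ DIM('a) * bump_square (v powr (- (1 / s)) *\<^sub>R x)) = 0" for v :: real
  proof (cases "v \<in> {0<..<1}")
    case True
    then have "1 \<le> v powr (- (1 / s))" using assms by (simp add: powr_minus one_le_inverse powr_le1)
    then have "2 < norm (v powr (- (1 / s)) *\<^sub>R x)"
      using assms(2) mult_right_mono[of 1 "v powr (- (1 / s))" "norm x"] by simp
    then show ?thesis by (simp add: bump_square_eq_0)
  qed simp
  then show ?thesis unfolding potential_def by (simp only: integral_zero)
qed

lemma compactly_supported_potential: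
  assumes "s > 0" shows "compactly_supported (potential s :: 'a::euclidean_space \<Rightarrow> real)"
proof -
  have "{x::'a. potential s x \<noteq> 0} \<subseteq> cball 0 2" using potential_eq_0[OF assms] by (force simp: not_le[symmetric])
  then show ?thesis
    unfolding compactly_supported_def compact_closure by (rule bounded_subset[OF bounded_cball])
qed

lemma borel_measurable_bump_square [measurable]: "bump_square \<in> borel_measurable borel"
  by (rule borel_measurable_continuous_onI[OF continuous_on_bump_square])

lemma borel_measurable_bump_hat [measurable]: "bump_hat \<in> borel_measurable (borel :: 'a::euclidean_space measure)"
proof -
  obtain L where L: "L > 0" "\<And>\<xi> \<eta>::'a. \<bar>bump_hat \<xi> - bump_hat \<eta>\<bar> \<le> L * norm (\<xi> - \<eta>)" using bump_hat_lipschitz by blast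
  then have "L-lipschitz_on UNIV (bump_hat :: 'a \<Rightarrow> real)" by (intro lipschitz_onI) (auto simp: dist_norm)
  then show ?thesis by (intro borel_measurable_continuous_onI lipschitz_on_continuous_on)
qed

text \<open>All dilates have the same \<open>L\<^sup>1\<close> norm, so the integrand is jointly integrable in \<open>v\<close> and \<open>x\<close>,
  and both claims follow from Fubini's theorem.\<close>

lemma potential_fourier:
  fixes \<xi> :: "'a::euclidean_space"
  assumes s: "s > 0"
  shows "integrable lborel (potential s :: 'a \<Rightarrow> real)"
    and "fourier (\<lambda>x. of_real (potential s x)) \<xi> = of_real (potential_hat s \<xi>)"
proof -
  let ?c = "\<lambda>v. v powr (- (1 / s))"
  let ?e = "\<lambda>\<xi> x::'a. exp (- (\<i> * of_real (x \<bullet> \<xi>)))"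
  let ?f = "\<lambda>\<xi> v x. complex_of_real (indicator {0<..<1} v) * (?e \<xi> x * of_real ((?c v) ^ DIM('a) * bump_square (?c v *\<^sub>R x)))"
  have e_meas: "?e \<xi> \<in> borel_measurable borel" for \<xi> by (intro borel_measurable_continuous_onI continuous_intros)
  note [measurable] = e_meas
  have h: "integrable lborel (\<lambda>x::'a. complex_of_real (bump_square x))"
    by (rule integrable_compact_support[of _ 2]) (auto intro!: continuous_on_bump_square continuous_on_of_real simp: bump_square_eq_0)
  have g: "integrable lborel (\<lambda>x::'a. ?e \<xi> x * complex_of_real (bump_square x))" for \<xi>
    by (rule integrable_bounded_mult[where L = 1, OF e_meas _ h]) simp
  have c: "?c v > 0" if "v \<in> {0<..<1}" for v using that by simp
  have scal: "integrable lborel (\<lambda>x. ?f \<xi> v x)"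
      "(LINT x|lborel. ?f \<xi> v x) = of_real (indicator {0<..<1} v * (bump_hat (v powr (1 / s) *\<^sub>R \<xi>))\<^sup>2)"
      "(LINT x|lborel. norm (?f \<xi> v x)) = indicator {0<..<1} v * (LINT x::'a|lborel. norm (complex_of_real (bump_square x)))" for v \<xi>
  proof (goal_cases)
    case 1
    show ?case
    proof (cases "v \<in> {0<..<1}")
      case True
      from integral_lborel_affine(1)[OF g[of "inverse (?c v) *\<^sub>R \<xi>"], of "?c v" 0] c[OF True]
      have "integrable lborel (\<lambda>x::'a. ?e (inverse (?c v) *\<^sub>R \<xi>) (?c v *\<^sub>R x) * complex_of_real (bump_square (?c v *\<^sub>R x)))"
        unfolding add_0 by auto
      moreover have "(?c v *\<^sub>R x) \<bullet> (inverse (?c v) *\<^sub>R \<xi>) = x \<bullet> \<xi>" for x using c[OF True] by simp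
      ultimately have "integrable lborel (\<lambda>x::'a. ?e \<xi> x * complex_of_real (bump_square (?c v *\<^sub>R x)))"
        by (simp only:)
      then have "integrable lborel (\<lambda>x::'a. of_real ((?c v) ^ DIM('a)) * (?e \<xi> x * complex_of_real (bump_square (?c v *\<^sub>R x))))"
        by (rule integrable_mult_right)
      then show ?thesis using True by (simp add: mult_ac)
    qed simp
  next
    case 2
    show ?case
    proof (cases "v \<in> {0<..<1}")
      case True
      have "of_real ((bump_hat (v powr (1 / s) *\<^sub>R \<xi>))\<^sup>2) = (LINT x::'a|lborel. ?e (v powr (1 / s) *\<^sub>R \<xi>) x * complex_of_real (bump_square x))"
        unfolding fourier_bump_square[symmetric] fourier_def ..
      also have "\<dots> = (?c v) ^ DIM('a) *\<^sub>R (LINT x::'a|lborel. ?e (v powr (1 / s) *\<^sub>R \<xi>) (0 + ?c v *\<^sub>R x) * complex_of_real (bump_square (0 + ?c v *\<^sub>R x)))"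
        using integral_lborel_affine(2)[OF g[of "v powr (1 / s) *\<^sub>R \<xi>"], of "?c v" 0] c[OF True] by simp
      also have "\<dots> = (LINT x::'a|lborel. (?c v) ^ DIM('a) *\<^sub>R (?e (v powr (1 / s) *\<^sub>R \<xi>) (0 + ?c v *\<^sub>R x) * complex_of_real (bump_square (0 + ?c v *\<^sub>R x))))"
        by (rule integral_scaleR_right[symmetric])
      also have "\<dots> = (LINT x|lborel. ?f \<xi> v x)"
      proof (rule Bochner_Integration.integral_cong)
        fix x :: 'a
        have ip: "(0 + ?c v *\<^sub>R x) \<bullet> (v powr (1 / s) *\<^sub>R \<xi>) = x \<bullet> \<xi>" using True by (simp add: powr_minus)
        show "(?c v) ^ DIM('a) *\<^sub>R (?e (v powr (1 / s) *\<^sub>R \<xi>) (0 + ?c v *\<^sub>R x) * complex_of_real (bump_square (0 + ?c v *\<^sub>R x))) = ?f \<xi> v x"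
          unfolding ip using True by (simp add: scaleR_conv_of_real)
      qed simp
      finally show ?thesis using True by simp
    qed simp
  next
    case 3
    show ?case
    proof (cases "v \<in> {0<..<1}")
      case True
      have "(LINT x::'a|lborel. norm (complex_of_real (bump_square x)))
        = (?c v) ^ DIM('a) *\<^sub>R (LINT x::'a|lborel. norm (complex_of_real (bump_square (0 + ?c v *\<^sub>R x))))"
        using integral_lborel_affine(2)[OF integrable_norm[OF h], of "?c v" 0] c[OF True] by simp
      also have "\<dots> = (LINT x|lborel. norm (?f \<xi> v x))"
        using True c[OF True] by (subst integral_scaleR_right[symmetric]) (auto simp: norm_mult norm_power abs_mult)
      finally show ?thesis using True by simp
    qed simp
  qed
  have ind: "integrable lborel (indicator {0<..<1::real} :: real \<Rightarrow> real)" by simp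
  have int: "integrable (lborel \<Otimes>\<^sub>M lborel) (\<lambda>(v, x). ?f \<xi> v x)" for \<xi>
  proof (rule lborel_pair.Fubini_integrable)
    show "integrable lborel (\<lambda>v. LINT x|lborel. norm (case (v, x) of (v, x) \<Rightarrow> ?f \<xi> v x))"
      unfolding prod.case scal using ind by simp
    show "AE v in lborel. integrable lborel (\<lambda>x. case (v, x) of (v, x) \<Rightarrow> ?f \<xi> v x)"
      unfolding prod.case using scal(1) by simp
  qed measurable
  have pot: "complex_of_real (potential s x) * ?e \<xi> x = (LINT v|lborel. ?f \<xi> v x)" for x \<xi>
  proof -
    have "(LINT v|lborel. ?f \<xi> v x) = (LINT v|lborel. complex_of_real (indicator {0<..<1} v * ((?c v) ^ DIM('a) * bump_square (?c v *\<^sub>R x))) * ?e \<xi> x)"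
      by (rule Bochner_Integration.integral_cong) auto
    also have "\<dots> = complex_of_real (potential s x) * ?e \<xi> x"
      unfolding potential_def by (subst integral_mult_left_zero) (simp only: integral_complex_of_real)
    finally show ?thesis by simp
  qed
  have "integrable lborel (\<lambda>x. LINT v|lborel. ?f 0 v x)" by (rule lborel_pair.integrable_snd[OF int])
  then have "integrable lborel (\<lambda>x. Re (complex_of_real (potential s x) * ?e 0 x))" unfolding pot by (rule integrable_Re)
  then show "integrable lborel (potential s :: 'a \<Rightarrow> real)" by simp
  have "fourier (\<lambda>x. of_real (potential s x)) \<xi> = (LINT x|lborel. LINT v|lborel. ?f \<xi> v x)"
    unfolding fourier_def pot[symmetric] by (simp only: mult.commute)
  also have "\<dots> = (LINT v|lborel. LINT x|lborel. ?f \<xi> v x)" by (rule lborel_pair.Fubini_integral[OF int])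
  also have "\<dots> = of_real (potential_hat s \<xi>)" unfolding scal potential_hat_def by (rule integral_complex_of_real)
  finally show "fourier (\<lambda>x. of_real (potential s x)) \<xi> = of_real (potential_hat s \<xi>)" .
qed

lemma integral_inverse_square:
  fixes \<Lambda> :: real assumes "\<Lambda> > 0"
  shows "integrable lborel (\<lambda>v. indicator {0<..<1} v * (1 / (1 + v * \<Lambda>)\<^sup>2))"
    and "(LINT v|lborel. indicator {0<..<1} v * (1 / (1 + v * \<Lambda>)\<^sup>2)) \<le> 1 / \<Lambda>"
proof -
  have "has_bochner_integral lborel (\<lambda>v. (1 / (1 + v * \<Lambda>)\<^sup>2) * indicator {0..1} v) (1 / (1 + 1 * \<Lambda>) - 0 / (1 + 0 * \<Lambda>))"
  proof (rule has_bochner_integral_FTC_Icc_nonneg[where F = "\<lambda>v. v / (1 + v * \<Lambda>)"])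
    fix v :: real assume v: "v \<in> {0..1}"
    then have "1 + v * \<Lambda> > 0" using assms by (simp add: add_pos_nonneg)
    then show "((\<lambda>v. v / (1 + v * \<Lambda>)) has_real_derivative 1 / (1 + v * \<Lambda>)\<^sup>2) (at v)"
      by (auto intro!: derivative_eq_intros simp: power2_eq_square algebra_simps)
  qed auto
  moreover have "AE v in lborel. (1 / (1 + v * \<Lambda>)\<^sup>2) * indicator {0..1} v = indicator {0<..<1} v * (1 / (1 + v * \<Lambda>)\<^sup>2)"
    using AE_lborel_singleton[of 0] AE_lborel_singleton[of 1] by eventually_elim (auto split: split_indicator)
  ultimately have "has_bochner_integral lborel (\<lambda>v. indicator {0<..<1} v * (1 / (1 + v * \<Lambda>)\<^sup>2)) (1 / (1 + 1 * \<Lambda>) - 0 / (1 + 0 * \<Lambda>))"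
    by (subst has_bochner_integral_cong_AE[symmetric]) (auto elim: eventually_mono)
  moreover have "1 / (1 + 1 * \<Lambda>) - 0 / (1 + 0 * \<Lambda>) \<le> 1 / \<Lambda>" using assms by (simp add: frac_le)
  ultimately show "integrable lborel (\<lambda>v. indicator {0<..<1} v * (1 / (1 + v * \<Lambda>)\<^sup>2))"
    "(LINT v|lborel. indicator {0<..<1} v * (1 / (1 + v * \<Lambda>)\<^sup>2)) \<le> 1 / \<Lambda>"
    unfolding has_bochner_integral_iff by (blast, linarith)
qed

text \<open>For \<open>t = v powr (1/s) \<le> 1\<close> the bracket of \<open>t \<xi>\<close> is at least 1 and at least \<open>t\<close> times the
  bracket of \<open>\<xi>\<close>; the power \<open>s\<close> of the latter bound is \<open>v * jbracket \<xi> powr s\<close>. The mean of the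
  two bounds gives a majorant that has an elementary primitive in \<open>v\<close>.\<close>

lemma jbracket_dilate_lower:
  fixes \<xi> :: "'a::euclidean_space"
  assumes s: "s > 0" and v: "v \<in> {0<..<1}" and N: "2 * s \<le> real N"
  shows "1 / jbracket (v powr (1 / s) *\<^sub>R \<xi>) ^ N \<le> 4 / (1 + v * jbracket \<xi> powr s)\<^sup>2"
proof -
  define t where "t = v powr (1 / s)"
  have t: "0 < t" "t \<le> 1" using v s by (auto simp: t_def powr_le1)
  define J where "J = jbracket (t *\<^sub>R \<xi>)"
  have J1: "1 \<le> J" by (simp add: J_def jbracket_ge_1)
  have "t * jbracket \<xi> \<le> J"
  proof -
    have "(t * jbracket \<xi>)\<^sup>2 = t\<^sup>2 + (t * norm \<xi>)\<^sup>2"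
      by (simp add: jbracket_eq power_mult_distrib algebra_simps)
    also have "\<dots> \<le> 1 + (t * norm \<xi>)\<^sup>2" using t power_le_one[of t 2] by simp
    also have "\<dots> = J\<^sup>2" using t by (simp add: J_def jbracket_eq)
    finally show ?thesis using power2_le_imp_le[of "t * jbracket \<xi>" J] J1 by simp
  qed
  then have "(t * jbracket \<xi>) powr s \<le> J powr s" using t s by (intro powr_mono2) (auto simp: less_imp_le)
  moreover have "(t * jbracket \<xi>) powr s = v * jbracket \<xi> powr s"
    using t s v by (simp add: powr_mult less_imp_le) (simp add: t_def powr_powr)
  moreover have "1 \<le> J powr s" using J1 s by (simp add: ge_one_powr_ge_zero)
  ultimately have "(1 + v * jbracket \<xi> powr s) / 2 \<le> J powr s" by simp
  then have "((1 + v * jbracket \<xi> powr s) / 2)\<^sup>2 \<le> (J powr s)\<^sup>2"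
    using v by (intro power_mono) auto
  also have "(J powr s)\<^sup>2 = J powr (2 * s)" using J1 by (simp add: power2_eq_square powr_add[symmetric])
  also have "\<dots> \<le> J powr real N" using J1 N by (intro powr_mono) auto
  also have "\<dots> = J ^ N" using J1 by (simp add: powr_realpow)
  finally have "(1 + v * jbracket \<xi> powr s)\<^sup>2 \<le> 4 * J ^ N" by (simp add: power_divide)
  moreover have "0 < 1 + v * jbracket \<xi> powr s" using v by (intro add_pos_nonneg) auto
  then have "0 < (1 + v * jbracket \<xi> powr s)\<^sup>2" by simp
  moreover have "0 < J ^ N" using J1 by simp
  ultimately show ?thesis unfolding t_def[symmetric] J_def[symmetric] by (simp add: field_simps)
qed

text \<open>Values and increments are bounded above by the majorant of \<open>jbracket_dilate_lower\<close>, whose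
  integral over \<open>v\<close> is at most \<open>4 * jbracket \<xi> powr - s\<close>. For the lower bound it is enough to
  keep the dilates with \<open>|t \<xi>| \<le> \<rho>\<close>; they fill an interval of \<open>v\<close> of length comparable to
  \<open>jbracket \<xi> powr - s\<close>.\<close>

theorem potential_hat_bounds:
  fixes s :: real
  assumes s: "s > 0"
  shows "\<exists>c>0. \<exists>C>0. \<forall>\<xi>::'a::euclidean_space.
     c * jbracket \<xi> powr - s \<le> potential_hat s \<xi> \<and> potential_hat s \<xi> \<le> C * jbracket \<xi> powr - s \<and>
     (\<forall>\<eta>. norm (\<xi> - \<eta>) \<le> 1 \<longrightarrow> \<bar>potential_hat s \<xi> - potential_hat s \<eta>\<bar> \<le> C * norm (\<xi> - \<eta>) * jbracket \<xi> powr - s)"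
proof -
  obtain N :: nat where N: "2 * s \<le> real N" using real_arch_simple by blast
  obtain K where K: "K > 0" "\<And>\<xi>::'a. (bump_hat \<xi>)\<^sup>2 \<le> K / jbracket \<xi> ^ N"
    "\<And>\<xi> \<eta>::'a. norm (\<xi> - \<eta>) \<le> 1 \<Longrightarrow> \<bar>(bump_hat \<xi>)\<^sup>2 - (bump_hat \<eta>)\<^sup>2\<bar> \<le> K * norm (\<xi> - \<eta>) / jbracket \<xi> ^ N"
    using bump_hat_square_decay[of N, where 'a = 'a] by blast
  obtain c \<rho> where c: "c > 0" "\<rho> > 0" "\<rho> \<le> 1" "\<And>\<xi>::'a. norm \<xi> \<le> \<rho> \<Longrightarrow> c \<le> (bump_hat \<xi>)\<^sup>2"
    using bump_hat_square_lower[where 'a = 'a] by blast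
  let ?I = "\<lambda>v. indicator {0<..<1} v :: real"
  let ?h = "\<lambda>\<xi>::'a. \<lambda>v. ?I v * (bump_hat (v powr (1 / s) *\<^sub>R \<xi>))\<^sup>2"
  have L: "jbracket \<xi> powr s > 0" for \<xi> :: 'a by simp
  have up: "?h \<xi> v \<le> 4 * K * (?I v * (1 / (1 + v * jbracket \<xi> powr s)\<^sup>2))" for \<xi> v
  proof (cases "v \<in> {0<..<1}")
    case True
    have "(bump_hat (v powr (1 / s) *\<^sub>R \<xi>))\<^sup>2 \<le> K * (1 / jbracket (v powr (1 / s) *\<^sub>R \<xi>) ^ N)" using K(2) by simp
    also have "\<dots> \<le> K * (4 / (1 + v * jbracket \<xi> powr s)\<^sup>2)"
      using K(1) by (intro mult_left_mono jbracket_dilate_lower[OF s True N]) auto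
    finally show ?thesis using True by (simp add: mult.commute[of K])
  qed simp
  have hint: "integrable lborel (?h \<xi>)" for \<xi>
  proof (rule Bochner_Integration.integrable_bound)
    show "integrable lborel (\<lambda>v. 4 * K * (?I v * (1 / (1 + v * jbracket \<xi> powr s)\<^sup>2)))"
      by (intro integrable_mult_right integral_inverse_square L)
    show "AE v in lborel. norm (?h \<xi> v) \<le> norm (4 * K * (?I v * (1 / (1 + v * jbracket \<xi> powr s)\<^sup>2)))"
    proof (rule AE_I2)
      fix v show "norm (?h \<xi> v) \<le> norm (4 * K * (?I v * (1 / (1 + v * jbracket \<xi> powr s)\<^sup>2)))"
        using up[of v \<xi>] K(1) by (simp add: abs_mult)
    qed
  qed measurable
  have upper: "potential_hat s \<xi> \<le> 4 * K * jbracket \<xi> powr - s" for \<xi> :: 'a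
  proof -
    have "potential_hat s \<xi> \<le> (LINT v|lborel. 4 * K * (?I v * (1 / (1 + v * jbracket \<xi> powr s)\<^sup>2)))"
      unfolding potential_hat_def by (intro integral_mono hint up integrable_mult_right integral_inverse_square L)
    also have "\<dots> = 4 * K * (LINT v|lborel. (?I v * (1 / (1 + v * jbracket \<xi> powr s)\<^sup>2)))"
      by (rule integral_mult_right_zero)
    also have "\<dots> \<le> 4 * K * (1 / jbracket \<xi> powr s)"
      using K(1) by (intro mult_left_mono integral_inverse_square(2) L) auto
    finally show ?thesis by (simp add: powr_minus inverse_eq_divide)
  qed
  have lip: "\<bar>potential_hat s \<xi> - potential_hat s \<eta>\<bar> \<le> 4 * K * norm (\<xi> - \<eta>) * jbracket \<xi> powr - s"
    if d: "norm (\<xi> - \<eta>) \<le> 1" for \<xi> \<eta> :: 'a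
  proof -
    have eq: "potential_hat s \<xi> - potential_hat s \<eta> = (LINT v|lborel. ?h \<xi> v - ?h \<eta> v)"
      unfolding potential_hat_def by (rule Bochner_Integration.integral_diff[symmetric]) (rule hint)+
    have "\<bar>LINT v|lborel. ?h \<xi> v - ?h \<eta> v\<bar> \<le> (LINT v|lborel. (4 * K * norm (\<xi> - \<eta>)) * (?I v * (1 / (1 + v * jbracket \<xi> powr s)\<^sup>2)))"
      unfolding real_norm_def[symmetric]
    proof (rule Bochner_Integration.integral_norm_bound_integral)
      show "integrable lborel (\<lambda>v. ?h \<xi> v - ?h \<eta> v)" by (intro Bochner_Integration.integrable_diff hint)
      show "integrable lborel (\<lambda>v. (4 * K * norm (\<xi> - \<eta>)) * (?I v * (1 / (1 + v * jbracket \<xi> powr s)\<^sup>2)))"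
        by (intro integrable_mult_right integral_inverse_square L)
      fix v :: real
      show "norm (?h \<xi> v - ?h \<eta> v) \<le> (4 * K * norm (\<xi> - \<eta>)) * (?I v * (1 / (1 + v * jbracket \<xi> powr s)\<^sup>2))"
      proof (cases "v \<in> {0<..<1}")
        case True
        define t where "t = v powr (1 / s)"
        have t: "0 \<le> t" "t \<le> 1" using True s by (auto simp: t_def powr_le1)
        have nt: "norm (t *\<^sub>R \<xi> - t *\<^sub>R \<eta>) = t * norm (\<xi> - \<eta>)"
          using t by (simp add: scaleR_diff_right[symmetric])
        then have nt1: "norm (t *\<^sub>R \<xi> - t *\<^sub>R \<eta>) \<le> norm (\<xi> - \<eta>)" using t by (simp add: mult_left_le_one_le)
        have "\<bar>(bump_hat (t *\<^sub>R \<xi>))\<^sup>2 - (bump_hat (t *\<^sub>R \<eta>))\<^sup>2\<bar> \<le> K * norm (t *\<^sub>R \<xi> - t *\<^sub>R \<eta>) / jbracket (t *\<^sub>R \<xi>) ^ N"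
          using nt1 d by (intro K(3)) auto
        also have "\<dots> \<le> (K * norm (\<xi> - \<eta>)) * (1 / jbracket (t *\<^sub>R \<xi>) ^ N)"
          using nt1 K(1) by (auto intro!: divide_right_mono mult_left_mono simp: less_imp_le)
        also have "\<dots> \<le> (K * norm (\<xi> - \<eta>)) * (4 / (1 + v * jbracket \<xi> powr s)\<^sup>2)"
          unfolding t_def using K(1) by (intro mult_left_mono jbracket_dilate_lower[OF s True N]) auto
        finally show ?thesis using True by (simp add: t_def mult_ac)
      qed simp
    qed
    also have "\<dots> = (4 * K * norm (\<xi> - \<eta>)) * (LINT v|lborel. (?I v * (1 / (1 + v * jbracket \<xi> powr s)\<^sup>2)))"
      by (rule integral_mult_right_zero)
    also have "\<dots> \<le> (4 * K * norm (\<xi> - \<eta>)) * (1 / jbracket \<xi> powr s)"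
      using K(1) by (intro mult_left_mono integral_inverse_square(2) L) auto
    finally show ?thesis unfolding eq by (simp add: powr_minus inverse_eq_divide)
  qed
  have lower: "c * \<rho> powr s * jbracket \<xi> powr - s \<le> potential_hat s \<xi>" for \<xi> :: 'a
  proof -
    define v0 where "v0 = (\<rho> / jbracket \<xi>) powr s"
    have q: "0 < \<rho> / jbracket \<xi>" "\<rho> / jbracket \<xi> \<le> 1" using c jbracket_ge_1[of \<xi>] by (auto simp: field_simps)
    have "\<bar>\<rho> / jbracket \<xi>\<bar> \<le> 1" using q by linarith
    then have v0: "0 < v0" "v0 \<le> 1"
      unfolding v0_def using q(1) s powr_le1[of s "\<rho> / jbracket \<xi>"] by (simp_all only: powr_gt_zero less_imp_le)
    have "c * v0 = (LINT v|lborel. c * indicator {0<..<v0} v)" using v0 by simp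
    also have "\<dots> \<le> potential_hat s \<xi>"
      unfolding potential_hat_def
    proof (intro integral_mono hint integrable_mult_right)
      show "integrable lborel (indicator {0<..<v0} :: real \<Rightarrow> real)"
        by (rule integrable_real_indicator) (use v0 in auto)
      fix v :: real
      show "c * indicator {0<..<v0} v \<le> ?h \<xi> v"
      proof (cases "v \<in> {0<..<v0}")
        case True
        have "v powr (1 / s) \<le> v0 powr (1 / s)" using True s by (intro powr_mono2) auto
        also have "\<dots> = \<rho> / jbracket \<xi>" using q s c(2) by (simp add: v0_def powr_powr abs_of_pos)
        finally have "v powr (1 / s) * norm \<xi> \<le> \<rho> / jbracket \<xi> * jbracket \<xi>"
          using q norm_le_jbracket[of \<xi>] by (intro mult_mono) auto
        then have "norm (v powr (1 / s) *\<^sub>R \<xi>) \<le> \<rho>" by simp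
        from c(4)[OF this] show ?thesis using True v0 by simp
      qed (auto split: split_indicator)
    qed
    also have "v0 = \<rho> powr s * jbracket \<xi> powr - s"
      using c by (simp add: v0_def powr_divide less_imp_le powr_minus field_simps)
    finally show ?thesis by (simp add: mult.assoc)
  qed
  show ?thesis
    using lower upper lip c K(1) by (intro exI[of _ "c * \<rho> powr s"] conjI exI[of _ "4 * K"] allI) auto
qed

section \<open>Integrals over spheres\<close>

lemma AE_surface_measure_sphere: "AE \<omega> in (surface_measure :: 'a::euclidean_space measure). norm \<omega> = 1"
proof -
  have "(\<integral>\<^sup>+\<omega>. indicator {\<omega>. norm \<omega> \<noteq> 1} \<omega> \<partial>(surface_measure :: 'a measure)) = 0"
  proof -
    have "AE x in (lborel :: 'a measure). indicator {\<omega>. norm \<omega> \<noteq> 1} (sgn x) * indicator (ball 0 1) x = (0 :: ennreal)"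
      using AE_lborel_singleton[of 0] by eventually_elim (simp add: norm_sgn)
    then have "(\<integral>\<^sup>+x. indicator {\<omega>. norm \<omega> \<noteq> 1} (sgn x) * indicator (ball 0 1) x \<partial>(lborel :: 'a measure)) = (\<integral>\<^sup>+x. 0 \<partial>(lborel :: 'a measure))"
      by (rule nn_integral_cong_AE)
    then show ?thesis by (subst nn_integral_surface_measure) simp_all
  qed
  then have "AE \<omega> in (surface_measure :: 'a measure). indicator {\<omega>. norm \<omega> \<noteq> 1} \<omega> = (0 :: ennreal)"
    by (subst (asm) nn_integral_0_iff_AE) auto
  then show ?thesis by eventually_elim (auto simp: indicator_def split: if_splits)
qed

lemma finite_surface_measure: "finite_measure (surface_measure :: 'a::euclidean_space measure)"
proof
  have "emeasure (surface_measure :: 'a measure) (space surface_measure) = (\<integral>\<^sup>+\<omega>. 1 \<partial>(surface_measure :: 'a measure))"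
    by simp
  also have "\<dots> = ennreal (real DIM('a)) * emeasure lborel (ball (0::'a) 1)"
    by (subst nn_integral_surface_measure) auto
  also have "\<dots> < \<infinity>" using emeasure_lborel_ball_finite[of "0::'a" 1] by (simp add: ennreal_mult_less_top)
  finally show "emeasure (surface_measure :: 'a measure) (space surface_measure) \<noteq> \<infinity>" by simp
qed

abbreviation sphere_integral :: "('a::euclidean_space \<Rightarrow> real) \<Rightarrow> real \<Rightarrow> ennreal" where
  "sphere_integral w r \<equiv> (\<integral>\<^sup>+\<omega>. ennreal (w (r *\<^sub>R \<omega>)) \<partial>surface_measure)"

lemma sphere_integral_slow:
  fixes w :: "'a::euclidean_space \<Rightarrow> real"
  assumes [measurable]: "w \<in> borel_measurable borel" and K: "0 \<le> K"
    and slow: "\<And>x y. norm (x - y) \<le> 1 \<Longrightarrow> w y \<le> K * w x" and kr: "\<bar>r - k\<bar> \<le> 1"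
  shows "sphere_integral w k \<le> ennreal K * sphere_integral w r"
proof -
  have "sphere_integral w k \<le> (\<integral>\<^sup>+\<omega>. ennreal K * ennreal (w (r *\<^sub>R \<omega>)) \<partial>surface_measure)"
  proof (rule nn_integral_mono_AE, use AE_surface_measure_sphere in eventually_elim)
    fix \<omega> :: 'a assume "norm \<omega> = 1"
    then have "norm (r *\<^sub>R \<omega> - k *\<^sub>R \<omega>) \<le> 1" using kr by (simp add: scaleR_diff_left[symmetric])
    from slow[OF this] show "ennreal (w (k *\<^sub>R \<omega>)) \<le> ennreal K * ennreal (w (r *\<^sub>R \<omega>))"
      using K by (simp add: ennreal_mult'[symmetric] ennreal_leI)
  qed
  then show ?thesis by (simp add: nn_integral_cmult)
qed

text \<open>Averaging \<open>sphere_integral_slow\<close> over \<open>r \<in> {k..k + 1}\<close> replaces the sphere by a shell,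
  whose mass is at most the total mass. This makes the bound uniform in \<open>k\<close>.\<close>

lemma sphere_integral_upper:
  fixes w :: "'a::euclidean_space \<Rightarrow> real"
  assumes [measurable]: "w \<in> borel_measurable borel" and w: "\<And>x. 0 \<le> w x" and K: "0 \<le> K"
    and slow: "\<And>x y. norm (x - y) \<le> 1 \<Longrightarrow> w y \<le> K * w x" and k: "0 < k"
  shows "ennreal (k ^ (DIM('a) - 1)) * sphere_integral w k
      \<le> ennreal K * (\<integral>\<^sup>+x. ennreal (w x) \<partial>lborel)"
proof -
  let ?S = "sphere_integral w"
  let ?p = "\<lambda>r. ennreal (r ^ (DIM('a) - 1))"
  have 1: "?S k \<le> ennreal K * ?S r" if r: "r \<in> {k..k + 1}" for r
    by (rule sphere_integral_slow[OF assms(1) K slow]) (use r in auto)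
  have Ik: "(\<integral>\<^sup>+r. indicator {k..k + 1} r \<partial>lborel) = (1 :: ennreal)" using k by (subst nn_integral_indicator) auto
  have "?p k * ?S k = (\<integral>\<^sup>+r. ?p k * ?S k * indicator {k..k + 1} r \<partial>lborel)"
    by (subst nn_integral_cmult) (simp_all add: Ik)
  also have "\<dots> \<le> (\<integral>\<^sup>+r. ennreal K * (?p r * indicator {0<..} r * ?S r) \<partial>lborel)"
  proof (rule nn_integral_mono)
    fix r :: real
    show "?p k * ?S k * indicator {k..k + 1} r \<le> ennreal K * (?p r * indicator {0<..} r * ?S r)"
    proof (cases "r \<in> {k..k + 1}")
      case True
      have "?p k * ?S k \<le> ?p r * (ennreal K * ?S r)"
        using True k by (intro mult_mono 1 ennreal_leI power_mono) auto
      then show ?thesis using True k by (simp add: mult_ac)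
    qed simp
  qed
  also have "\<dots> = ennreal K * (\<integral>\<^sup>+x. ennreal (w x) \<partial>lborel)"
  proof -
    interpret surf: finite_measure "surface_measure :: 'a measure" by (rule finite_surface_measure)
    have [measurable]: "sphere_integral w \<in> borel_measurable borel" by (rule surf.borel_measurable_nn_integral) measurable
    show ?thesis
      by (subst nn_integral_polar[where f = "\<lambda>x. ennreal (w x)"], simp) (rule nn_integral_cmult, measurable)
  qed
  finally show ?thesis .
qed

text \<open>The comparison of neighbouring spheres in the other direction. On the shell, \<open>k \<ge> 1\<close>
  gives \<open>r \<le> 2 k\<close>, hence the power of 2.\<close>

lemma sphere_integral_lower:
  fixes w :: "'a::euclidean_space \<Rightarrow> real"
  assumes [measurable]: "w \<in> borel_measurable borel" and w: "\<And>x. 0 \<le> w x" and K: "0 \<le> K"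
    and slow: "\<And>x y. norm (x - y) \<le> 1 \<Longrightarrow> w y \<le> K * w x" and k: "1 \<le> k"
  shows "(\<integral>\<^sup>+x. ennreal (w x) * indicator {x. norm x \<in> {k..k + 1}} x \<partial>lborel)
     \<le> ennreal (2 ^ (DIM('a) - 1) * K) * (ennreal (k ^ (DIM('a) - 1)) * sphere_integral w k)"
proof -
  let ?S = "sphere_integral w"
  let ?p = "\<lambda>r. ennreal (r ^ (DIM('a) - 1))"
  have 1: "?S r \<le> ennreal K * ?S k" if r: "r \<in> {k..k + 1}" for r
    by (rule sphere_integral_slow[OF assms(1) K slow]) (use r in auto)
  have Ik: "(\<integral>\<^sup>+r. indicator {k..k + 1} r \<partial>lborel) = (1 :: ennreal)" using k by (subst nn_integral_indicator) auto
  have inner: "(\<integral>\<^sup>+\<omega>. ennreal (w (r *\<^sub>R \<omega>)) * indicator {x. norm x \<in> {k..k + 1}} (r *\<^sub>R \<omega>) \<partial>(surface_measure :: 'a measure))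
      = ?S r * indicator {k..k + 1} r" if "r > 0" for r
  proof -
    have "(\<integral>\<^sup>+\<omega>. ennreal (w (r *\<^sub>R \<omega>)) * indicator {x. norm x \<in> {k..k + 1}} (r *\<^sub>R \<omega>) \<partial>(surface_measure :: 'a measure))
      = (\<integral>\<^sup>+\<omega>. ennreal (w (r *\<^sub>R \<omega>)) * indicator {k..k + 1} r \<partial>(surface_measure :: 'a measure))"
      by (rule nn_integral_cong_AE, use AE_surface_measure_sphere in eventually_elim) (use that in \<open>auto simp: indicator_def\<close>)
    then show ?thesis by (simp add: nn_integral_multc)
  qed
  have "(\<integral>\<^sup>+x. ennreal (w x) * indicator {x. norm x \<in> {k..k + 1}} x \<partial>lborel)
     = (\<integral>\<^sup>+r. ?p r * indicator {0<..} r * (?S r * indicator {k..k + 1} r) \<partial>lborel)"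
  proof (subst nn_integral_polar)
    show "(\<lambda>x::'a. ennreal (w x) * indicator {x. norm x \<in> {k..k + 1}} x) \<in> borel_measurable borel" by measurable
    show "(\<integral>\<^sup>+r. ?p r * indicator {0<..} r * (\<integral>\<^sup>+\<omega>. ennreal (w (r *\<^sub>R \<omega>)) * indicator {x. norm x \<in> {k..k + 1}} (r *\<^sub>R \<omega>) \<partial>(surface_measure :: 'a measure)) \<partial>lborel)
      = (\<integral>\<^sup>+r. ?p r * indicator {0<..} r * (?S r * indicator {k..k + 1} r) \<partial>lborel)"
    proof (rule nn_integral_cong)
      fix r :: real
      show "?p r * indicator {0<..} r * (\<integral>\<^sup>+\<omega>. ennreal (w (r *\<^sub>R \<omega>)) * indicator {x. norm x \<in> {k..k + 1}} (r *\<^sub>R \<omega>) \<partial>(surface_measure :: 'a measure))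
        = ?p r * indicator {0<..} r * (?S r * indicator {k..k + 1} r)"
        by (cases "0 < r") (simp only: inner, simp)
    qed
  qed
  also have "\<dots> \<le> (\<integral>\<^sup>+r. ennreal (2 ^ (DIM('a) - 1) * K) * (?p k * ?S k) * indicator {k..k + 1} r \<partial>lborel)"
  proof (rule nn_integral_mono)
    fix r :: real
    show "?p r * indicator {0<..} r * (?S r * indicator {k..k + 1} r) \<le> ennreal (2 ^ (DIM('a) - 1) * K) * (?p k * ?S k) * indicator {k..k + 1} r"
    proof (cases "r \<in> {k..k + 1}")
      case True
      have "r ^ (DIM('a) - 1) \<le> (2 * k) ^ (DIM('a) - 1)" using True k by (intro power_mono) auto
      then have "?p r \<le> ennreal (2 ^ (DIM('a) - 1)) * ?p k"
        using k by (simp add: ennreal_mult'[symmetric] ennreal_leI power_mult_distrib)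
      then have "?p r * ?S r \<le> (ennreal (2 ^ (DIM('a) - 1)) * ?p k) * (ennreal K * ?S k)"
        by (intro mult_mono 1 True) auto
      then show ?thesis using True k K by (simp add: mult_ac ennreal_mult')
    qed simp
  qed
  also have "\<dots> = ennreal (2 ^ (DIM('a) - 1) * K) * (?p k * ?S k)"
    by (subst nn_integral_cmult) (simp_all add: Ik)
  finally show ?thesis .
qed

text \<open>Polar coordinates as an identity between measures, so that complex-valued radial
  factors can be integrated without splitting them into positive parts.\<close>

lemma radial_pushforward:
  fixes \<Phi> :: "'a::euclidean_space \<Rightarrow> real"
  assumes [measurable]: "\<Phi> \<in> borel_measurable borel" and Phi: "\<And>x. 0 \<le> \<Phi> x"
    and S: "(\<integral>\<^sup>+\<omega>. ennreal (\<Phi> \<omega>) \<partial>surface_measure) = ennreal S" "0 \<le> S"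
  shows "distr (density lborel (\<lambda>x. ennreal (\<Phi> (sgn x)))) borel norm
     = density lborel (\<lambda>r. ennreal (S * (r ^ (DIM('a) - 1) * indicator {0<..} r)))"
proof (rule measure_eqI)
  fix A :: "real set"
  assume "A \<in> sets (distr (density lborel (\<lambda>x. ennreal (\<Phi> (sgn x)))) borel (norm :: 'a \<Rightarrow> real))"
  then have [measurable]: "A \<in> sets borel" by simp
  then have [measurable]: "(norm :: 'a \<Rightarrow> real) -` A \<in> sets borel"
    using measurable_sets_borel[of "norm :: 'a \<Rightarrow> real" borel A] by simp
  have inner: "(\<integral>\<^sup>+\<omega>. ennreal (\<Phi> (sgn (r *\<^sub>R \<omega>))) * indicator A (norm (r *\<^sub>R \<omega>)) \<partial>(surface_measure :: 'a measure))
      = ennreal S * indicator A r" if "r > 0" for r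
  proof -
    have "(\<integral>\<^sup>+\<omega>. ennreal (\<Phi> (sgn (r *\<^sub>R \<omega>))) * indicator A (norm (r *\<^sub>R \<omega>)) \<partial>(surface_measure :: 'a measure))
       = (\<integral>\<^sup>+\<omega>. ennreal (\<Phi> \<omega>) * indicator A r \<partial>(surface_measure :: 'a measure))"
      by (rule nn_integral_cong_AE, use AE_surface_measure_sphere in eventually_elim)
         (use that in \<open>simp add: sgn_scaleR sgn_div_norm\<close>)
    then show ?thesis by (simp add: nn_integral_multc S)
  qed
  have "emeasure (distr (density lborel (\<lambda>x. ennreal (\<Phi> (sgn x)))) borel (norm :: 'a \<Rightarrow> real)) A
     = (\<integral>\<^sup>+x. ennreal (\<Phi> (sgn x)) * indicator A (norm (x::'a)) \<partial>lborel)"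
    by (subst emeasure_distr, simp, simp, subst emeasure_density) (auto intro!: nn_integral_cong split: split_indicator)
  also have "\<dots> = (\<integral>\<^sup>+r. ennreal (r ^ (DIM('a) - 1)) * indicator {0<..} r * (ennreal S * indicator A r) \<partial>lborel)"
  proof (subst nn_integral_polar)
    show "(\<lambda>x::'a. ennreal (\<Phi> (sgn x)) * indicator A (norm x)) \<in> borel_measurable borel" by measurable
    show "(\<integral>\<^sup>+r. ennreal (r ^ (DIM('a) - 1)) * indicator {0<..} r * (\<integral>\<^sup>+\<omega>. ennreal (\<Phi> (sgn (r *\<^sub>R \<omega>))) * indicator A (norm (r *\<^sub>R \<omega>)) \<partial>(surface_measure :: 'a measure)) \<partial>lborel)
      = (\<integral>\<^sup>+r. ennreal (r ^ (DIM('a) - 1)) * indicator {0<..} r * (ennreal S * indicator A r) \<partial>lborel)"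
    proof (rule nn_integral_cong)
      fix r :: real
      show "ennreal (r ^ (DIM('a) - 1)) * indicator {0<..} r * (\<integral>\<^sup>+\<omega>. ennreal (\<Phi> (sgn (r *\<^sub>R \<omega>))) * indicator A (norm (r *\<^sub>R \<omega>)) \<partial>(surface_measure :: 'a measure))
        = ennreal (r ^ (DIM('a) - 1)) * indicator {0<..} r * (ennreal S * indicator A r)"
        by (cases "0 < r") (simp only: inner, simp)
    qed
  qed
  also have "\<dots> = emeasure (density lborel (\<lambda>r. ennreal (S * (r ^ (DIM('a) - 1) * indicator {0<..} r)))) A"
    using S(2) by (subst emeasure_density)
      (auto intro!: nn_integral_cong simp: ennreal_mult' mult_ac split: split_indicator)
  finally show "emeasure (distr (density lborel (\<lambda>x. ennreal (\<Phi> (sgn x)))) borel (norm :: 'a \<Rightarrow> real)) A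
     = emeasure (density lborel (\<lambda>r. ennreal (S * (r ^ (DIM('a) - 1) * indicator {0<..} r)))) A" .
qed simp

lemma integral_radial_times_angular:
  fixes \<Phi> :: "'a::euclidean_space \<Rightarrow> real" and f :: "real \<Rightarrow> complex"
  assumes [measurable]: "\<Phi> \<in> borel_measurable borel" "f \<in> borel_measurable borel" and Phi: "\<And>x. 0 \<le> \<Phi> x"
    and S: "(\<integral>\<^sup>+\<omega>. ennreal (\<Phi> \<omega>) \<partial>surface_measure) = ennreal S" "0 \<le> S"
  shows "(LINT x|lborel. \<Phi> (sgn x) *\<^sub>R f (norm x)) = S *\<^sub>R (LINT r|lborel. (r ^ (DIM('a) - 1) * indicator {0<..} r) *\<^sub>R f r)"
proof -
  have "(LINT x|lborel. \<Phi> (sgn x) *\<^sub>R f (norm x)) = (LINT x|density lborel (\<lambda>x. ennreal (\<Phi> (sgn x))). f (norm x))"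
    using Phi by (subst integral_density) auto
  also have "\<dots> = (LINT r|distr (density lborel (\<lambda>x. ennreal (\<Phi> (sgn x)))) borel (norm :: 'a \<Rightarrow> real). f r)"
    by (subst integral_distr) auto
  also have "\<dots> = (LINT r|density lborel (\<lambda>r. ennreal (S * (r ^ (DIM('a) - 1) * indicator {0<..} r))). f r)"
    by (subst radial_pushforward[OF assms(1) Phi S]) simp
  also have "\<dots> = (LINT r|lborel. (S * (r ^ (DIM('a) - 1) * indicator {0<..} r)) *\<^sub>R f r)"
    using S(2) by (subst integral_density) (auto split: split_indicator)
  also have "\<dots> = S *\<^sub>R (LINT r|lborel. (r ^ (DIM('a) - 1) * indicator {0<..} r) *\<^sub>R f r)"
    by (subst integral_scaleR_right[symmetric]) simp
  finally show ?thesis .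
qed

text \<open>The value of the integral of \<open>r / (k\<^sup>2 - r\<^sup>2 + i\<epsilon>)\<close> over the window \<open>{k - \<delta>..k + \<delta>}\<close>.\<close>

abbreviation window_log :: "real \<Rightarrow> real \<Rightarrow> real \<Rightarrow> complex" where
  "window_log k \<delta> \<epsilon> \<equiv> (Ln (of_real \<epsilon> - \<i> * of_real (k\<^sup>2 - (k - \<delta>)\<^sup>2)) - Ln (of_real \<epsilon> - \<i> * of_real (k\<^sup>2 - (k + \<delta>)\<^sup>2))) / 2"

text \<open>A primitive is \<open>- Ln (\<epsilon> - i (k\<^sup>2 - r\<^sup>2)) / 2\<close>. The factor \<open>-i\<close> turns \<open>k\<^sup>2 - r\<^sup>2 + i\<epsilon>\<close> into a
  number with positive real part, so that the branch cut is avoided.\<close>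

lemma resolvent_window_integral:
  fixes k \<delta> \<epsilon> :: real
  assumes "0 < k" "0 < \<delta>" "\<delta> \<le> k / 2" "0 < \<epsilon>"
  shows "integrable lborel (\<lambda>r. indicator {k - \<delta>..k + \<delta>} r *\<^sub>R (of_real r / (of_real (k\<^sup>2 - r\<^sup>2) + \<i> * of_real \<epsilon>)))"
    and "(LINT r|lborel. indicator {k - \<delta>..k + \<delta>} r *\<^sub>R (of_real r / (of_real (k\<^sup>2 - r\<^sup>2) + \<i> * of_real \<epsilon>)))
    = window_log k \<delta> \<epsilon>"
proof -
  let ?F = "\<lambda>r. - Ln (of_real \<epsilon> - \<i> * of_real (k\<^sup>2 - r\<^sup>2)) / 2"
  have nz: "of_real (k\<^sup>2 - r\<^sup>2) + \<i> * complex_of_real \<epsilon> \<noteq> 0" for r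
    using assms(4) by (auto simp: complex_eq_iff)
  have cont: "continuous_on {k - \<delta>..k + \<delta>} (\<lambda>r. of_real r / (of_real (k\<^sup>2 - r\<^sup>2) + \<i> * complex_of_real \<epsilon>))"
    using nz by (intro continuous_intros) auto
  show "integrable lborel (\<lambda>r. indicator {k - \<delta>..k + \<delta>} r *\<^sub>R (of_real r / (of_real (k\<^sup>2 - r\<^sup>2) + \<i> * of_real \<epsilon>)))"
    by (rule borel_integrable_compact) (use cont in auto)
  have "(LINT r|lborel. indicator {k - \<delta>..k + \<delta>} r *\<^sub>R (of_real r / (of_real (k\<^sup>2 - r\<^sup>2) + \<i> * of_real \<epsilon>)))
     = ?F (k + \<delta>) - ?F (k - \<delta>)"
  proof (rule integral_FTC_atLeastAtMost)
    fix r :: real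
    have nonpos: "of_real \<epsilon> - \<i> * of_real (k\<^sup>2 - r\<^sup>2) \<notin> \<real>\<^sub>\<le>\<^sub>0"
      using assms(4) by (auto simp: complex_nonpos_Reals_iff)
    have inner: "((\<lambda>r. of_real \<epsilon> - \<i> * complex_of_real (k\<^sup>2 - r\<^sup>2)) has_vector_derivative (\<i> * of_real (2 * r))) (at r within {k - \<delta>..k + \<delta>})"
    proof -
      have "((\<lambda>r. - (k\<^sup>2 - r\<^sup>2)) has_real_derivative 2 * r) (at r within {k - \<delta>..k + \<delta>})"
        by (auto intro!: derivative_eq_intros)
      from has_vector_derivative_add_const[THEN iffD2, OF has_vector_derivative_mult_right[OF has_vector_derivative_of_real[OF this], of \<i>], of "of_real \<epsilon>"]
      show ?thesis by (simp add: algebra_simps)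
    qed
    have "((\<lambda>z. - Ln z / 2) has_field_derivative - inverse (of_real \<epsilon> - \<i> * complex_of_real (k\<^sup>2 - r\<^sup>2)) / 2)
       (at (of_real \<epsilon> - \<i> * complex_of_real (k\<^sup>2 - r\<^sup>2)) within (\<lambda>r. of_real \<epsilon> - \<i> * complex_of_real (k\<^sup>2 - r\<^sup>2)) ` {k - \<delta>..k + \<delta>})"
      using nonpos by (auto intro!: derivative_eq_intros)
    from field_vector_diff_chain_within[OF inner this]
    have "(?F has_vector_derivative (\<i> * of_real (2 * r)) * (- inverse (of_real \<epsilon> - \<i> * complex_of_real (k\<^sup>2 - r\<^sup>2)) / 2)) (at r within {k - \<delta>..k + \<delta>})"
      by (simp add: o_def)
    moreover have "(\<i> * of_real (2 * r)) * (- inverse (of_real \<epsilon> - \<i> * complex_of_real (k\<^sup>2 - r\<^sup>2)) / 2)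
       = of_real r / (of_real (k\<^sup>2 - r\<^sup>2) + \<i> * of_real \<epsilon>)"
    proof -
      have "of_real \<epsilon> - \<i> * complex_of_real (k\<^sup>2 - r\<^sup>2) = - \<i> * (of_real (k\<^sup>2 - r\<^sup>2) + \<i> * of_real \<epsilon>)"
        by (simp add: algebra_simps)
      moreover have "(\<i> * of_real (2 * r)) * (- inverse (- \<i> * d) / 2) = of_real r / d" if "d \<noteq> 0" for d :: complex
        using that by (simp add: field_simps)
      ultimately show ?thesis using nz[of r] by simp
    qed
    ultimately show "(?F has_vector_derivative of_real r / (of_real (k\<^sup>2 - r\<^sup>2) + \<i> * of_real \<epsilon>)) (at r within {k - \<delta>..k + \<delta>})"
      by simp
  qed (use assms cont in auto)
  then show "(LINT r|lborel. indicator {k - \<delta>..k + \<delta>} r *\<^sub>R (of_real r / (of_real (k\<^sup>2 - r\<^sup>2) + \<i> * of_real \<epsilon>)))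
    = window_log k \<delta> \<epsilon>"
    by (simp add: diff_divide_distrib)
qed

text \<open>In the limit the arguments of the two logarithms lie on opposite halves of the
  imaginary axis; the jump of their imaginary parts is the contribution of the delta
  function on the sphere of radius \<open>k\<close>. The real part is bounded because the moduli of the
  arguments have ratio at most \<open>5/3\<close>.\<close>

lemma resolvent_window_limit:
  fixes k \<delta> :: real
  assumes k: "0 < k" "0 < \<delta>" "\<delta> \<le> k / 2"
  shows "\<exists>c. \<bar>c\<bar> \<le> 1 \<and>
    ((\<lambda>\<epsilon>. window_log k \<delta> \<epsilon>)
      \<longlongrightarrow> of_real c - \<i> * of_real (pi / 2)) (at_right 0)"
proof -
  define u v where "u = k\<^sup>2 - (k - \<delta>)\<^sup>2" and "v = (k + \<delta>)\<^sup>2 - k\<^sup>2"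
  have uv_eq: "u = \<delta> * (2 * k - \<delta>)" "v = \<delta> * (2 * k + \<delta>)" by (auto simp: u_def v_def power2_eq_square algebra_simps)
  have uv: "0 < u" "0 < v" "u \<le> v" using k unfolding uv_eq by (auto intro!: mult_left_mono)
  have "3 * v \<le> 5 * u" using k unfolding uv_eq by (simp add: algebra_simps mult_left_mono)
  then have "v / u \<le> 5 / 3" using uv by (simp add: field_simps)
  moreover have "ln v - ln u \<le> v / u - 1" using ln_le_minus_one[of "v / u"] uv by (simp add: ln_div)
  ultimately have "ln v - ln u \<le> 2 / 3" by linarith
  moreover have "0 \<le> ln v - ln u" using uv by simp
  ultimately have c: "\<bar>(ln u - ln v) / 2\<bar> \<le> 1" by simp
  have np: "- (\<i> * complex_of_real u) \<notin> \<real>\<^sub>\<le>\<^sub>0" "\<i> * complex_of_real v \<notin> \<real>\<^sub>\<le>\<^sub>0"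
    using uv by (auto simp: complex_nonpos_Reals_iff)
  have Lu: "Ln (- (\<i> * complex_of_real u)) = of_real (ln u) - \<i> * of_real (pi / 2)"
    using Ln_times_of_real[of u "- \<i>"] uv Ln_minus_ii by (simp add: mult.commute Ln_of_real)
  have Lv: "Ln (\<i> * complex_of_real v) = of_real (ln v) + \<i> * of_real (pi / 2)"
    using Ln_times_of_real[of v "\<i>"] uv Ln_ii by (simp add: mult.commute Ln_of_real)
  have "((\<lambda>\<epsilon>. (Ln (of_real \<epsilon> - \<i> * of_real u) - Ln (of_real \<epsilon> + \<i> * of_real v)) / 2)
      \<longlongrightarrow> (Ln (of_real 0 - \<i> * of_real u) - Ln (of_real 0 + \<i> * of_real v)) / 2) (at_right 0)"
    using np by (intro tendsto_intros) auto
  moreover have "(Ln (of_real 0 - \<i> * of_real u) - Ln (of_real 0 + \<i> * of_real v)) / 2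
     = of_real ((ln u - ln v) / 2) - \<i> * of_real (pi / 2)"
    by (simp add: Lu Lv)
  moreover have "of_real \<epsilon> - \<i> * complex_of_real (k\<^sup>2 - (k + \<delta>)\<^sup>2) = of_real \<epsilon> + \<i> * of_real v" for \<epsilon>
    by (simp add: v_def algebra_simps)
  ultimately have "((\<lambda>\<epsilon>. (Ln (of_real \<epsilon> - \<i> * of_real u) - Ln (of_real \<epsilon> - \<i> * of_real (k\<^sup>2 - (k + \<delta>)\<^sup>2))) / 2)
      \<longlongrightarrow> of_real ((ln u - ln v) / 2) - \<i> * of_real (pi / 2)) (at_right 0)"
    by (simp only:)
  then show ?thesis using c unfolding u_def[symmetric] by blast
qed

section \<open>The limiting absorption principle\<close>

lemma one_minus_power_le: "\<bar>1 - x ^ m\<bar> \<le> real m * 2 ^ m * \<bar>1 - x\<bar>" if x: "0 \<le> x" "x \<le> 2" for x :: real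
proof (induction m)
  case (Suc m)
  have "1 - x ^ Suc m = (1 - x ^ m) + x ^ m * (1 - x)" by (simp add: algebra_simps)
  then have "\<bar>1 - x ^ Suc m\<bar> \<le> \<bar>1 - x ^ m\<bar> + \<bar>x ^ m * (1 - x)\<bar>" by (metis abs_triangle_ineq)
  also have "\<bar>x ^ m * (1 - x)\<bar> \<le> 2 ^ m * \<bar>1 - x\<bar>"
    using x by (auto simp: abs_mult intro!: mult_right_mono power_mono)
  also have "\<bar>1 - x ^ m\<bar> + 2 ^ m * \<bar>1 - x\<bar> \<le> real (Suc m) * 2 ^ m * \<bar>1 - x\<bar>"
    using Suc by (simp add: algebra_simps)
  also have "\<dots> \<le> real (Suc m) * 2 ^ Suc m * \<bar>1 - x\<bar>"
    by (intro mult_right_mono mult_left_mono) auto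
  finally show ?case by simp
qed simp

lemma norm_resolvent_denominator: "\<bar>u\<bar> \<le> norm (complex_of_real u + \<i> * of_real \<epsilon>)"
  using abs_Re_le_cmod[of "complex_of_real u + \<i> * of_real \<epsilon>"] by simp

definition damped_resolvent :: "('a::euclidean_space \<Rightarrow> real) \<Rightarrow> real \<Rightarrow> real \<Rightarrow> complex" where
  "damped_resolvent F k \<epsilon> =
     (LINT \<zeta>|lborel. of_real (F \<zeta>) / (of_real (- (norm \<zeta>)\<^sup>2 + k\<^sup>2) + \<i> * of_real \<epsilon>))"

text \<open>Near the singular sphere \<open>F \<zeta>\<close> is compared with its value at \<open>k sgn \<zeta>\<close>, multiplied by
  \<open>(k/|\<zeta>|)\<^sup>n\<^sup>-\<^sup>2\<close>. By the Lipschitz bound the difference, divided by \<open>k\<^sup>2 - |\<zeta>|\<^sup>2\<close>, is at most a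
  multiple of \<open>w \<zeta> / |\<zeta>|\<close>, so its contribution converges to a real number by dominated
  convergence. The comparison term factorises in polar coordinates, and the power \<open>n - 2\<close> is
  the one for which \<open>r\<^sup>n\<^sup>-\<^sup>1 (k/r)\<^sup>n\<^sup>-\<^sup>2\<close> is linear in \<open>r\<close>, so that the radial integral is
  elementary. The window has half-width \<open>min 1 k / 2\<close>: at most 1 because \<open>w\<close> varies slowly only
  at unit scale, and at most \<open>k / 2\<close> to stay away from the origin. Its inverse is the source
  of the factor \<open>1 + 1/k\<close>.\<close>

theorem limiting_absorption:
  fixes F w :: "'a::euclidean_space \<Rightarrow> real"
  assumes n: "2 \<le> DIM('a)"
    and [measurable]: "F \<in> borel_measurable borel" "w \<in> borel_measurable borel"
    and Fw: "\<And>x. 0 \<le> F x" "\<And>x. F x \<le> w x"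
    and lip: "\<And>x y. norm (x - y) \<le> 1 \<Longrightarrow> \<bar>F x - F y\<bar> \<le> norm (x - y) * w x"
    and K: "1 \<le> K" and slow: "\<And>x y. norm (x - y) \<le> 1 \<Longrightarrow> w y \<le> K * w x"
    and int: "integrable lborel w" "(LINT x|lborel. w x) \<le> I"
    and intn: "integrable lborel (\<lambda>x. w x / norm x)" "(LINT x|lborel. w x / norm x) \<le> I"
    and k: "0 < k"
  shows "\<exists>S\<ge>0. sphere_integral F k = ennreal S \<and>
     (\<exists>L. (damped_resolvent F k \<longlongrightarrow> L) (at_right 0) \<and>
      Im L = - (pi / 2) * (S * k ^ (DIM('a) - 2)) \<and>
      norm L \<le> ((2 + 2 * K * (real (DIM('a) - 2) * 2 ^ (DIM('a) - 2))) + 3 * K) * I * (1 + 1 / k))"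
proof -
  define m where "m = DIM('a) - 2"
  have m: "DIM('a) - 1 = Suc m" using n by (simp add: m_def)
  define M where "M = real m * 2 ^ m"
  have M: "0 \<le> M" by (simp add: M_def)
  define \<delta> where "\<delta> = min 1 k / 2"
  have \<delta>: "0 < \<delta>" "\<delta> \<le> k / 2" "\<delta> \<le> 1 / 2" using k by (auto simp: \<delta>_def)
  have w0: "0 \<le> w x" for x using Fw[of x] by linarith
  define B where "B = (2 + 2 * K * M) * (1 + 1 / k)"
  have B: "0 \<le> B" using K M k by (auto simp: B_def)
  have "0 \<le> (LINT x|lborel. w x)" by (rule Bochner_Integration.integral_nonneg) (use w0 in auto)
  then have I0: "0 \<le> I" using int(2) by linarith
  \<comment> \<open>The integral over the sphere is finite and at most a multiple of \<open>1/k\<close> after normalisation.\<close>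
  have up: "ennreal (k ^ Suc m) * sphere_integral F k \<le> ennreal (K * I)"
  proof -
    have "ennreal (k ^ Suc m) * sphere_integral F k
       \<le> ennreal (k ^ (DIM('a) - 1)) * sphere_integral w k"
      unfolding m by (intro mult_left_mono nn_integral_mono ennreal_leI Fw) auto
    also have "\<dots> \<le> ennreal K * (\<integral>\<^sup>+x. ennreal (w x) \<partial>lborel)"
      by (rule sphere_integral_upper) (use w0 K slow k in auto)
    also have "(\<integral>\<^sup>+x. ennreal (w x) \<partial>lborel) = ennreal (LINT x|lborel. w x)"
      by (rule nn_integral_eq_integral[OF int(1)]) (use w0 in auto)
    also have "ennreal K * ennreal (LINT x|lborel. w x) \<le> ennreal (K * I)"
      using K int(2) by (simp add: ennreal_mult'[symmetric] ennreal_leI)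
    finally show ?thesis .
  qed
  define T where "T = sphere_integral F k"
  have "T \<noteq> top"
  proof
    assume "T = top"
    then have "ennreal (k ^ Suc m) * T = top" using k by (simp add: ennreal_mult_top)
    then show False using up unfolding T_def[symmetric] by (simp add: top_unique)
  qed
  then obtain S where S: "T = ennreal S" "0 \<le> S" by (cases T) auto
  have "k ^ Suc m * S \<le> K * I"
    using up k S K I0 unfolding T_def[symmetric] S(1) by (simp add: ennreal_mult'[symmetric])
  then have Sk: "S * k ^ m \<le> K * I / k" using k by (simp add: field_simps)
  \<comment> \<open>\<open>G\<close> is what remains of \<open>F\<close> after subtracting the comparison term \<open>H\<close> on the window.\<close>
  define H where "H \<zeta> = F (k *\<^sub>R sgn \<zeta>) * (indicator {k - \<delta>..k + \<delta>} (norm \<zeta>) * (k / norm \<zeta>) ^ m)" for \<zeta> :: 'a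
  define G where "G \<zeta> = F \<zeta> - H \<zeta>" for \<zeta>
  define u where "u \<zeta> = - (norm \<zeta>)\<^sup>2 + k\<^sup>2" for \<zeta> :: 'a
  have [measurable]: "G \<in> borel_measurable borel" "H \<in> borel_measurable borel" "u \<in> borel_measurable borel"
    unfolding G_def H_def u_def by measurable
  have u_eq: "\<bar>u \<zeta>\<bar> = \<bar>norm \<zeta> - k\<bar> * (norm \<zeta> + k)" for \<zeta>
  proof -
    have "u \<zeta> = - ((norm \<zeta> - k) * (norm \<zeta> + k))" by (simp add: u_def power2_eq_square algebra_simps)
    then show ?thesis using k by (simp add: abs_mult add_nonneg_nonneg)
  qed
  have boundG: "\<bar>G \<zeta>\<bar> \<le> B * (w \<zeta> / norm \<zeta>) * \<bar>u \<zeta>\<bar>" if z: "\<zeta> \<noteq> 0" for \<zeta> :: 'a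
  proof -
    define r where "r = norm \<zeta>"
    have r: "0 < r" using z by (simp add: r_def)
    show ?thesis
    proof (cases "r \<in> {k - \<delta>..k + \<delta>}")
      case True
      define y where "y = k *\<^sub>R sgn \<zeta>"
      have rk: "k / 2 \<le> r" "\<bar>r - k\<bar> \<le> 1" using True \<delta> by auto
      have "\<zeta> - y = (r - k) *\<^sub>R sgn \<zeta>" 
      proof -
        have "\<zeta> = r *\<^sub>R sgn \<zeta>" using r by (simp add: r_def sgn_div_norm)
        then show ?thesis unfolding y_def by (simp only: scaleR_diff_left) 
      qed
      then have zy: "norm (\<zeta> - y) = \<bar>r - k\<bar>" using z by (simp add: norm_sgn)
      have x: "0 \<le> k / r" "k / r \<le> 2" using rk r k by (auto simp: field_simps)
      have 1: "\<bar>F \<zeta> - F y\<bar> \<le> \<bar>r - k\<bar> * w \<zeta>" using lip[of \<zeta> y] zy rk by simp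
      have "\<bar>1 - k / r\<bar> = \<bar>r - k\<bar> / r" 
      proof -
        have "1 - k / r = (r - k) / r" using r by (simp add: diff_divide_distrib)
        then show ?thesis using r by simp
      qed
      also have "\<dots> \<le> \<bar>r - k\<bar> / (k / 2)" using rk k by (intro divide_left_mono) auto
      finally have x1: "M * \<bar>1 - k / r\<bar> \<le> M * (2 * \<bar>r - k\<bar> / k)"
        using M by (intro mult_left_mono) (auto simp: mult.commute)
      have 2: "\<bar>1 - (k / r) ^ m\<bar> \<le> M * (2 * \<bar>r - k\<bar> / k)"
        using one_minus_power_le[OF x, of m] x1 unfolding M_def by linarith
      have 3: "F y \<le> K * w \<zeta>" using Fw(2)[of y] slow[of \<zeta> y] zy rk by simp
      have "G \<zeta> = (F \<zeta> - F y) + F y * (1 - (k / r) ^ m)"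
        using True by (simp add: G_def H_def y_def r_def algebra_simps)
      then have "\<bar>G \<zeta>\<bar> \<le> \<bar>F \<zeta> - F y\<bar> + F y * \<bar>1 - (k / r) ^ m\<bar>"
        using Fw(1)[of y] by (metis abs_mult abs_of_nonneg abs_triangle_ineq)
      also have "\<dots> \<le> \<bar>r - k\<bar> * w \<zeta> + (K * w \<zeta>) * (M * (2 * \<bar>r - k\<bar> / k))"
        by (intro add_mono 1 mult_mono 3 2) (use K w0 in auto)
      also have "\<dots> = (1 + 2 * K * M * (1 / k)) * w \<zeta> * \<bar>r - k\<bar>" using k by (simp add: field_simps)
      also have "\<dots> \<le> B * w \<zeta> * \<bar>r - k\<bar>"
      proof -
        have "1 + 2 * K * M * (1 / k) \<le> B"
        proof -
          have "B = (1 + 2 * K * M * (1 / k)) + (1 + 2 * K * M + 2 * (1 / k))" by (simp add: B_def algebra_simps)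
          moreover have "0 \<le> 1 + 2 * K * M + 2 * (1 / k)" using K M k by (intro add_nonneg_nonneg mult_nonneg_nonneg) auto
          ultimately show ?thesis by linarith
        qed
        then show ?thesis using w0 by (intro mult_right_mono) auto
      qed
      also have "\<dots> \<le> B * w \<zeta> * \<bar>r - k\<bar> * ((r + k) / r)"
        using r k B w0[of \<zeta>] mult_left_mono[of 1 "(r + k) / r" "B * w \<zeta> * \<bar>r - k\<bar>"] by simp
      also have "\<dots> = B * (w \<zeta> / norm \<zeta>) * \<bar>u \<zeta>\<bar>" unfolding u_eq r_def by simp
      finally show ?thesis .
    next
      case False
      then have "\<delta> \<le> \<bar>r - k\<bar>" by auto
      have "1 / \<delta> \<le> 2 * (1 + 1 / k)" using k by (auto simp: \<delta>_def min_def field_simps)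
      also have "\<dots> \<le> B" using K M k unfolding B_def by (intro mult_right_mono) auto
      finally have "1 \<le> B * \<delta>" using \<delta>(1) by (simp add: field_simps)
      also have "\<dots> \<le> B * (\<bar>r - k\<bar> * ((r + k) / r))"
      proof (intro mult_left_mono B)
        have "\<delta> * 1 \<le> \<bar>r - k\<bar> * ((r + k) / r)"
          using \<open>\<delta> \<le> \<bar>r - k\<bar>\<close> r k \<delta>(1) by (intro mult_mono) auto
        then show "\<delta> \<le> \<bar>r - k\<bar> * ((r + k) / r)" by simp
      qed
      finally have "w \<zeta> * 1 \<le> w \<zeta> * (B * (\<bar>r - k\<bar> * ((r + k) / r)))" by (intro mult_left_mono w0)
      moreover have "\<bar>G \<zeta>\<bar> \<le> w \<zeta>" using False Fw[of \<zeta>] by (simp add: G_def H_def r_def)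
      ultimately show ?thesis unfolding u_eq r_def by (simp add: mult_ac)
    qed
  qed
  have AEz: "AE \<zeta> in (lborel :: 'a measure). \<zeta> \<noteq> 0" by (rule AE_lborel_singleton)
  let ?d = "\<lambda>\<epsilon> \<zeta>. complex_of_real (u \<zeta>) + \<i> * of_real \<epsilon>"
  have dnz: "?d \<epsilon> \<zeta> \<noteq> 0" if "0 < \<epsilon>" for \<epsilon> \<zeta> using that by (auto simp: complex_eq_iff)
  have Gd: "norm (of_real (G \<zeta>) / ?d \<epsilon> \<zeta>) \<le> B * (w \<zeta> / norm \<zeta>)" if "0 < \<epsilon>" "\<zeta> \<noteq> 0" for \<epsilon> \<zeta>
  proof -
    have "\<bar>G \<zeta>\<bar> \<le> B * (w \<zeta> / norm \<zeta>) * norm (?d \<epsilon> \<zeta>)"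
      by (rule order_trans[OF boundG[OF that(2)]])
         (intro mult_left_mono norm_resolvent_denominator mult_nonneg_nonneg B divide_nonneg_nonneg w0 norm_ge_zero)
    then show ?thesis using dnz[OF that(1), of \<zeta>] by (simp add: norm_divide divide_le_eq)
  qed
  have Bint: "integrable lborel (\<lambda>\<zeta>. B * (w \<zeta> / norm \<zeta>))" using intn(1) by (rule integrable_mult_right)
  have Gint: "integrable lborel (\<lambda>\<zeta>. of_real (G \<zeta>) / ?d \<epsilon> \<zeta>)" if "0 < \<epsilon>" for \<epsilon>
  proof (rule Bochner_Integration.integrable_bound[OF Bint])
    show "AE \<zeta> in lborel. norm (of_real (G \<zeta>) / ?d \<epsilon> \<zeta>) \<le> norm (B * (w \<zeta> / norm \<zeta>))"
      using AEz by eventually_elim (rule order_trans[OF Gd[OF that]], assumption, simp only: real_norm_def abs_ge_self)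
  qed measurable
  have Fint: "integrable lborel (\<lambda>\<zeta>. of_real (F \<zeta>) / ?d \<epsilon> \<zeta>)" if e: "0 < \<epsilon>" for \<epsilon>
  proof (rule Bochner_Integration.integrable_bound)
    show "integrable lborel (\<lambda>\<zeta>. (1 / \<epsilon>) * w \<zeta>)" using int(1) by (rule integrable_mult_right)
    show "AE \<zeta> in lborel. norm (of_real (F \<zeta>) / ?d \<epsilon> \<zeta>) \<le> norm ((1 / \<epsilon>) * w \<zeta>)"
    proof (rule AE_I2)
      fix \<zeta>
      have "\<epsilon> \<le> norm (?d \<epsilon> \<zeta>)" using abs_Im_le_cmod[of "?d \<epsilon> \<zeta>"] by simp
      then have "F \<zeta> / norm (?d \<epsilon> \<zeta>) \<le> w \<zeta> / \<epsilon>" using Fw[of \<zeta>] e by (intro frac_le) auto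
      then show "norm (of_real (F \<zeta>) / ?d \<epsilon> \<zeta>) \<le> norm ((1 / \<epsilon>) * w \<zeta>)"
        using Fw(1)[of \<zeta>] w0[of \<zeta>] e by (simp add: norm_divide)
    qed
  qed measurable
  \<comment> \<open>The comparison term is a function of the direction times a function of the radius.\<close>
  have Hval: "(LINT \<zeta>|lborel. of_real (H \<zeta>) / ?d \<epsilon> \<zeta>)
      = of_real (S * k ^ m) * window_log k \<delta> \<epsilon>"
    if e: "0 < \<epsilon>" for \<epsilon>
  proof -
    define f where "f r = indicator {k - \<delta>..k + \<delta>} r *\<^sub>R (complex_of_real ((k / r) ^ m) / (of_real (k\<^sup>2 - r\<^sup>2) + \<i> * of_real \<epsilon>))" for r
    have [measurable]: "f \<in> borel_measurable borel" unfolding f_def by measurable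
    have "(LINT \<zeta>|lborel. of_real (H \<zeta>) / ?d \<epsilon> \<zeta>) = (LINT \<zeta>::'a|lborel. F (k *\<^sub>R sgn \<zeta>) *\<^sub>R f (norm \<zeta>))"
      by (rule Bochner_Integration.integral_cong) (auto simp: H_def f_def u_def scaleR_conv_of_real indicator_def)
    also have "\<dots> = S *\<^sub>R (LINT r|lborel. (r ^ (DIM('a) - 1) * indicator {0<..} r) *\<^sub>R f r)"
      by (rule integral_radial_times_angular[of "\<lambda>\<omega>. F (k *\<^sub>R \<omega>)"]) (use Fw S in \<open>auto simp: T_def\<close>)
    also have "(LINT r|lborel. (r ^ (DIM('a) - 1) * indicator {0<..} r) *\<^sub>R f r)
       = (LINT r|lborel. k ^ m *\<^sub>R (indicator {k - \<delta>..k + \<delta>} r *\<^sub>R (of_real r / (of_real (k\<^sup>2 - r\<^sup>2) + \<i> * of_real \<epsilon>))))"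
    proof (rule Bochner_Integration.integral_cong)
      fix r :: real
      show "(r ^ (DIM('a) - 1) * indicator {0<..} r) *\<^sub>R f r = k ^ m *\<^sub>R (indicator {k - \<delta>..k + \<delta>} r *\<^sub>R (of_real r / (of_real (k\<^sup>2 - r\<^sup>2) + \<i> * of_real \<epsilon>)))"
      proof (cases "r \<in> {k - \<delta>..k + \<delta>}")
        case True
        then have r: "0 < r" using \<delta> k by auto
        have "r ^ Suc m * (k / r) ^ m = k ^ m * r" using r by (simp add: power_divide)
        then have "complex_of_real (r ^ Suc m) * of_real ((k / r) ^ m) = of_real (k ^ m) * of_real r" by (metis of_real_mult)
        then show ?thesis using True r unfolding m by (simp add: f_def scaleR_conv_of_real)
      qed (simp add: f_def)
    qed simp
    also have "\<dots> = k ^ m *\<^sub>R window_log k \<delta> \<epsilon>"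
      by (subst integral_scaleR_right) (simp only: resolvent_window_integral(2)[OF k \<delta>(1) \<delta>(2) e])
    finally show ?thesis by (simp add: scaleR_conv_of_real)
  qed
  obtain c where c: "\<bar>c\<bar> \<le> 1"
    "((\<lambda>\<epsilon>. window_log k \<delta> \<epsilon>)
      \<longlongrightarrow> of_real c - \<i> * of_real (pi / 2)) (at_right 0)"
    using resolvent_window_limit[OF k \<delta>(1) \<delta>(2)] by blast
  define X where "X = (LINT \<zeta>|lborel. G \<zeta> / u \<zeta>)"
  have limG: "((\<lambda>\<epsilon>. LINT \<zeta>|lborel. of_real (G \<zeta>) / ?d \<epsilon> \<zeta>) \<longlongrightarrow> of_real X) (at_right 0)"
    unfolding filterlim_at_right_to_top X_def integral_complex_of_real[symmetric]
  proof (rule integral_dominated_convergence_at_top[OF _ _ Bint])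
    show "\<forall>\<^sub>F t in at_top. AE \<zeta> in lborel. norm (of_real (G \<zeta>) / ?d (inverse t) \<zeta>) \<le> B * (w \<zeta> / norm \<zeta>)"
      using eventually_gt_at_top[of "0::real"]
    proof eventually_elim
      fix t :: real assume "0 < t"
      then have "0 < inverse t" by simp
      show "AE \<zeta> in lborel. norm (of_real (G \<zeta>) / ?d (inverse t) \<zeta>) \<le> B * (w \<zeta> / norm \<zeta>)"
        using AEz by eventually_elim (rule Gd[OF \<open>0 < inverse t\<close>])
    qed
    show "AE \<zeta> in lborel. ((\<lambda>t. of_real (G \<zeta>) / ?d (inverse t) \<zeta>) \<longlongrightarrow> complex_of_real (G \<zeta> / u \<zeta>)) at_top"
      using AEz
    proof eventually_elim
      fix \<zeta> :: 'a assume z: "\<zeta> \<noteq> 0"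
      show "((\<lambda>t. of_real (G \<zeta>) / ?d (inverse t) \<zeta>) \<longlongrightarrow> complex_of_real (G \<zeta> / u \<zeta>)) at_top"
      proof (cases "u \<zeta> = 0")
        case True
        then have "G \<zeta> = 0" using boundG[OF z] by simp
        then show ?thesis by simp
      next
        case False
        have "((\<lambda>t. of_real (G \<zeta>) / ?d (inverse t) \<zeta>) \<longlongrightarrow> of_real (G \<zeta>) / (complex_of_real (u \<zeta>) + \<i> * of_real 0)) at_top"
          using False by (intro tendsto_intros tendsto_inverse_0_at_top filterlim_ident) auto
        then show ?thesis by simp
      qed
    qed
  qed measurable
  define L where "L = of_real X + of_real (S * k ^ m) * (of_real c - \<i> * of_real (pi / 2))"
  have damped: "damped_resolvent F k = (\<lambda>\<epsilon>. LINT \<zeta>|lborel. of_real (F \<zeta>) / ?d \<epsilon> \<zeta>)"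
    by (rule ext) (simp only: damped_resolvent_def u_def)
  have lim: "(damped_resolvent F k \<longlongrightarrow> L) (at_right 0)"
    unfolding damped
  proof (rule Lim_transform_eventually)
    show "((\<lambda>\<epsilon>. (LINT \<zeta>|lborel. of_real (G \<zeta>) / ?d \<epsilon> \<zeta>) + of_real (S * k ^ m) *
        window_log k \<delta> \<epsilon>) \<longlongrightarrow> L) (at_right 0)"
      unfolding L_def by (intro tendsto_add tendsto_mult limG c tendsto_const)
    show "\<forall>\<^sub>F \<epsilon> in at_right 0. (LINT \<zeta>|lborel. of_real (G \<zeta>) / ?d \<epsilon> \<zeta>) + of_real (S * k ^ m) *
        window_log k \<delta> \<epsilon>
        = (LINT \<zeta>|lborel. of_real (F \<zeta>) / ?d \<epsilon> \<zeta>)"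
      using eventually_at_right_less[of "0::real"]
    proof eventually_elim
      fix \<epsilon> :: real assume e: "0 < \<epsilon>"
      have eq: "of_real (H \<zeta>) / ?d \<epsilon> \<zeta> = of_real (F \<zeta>) / ?d \<epsilon> \<zeta> - of_real (G \<zeta>) / ?d \<epsilon> \<zeta>" for \<zeta>
        by (simp add: G_def diff_divide_distrib[symmetric])
      have "(LINT \<zeta>|lborel. of_real (H \<zeta>) / ?d \<epsilon> \<zeta>) = (LINT \<zeta>|lborel. of_real (F \<zeta>) / ?d \<epsilon> \<zeta>) - (LINT \<zeta>|lborel. of_real (G \<zeta>) / ?d \<epsilon> \<zeta>)"
        unfolding eq by (rule Bochner_Integration.integral_diff[OF Fint[OF e] Gint[OF e]])
      then show "(LINT \<zeta>|lborel. of_real (G \<zeta>) / ?d \<epsilon> \<zeta>) + of_real (S * k ^ m) *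
        window_log k \<delta> \<epsilon>
        = (LINT \<zeta>|lborel. of_real (F \<zeta>) / ?d \<epsilon> \<zeta>)"
        unfolding Hval[OF e, symmetric] by simp
    qed
  qed
  have ImL: "Im L = - (pi / 2) * (S * k ^ m)" by (simp add: L_def)
  have "norm L \<le> norm (complex_of_real X) + norm (complex_of_real (S * k ^ m) * (of_real c - \<i> * of_real (pi / 2)))"
    unfolding L_def by (rule norm_triangle_ineq)
  also have "norm (complex_of_real X) \<le> B * I"
  proof -
    have "norm X \<le> (LINT \<zeta>|lborel. norm (G \<zeta> / u \<zeta>))"
      unfolding X_def by (rule integral_norm_bound)
    also have "\<dots> \<le> (LINT \<zeta>|lborel. B * (w \<zeta> / norm \<zeta>))"
    proof (rule integral_mono_AE)
      show "integrable lborel (\<lambda>\<zeta>. norm (G \<zeta> / u \<zeta>))"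
      proof (rule integrable_norm)
      show "integrable lborel (\<lambda>\<zeta>. G \<zeta> / u \<zeta>)"
      proof (rule Bochner_Integration.integrable_bound[OF Bint])
        show "AE \<zeta> in lborel. norm (G \<zeta> / u \<zeta>) \<le> norm (B * (w \<zeta> / norm \<zeta>))"
          using AEz
        proof eventually_elim
          fix \<zeta> :: 'a assume "\<zeta> \<noteq> 0"
          from boundG[OF this] show "norm (G \<zeta> / u \<zeta>) \<le> norm (B * (w \<zeta> / norm \<zeta>))"
            using B w0[of \<zeta>] by (cases "u \<zeta> = 0") (auto simp: abs_div divide_le_eq)
        qed
      qed measurable
      qed
      show "AE \<zeta> in lborel. norm (G \<zeta> / u \<zeta>) \<le> B * (w \<zeta> / norm \<zeta>)"
        using AEz
      proof eventually_elim
        fix \<zeta> :: 'a assume "\<zeta> \<noteq> 0"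
        from boundG[OF this] show "norm (G \<zeta> / u \<zeta>) \<le> B * (w \<zeta> / norm \<zeta>)"
          using B w0[of \<zeta>] by (cases "u \<zeta> = 0") (auto simp: divide_le_eq)
      qed
    qed (rule Bint)
    also have "\<dots> = B * (LINT \<zeta>|lborel. w \<zeta> / norm \<zeta>)" by (rule integral_mult_right_zero)
    also have "\<dots> \<le> B * I" by (intro mult_left_mono intn B)
    finally show ?thesis by simp
  qed
  also have "norm (complex_of_real (S * k ^ m) * (of_real c - \<i> * of_real (pi / 2))) \<le> (K * I / k) * 3"
  proof -
    have "norm (complex_of_real c - \<i> * of_real (pi / 2)) \<le> \<bar>c\<bar> + pi / 2"
      by (rule order_trans[OF norm_triangle_ineq4]) (simp add: norm_mult)
    also have "\<dots> \<le> 3" using c(1) pi_less_4 by linarith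
    finally have 3: "norm (complex_of_real c - \<i> * of_real (pi / 2)) \<le> 3" .
    have "norm (complex_of_real (S * k ^ m)) = S * k ^ m" using S k by (simp only: norm_of_real) auto
    then show ?thesis unfolding norm_mult[of "complex_of_real (S * k ^ m)"]
      using Sk 3 K I0 k by (intro mult_mono) auto
  qed
  also have "B * I + (K * I / k) * 3 \<le> ((2 + 2 * K * M) + 3 * K) * I * (1 + 1 / k)"
  proof -
    have "(K * I / k) * 3 \<le> 3 * K * I * (1 + 1 / k)" using K I0 by (simp add: distrib_left mult_ac)
    then show ?thesis by (simp add: B_def algebra_simps)
  qed
  finally have "norm L \<le> ((2 + 2 * K * M) + 3 * K) * I * (1 + 1 / k)" by simp
  then show ?thesis
    using lim ImL S unfolding T_def M_def m_def by blast
qed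

section \<open>Products of two translated kernels\<close>

lemma nn_integral_radial:
  fixes f :: "real \<Rightarrow> ennreal"
  assumes [measurable]: "f \<in> borel_measurable borel"
  shows "(\<integral>\<^sup>+x. f (norm x) \<partial>(lborel :: 'a::euclidean_space measure)) =
    (\<integral>\<^sup>+r. ennreal (r ^ (DIM('a) - 1)) * indicator {0<..} r * f r \<partial>lborel) * emeasure (surface_measure :: 'a measure) UNIV"
proof -
  have "(\<integral>\<^sup>+\<omega>. f (norm (r *\<^sub>R \<omega>)) \<partial>(surface_measure :: 'a measure)) = f r * emeasure (surface_measure :: 'a measure) UNIV" if "0 < r" for r
  proof -
    have "(\<integral>\<^sup>+\<omega>. f (norm (r *\<^sub>R \<omega>)) \<partial>(surface_measure :: 'a measure)) = (\<integral>\<^sup>+\<omega>. f r \<partial>(surface_measure :: 'a measure))"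
      by (rule nn_integral_cong_AE, use AE_surface_measure_sphere in eventually_elim) (use that in simp)
    then show ?thesis by simp
  qed
  then have "(\<integral>\<^sup>+x. f (norm x) \<partial>(lborel :: 'a measure)) = (\<integral>\<^sup>+r. ennreal (r ^ (DIM('a) - 1)) * indicator {0<..} r * f r * emeasure (surface_measure :: 'a measure) UNIV \<partial>lborel)"
    by (subst nn_integral_polar, measurable) (auto intro!: nn_integral_cong simp: mult.assoc split: split_indicator)
  then show ?thesis by (simp add: nn_integral_multc)
qed

lemma emeasure_surface_measure_finite: "emeasure (surface_measure :: 'a::euclidean_space measure) UNIV < \<infinity>"
  using finite_measure.emeasure_finite[OF finite_surface_measure[where 'a = 'a], of UNIV] by (simp add: less_top)

lemma measurable_jbracket [measurable]: "jbracket \<in> borel_measurable borel"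
  by (rule borel_measurable_continuous_onI[OF continuous_on_jbracket])

lemma integrable_inverse_norm_ball:
  assumes "2 \<le> DIM('a::euclidean_space)"
  shows "integrable lborel (\<lambda>x::'a. indicator (ball 0 1) x / norm x)"
proof (rule integrableI_bounded)
  have [measurable]: "ball (0::'a) 1 \<in> sets borel" by simp
  show "(\<lambda>x::'a. indicator (ball 0 1) x / norm x :: real) \<in> borel_measurable lborel" by measurable
  have "(\<integral>\<^sup>+x. ennreal (norm (indicator (ball 0 1) x / norm x :: real)) \<partial>(lborel :: 'a measure))
    = (\<integral>\<^sup>+x. ennreal (indicator {..<1} (norm x) / norm x) \<partial>(lborel :: 'a measure))"
    by (intro nn_integral_cong) (auto split: split_indicator)
  also have "\<dots> = (\<integral>\<^sup>+r. ennreal (r ^ (DIM('a) - 1)) * indicator {0<..} r * ennreal (indicator {..<1} r / r) \<partial>lborel)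
      * emeasure (surface_measure :: 'a measure) UNIV"
    by (rule nn_integral_radial) measurable
  also have "\<dots> \<le> (\<integral>\<^sup>+r. indicator {0..1::real} r \<partial>lborel) * emeasure (surface_measure :: 'a measure) UNIV"
  proof (intro mult_right_mono nn_integral_mono)
    fix r :: real
    show "ennreal (r ^ (DIM('a) - 1)) * indicator {0<..} r * ennreal (indicator {..<1} r / r) \<le> indicator {0..1} r"
    proof (cases "0 < r \<and> r < 1")
      case True
      have "r ^ (DIM('a) - 1) = r ^ (DIM('a) - 2) * r"
        using assms by (metis Suc_1 Suc_diff_Suc Suc_le_lessD power_Suc2 One_nat_def)
      then have "r ^ (DIM('a) - 1) * (1 / r) \<le> 1" using True by (simp add: power_le_one)
      then have "ennreal (r ^ (DIM('a) - 1) * (1 / r)) \<le> 1" using ennreal_leI ennreal_1 by metis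
      moreover have "ennreal (r ^ (DIM('a) - 1)) * ennreal (1 / r) = ennreal (r ^ (DIM('a) - 1) * (1 / r))"
        using True by (intro ennreal_mult[symmetric]) auto
      ultimately show ?thesis using True by simp
    qed (auto split: split_indicator)
  qed simp
  also have "\<dots> < \<infinity>" using emeasure_surface_measure_finite[where 'a = 'a] by simp
  finally show "(\<integral>\<^sup>+x. ennreal (norm (indicator (ball 0 1) x / norm x :: real)) \<partial>(lborel :: 'a measure)) < \<infinity>" .
qed

lemma integrable_jbracket_powr:
  assumes s: "real DIM('a::euclidean_space) < 2 * s"
  shows "integrable lborel (\<lambda>x::'a. jbracket x powr - (2 * s))"
proof (rule integrableI_bounded)
  define n where "n = DIM('a)"
  have n: "0 < n" by (simp add: n_def)
  define e where "e = real n - 2 * s"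
  have e: "e < 0" using s by (simp add: e_def n_def)
  have tail: "(\<integral>\<^sup>+r. ennreal (r powr (e - 1)) * indicator {1..} r \<partial>lborel) = ennreal (0 - 1 powr e / e)"
  proof (rule nn_integral_FTC_atLeast)
    show "((\<lambda>r. r powr e / e) has_real_derivative x powr (e - 1)) (at x)" if "1 \<le> x" for x
      using that e by (auto intro!: derivative_eq_intros simp: field_simps)
    have "((\<lambda>r. r powr e / e) \<longlongrightarrow> 0 / e) at_top"
      using e by (intro tendsto_divide tendsto_neg_powr filterlim_ident tendsto_const) auto
    then show "((\<lambda>r. r powr e / e) \<longlongrightarrow> 0) at_top" by simp
  qed auto
  have "(\<integral>\<^sup>+x. ennreal (norm (jbracket x powr - (2 * s))) \<partial>(lborel :: 'a measure))
    = (\<integral>\<^sup>+x. ennreal (sqrt (1 + (norm x)\<^sup>2) powr - (2 * s)) \<partial>(lborel :: 'a measure))"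
    by (intro nn_integral_cong) (simp add: jbracket_eq)
  also have "\<dots> = (\<integral>\<^sup>+r. ennreal (r ^ (n - 1)) * indicator {0<..} r * ennreal (sqrt (1 + r\<^sup>2) powr - (2 * s)) \<partial>lborel)
      * emeasure (surface_measure :: 'a measure) UNIV"
    unfolding n_def by (rule nn_integral_radial) measurable
  also have "\<dots> \<le> (\<integral>\<^sup>+r. indicator {0..1} r + ennreal (r powr (e - 1)) * indicator {1..} r \<partial>lborel) * emeasure (surface_measure :: 'a measure) UNIV"
  proof (intro mult_right_mono nn_integral_mono)
    fix r :: real
    have s0: "0 \<le> 2 * s" using s by simp
    consider "r \<le> 0" | "0 < r" "r \<le> 1" | "1 < r" by linarith
    then show "ennreal (r ^ (n - 1)) * indicator {0<..} r * ennreal (sqrt (1 + r\<^sup>2) powr - (2 * s)) \<le> indicator {0..1} r + ennreal (r powr (e - 1)) * indicator {1..} r"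
    proof cases
      case 2
      have "sqrt (1 + r\<^sup>2) powr - (2 * s) \<le> 1 powr - (2 * s)" using s0 by (intro powr_mono2') auto
      then have "r ^ (n - 1) * sqrt (1 + r\<^sup>2) powr - (2 * s) \<le> 1 * 1"
        using 2 by (intro mult_mono power_le_one) auto
      then have "ennreal (r ^ (n - 1) * sqrt (1 + r\<^sup>2) powr - (2 * s)) \<le> 1" using ennreal_leI ennreal_1 by fastforce
      moreover have "ennreal (r ^ (n - 1)) * ennreal (sqrt (1 + r\<^sup>2) powr - (2 * s)) = ennreal (r ^ (n - 1) * sqrt (1 + r\<^sup>2) powr - (2 * s))"
        using 2 by (intro ennreal_mult[symmetric]) auto
      ultimately show ?thesis using 2 by (simp add: add_increasing2)
    next
      case 3
      have "sqrt (1 + r\<^sup>2) powr - (2 * s) \<le> r powr - (2 * s)"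
        using s0 3 by (intro powr_mono2') (auto simp: real_le_rsqrt)
      then have "r ^ (n - 1) * sqrt (1 + r\<^sup>2) powr - (2 * s) \<le> r powr real (n - 1) * r powr - (2 * s)"
        using 3 by (intro mult_mono) (auto simp: powr_realpow)
      also have "\<dots> = r powr (e - 1)" using n by (simp add: powr_add[symmetric] e_def of_nat_diff algebra_simps)
      finally have "ennreal (r ^ (n - 1) * sqrt (1 + r\<^sup>2) powr - (2 * s)) \<le> ennreal (r powr (e - 1))" by (rule ennreal_leI)
      moreover have "ennreal (r ^ (n - 1)) * ennreal (sqrt (1 + r\<^sup>2) powr - (2 * s)) = ennreal (r ^ (n - 1) * sqrt (1 + r\<^sup>2) powr - (2 * s))"
        using 3 by (intro ennreal_mult[symmetric]) auto
      ultimately show ?thesis using 3 by simp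
    qed simp
  qed simp
  also have "(\<integral>\<^sup>+r. indicator {0..1} r + ennreal (r powr (e - 1)) * indicator {1..} r \<partial>lborel) = 1 + ennreal (0 - 1 powr e / e)"
    by (subst nn_integral_add) (auto simp: tail)
  also have "(1 + ennreal (0 - 1 powr e / e)) * emeasure (surface_measure :: 'a measure) UNIV < \<infinity>"
    using emeasure_surface_measure_finite[where 'a = 'a] by (simp add: ennreal_mult_less_top)
  finally show "(\<integral>\<^sup>+x. ennreal (norm (jbracket x powr - (2 * s))) \<partial>(lborel :: 'a measure)) < \<infinity>" .
qed measurable

lemma jbracket_powr_shift:
  assumes "norm (x - y) \<le> 1" "0 \<le> s"
  shows "jbracket y powr - s \<le> 2 powr s * jbracket x powr - s"
proof -
  have "jbracket x \<le> 2 * jbracket y" by (rule jbracket_shift) (use assms in \<open>simp add: norm_minus_commute\<close>)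
  then have "(2 * jbracket y) powr - s \<le> jbracket x powr - s" using assms by (intro powr_mono2') auto
  then have "2 powr s * (2 powr - s * jbracket y powr - s) \<le> 2 powr s * jbracket x powr - s"
    by (intro mult_left_mono) (auto simp: powr_mult less_imp_le)
  then show ?thesis by (simp add: mult.assoc[symmetric] powr_add[symmetric])
qed

text \<open>What the scattering estimates use of the Fourier transform of the potential. The
  condition on \<open>s\<close> makes products of two translates integrable uniformly in the translations.\<close>

locale decaying_kernel =
  fixes Q :: "'a::euclidean_space \<Rightarrow> real" and c C s :: real
  assumes dim: "2 \<le> DIM('a)" and s: "real DIM('a) < 2 * s" and c: "0 < c" and C: "0 < C"
    and Q_measurable [measurable]: "Q \<in> borel_measurable borel"
    and lower: "\<And>\<xi>. c * jbracket \<xi> powr - s \<le> Q \<xi>"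
    and upper: "\<And>\<xi>. Q \<xi> \<le> C * jbracket \<xi> powr - s"
    and lip: "\<And>\<xi> \<eta>. norm (\<xi> - \<eta>) \<le> 1 \<Longrightarrow> \<bar>Q \<xi> - Q \<eta>\<bar> \<le> C * norm (\<xi> - \<eta>) * jbracket \<xi> powr - s"
begin

lemma s_pos: "0 < s" using s by simp

lemma Q_nonneg: "0 \<le> Q \<xi>"
  using lower[of \<xi>] c by (meson less_imp_le mult_nonneg_nonneg order_trans powr_ge_zero)

definition weight :: "'a \<Rightarrow> 'a \<Rightarrow> 'a \<Rightarrow> real" where
  "weight a b x = jbracket (a - x) powr - s * jbracket (x - b) powr - s"

lemma weight_nonneg: "0 \<le> weight a b x" by (simp add: weight_def)

lemma weight_le_1: "weight a b x \<le> 1"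
proof -
  have "jbracket y powr - s \<le> 1" for y :: 'a
    using powr_mono2'[of "- s" 1 "jbracket y"] jbracket_ge_1[of y] s_pos by simp
  then show ?thesis unfolding weight_def by (simp add: mult_le_one)
qed

lemma weight_measurable [measurable]: "weight a b \<in> borel_measurable borel"
  unfolding weight_def by measurable

lemma weight_slow: "norm (x - y) \<le> 1 \<Longrightarrow> weight a b y \<le> 4 powr s * weight a b x"
proof -
  assume xy: "norm (x - y) \<le> 1"
  have "weight a b y \<le> (2 powr s * jbracket (a - x) powr - s) * (2 powr s * jbracket (x - b) powr - s)"
    unfolding weight_def using xy s_pos
    by (intro mult_mono jbracket_powr_shift) (auto simp: norm_minus_commute)
  also have "\<dots> = (2 powr s * 2 powr s) * weight a b x" by (simp add: weight_def)
  also have "2 powr s * 2 powr s = (4::real) powr s" by (simp add: powr_mult[symmetric])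
  finally show ?thesis .
qed

text \<open>Bounds the mass of the weight, and of the weight divided by \<open>|x|\<close>, for all centres \<open>a\<close> and
  \<open>b\<close>.\<close>

definition weight_mass :: real where
  "weight_mass = 2 * (LINT x::'a|lborel. jbracket x powr - (2 * s)) + (LINT x::'a|lborel. indicator (ball 0 1) x / norm x)"

text \<open>The arithmetic-geometric mean inequality dominates the weight by the sum of two
  translates of \<open>jbracket x powr - (2 * s)\<close>. Near the origin the weight is at most 1 and \<open>1/|x|\<close>
  is integrable.\<close>

lemma weight_integrals:
  shows "integrable lborel (weight a b)" "(LINT x|lborel. weight a b x) \<le> weight_mass"
    and "integrable lborel (\<lambda>x. weight a b x / norm x)" "(LINT x|lborel. weight a b x / norm x) \<le> weight_mass"
proof -
  let ?j = "\<lambda>x::'a. jbracket x powr - (2 * s)"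
  have j: "integrable lborel ?j" by (rule integrable_jbracket_powr[OF s])
  have j2: "integrable lborel (\<lambda>x. ?j (x - b))" for b
    using integrable_translation[OF j, of "- b"] by simp
  have j2i: "(LINT x|lborel. ?j (x - b)) = (LINT x|lborel. ?j x)" for b
    using integral_translation[of ?j "- b"] by simp
  have jm: "?j (a - x) = ?j (x - a)" for x by (simp add: jbracket_eq norm_minus_commute)
  let ?g = "\<lambda>x. ?j (x - a) + ?j (x - b)"
  have g: "integrable lborel ?g" "(LINT x|lborel. ?g x) = 2 * (LINT x|lborel. ?j x)"
    using j2 by (auto simp: j2i)
  have wg: "weight a b x \<le> ?g x" for x
  proof -
    let ?p = "jbracket (a - x) powr - s" and ?q = "jbracket (x - b) powr - s"
    have "0 \<le> (?p - ?q)\<^sup>2" by simp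
    then have "2 * (?p * ?q) \<le> ?p * ?p + ?q * ?q" by (simp add: power2_eq_square algebra_simps)
    moreover have "?p * ?p = ?j (x - a)" "?q * ?q = ?j (x - b)" by (auto simp: powr_add[symmetric] jm[symmetric])
    moreover have "0 \<le> ?p * ?q" by simp
    ultimately show ?thesis unfolding weight_def by linarith
  qed
  let ?h = "\<lambda>x::'a. indicator (ball 0 1) x / norm x :: real"
  have h: "integrable lborel ?h" by (rule integrable_inverse_norm_ball[OF dim])
  have h0: "0 \<le> (LINT x|lborel. ?h x)" by (rule Bochner_Integration.integral_nonneg) auto
  show int: "integrable lborel (weight a b)"
    by (rule Bochner_Integration.integrable_bound[OF g(1)]) (use wg weight_nonneg in \<open>auto simp: abs_of_nonneg\<close>)
  have "(LINT x|lborel. weight a b x) \<le> (LINT x|lborel. ?g x)" by (rule integral_mono[OF int g(1) wg])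
  then show "(LINT x|lborel. weight a b x) \<le> weight_mass" unfolding weight_mass_def g(2) using h0 by linarith
  have wgh: "weight a b x / norm x \<le> ?g x + ?h x" for x
  proof (cases "norm x < 1")
    case True
    have "weight a b x / norm x \<le> 1 / norm x" using weight_le_1 by (intro divide_right_mono) auto
    then show ?thesis using True by (simp add: add_increasing)
  next
    case False
    then have "weight a b x / norm x \<le> weight a b x / 1" using weight_nonneg by (intro divide_left_mono) auto
    then show ?thesis using wg[of x] False by simp
  qed
  have gh: "integrable lborel (\<lambda>x. ?g x + ?h x)" by (rule Bochner_Integration.integrable_add[OF g(1) h])
  show int2: "integrable lborel (\<lambda>x. weight a b x / norm x)"
  proof (rule Bochner_Integration.integrable_bound[OF gh])
    show "AE x in lborel. norm (weight a b x / norm x) \<le> norm (?g x + ?h x)"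
    proof (rule AE_I2)
      fix x show "norm (weight a b x / norm x) \<le> norm (?g x + ?h x)"
        using wgh[of x] weight_nonneg[of a b x] by (simp add: abs_of_nonneg)
    qed
  qed measurable
  have "(LINT x|lborel. weight a b x / norm x) \<le> (LINT x|lborel. ?g x + ?h x)" by (rule integral_mono[OF int2 gh wgh])
  also have "\<dots> = weight_mass" unfolding weight_mass_def g(2)[symmetric] by (rule Bochner_Integration.integral_add[OF g(1) h])
  finally show "(LINT x|lborel. weight a b x / norm x) \<le> weight_mass" .
qed

definition product :: "'a \<Rightarrow> 'a \<Rightarrow> 'a \<Rightarrow> real" where
  "product a b x = Q (a - x) * Q (x - b)"

lemma product_measurable [measurable]: "product a b \<in> borel_measurable borel"
  unfolding product_def by measurable

lemma product_lower: "c\<^sup>2 * weight a b x \<le> product a b x"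
proof -
  have "(c * jbracket (a - x) powr - s) * (c * jbracket (x - b) powr - s) \<le> product a b x"
    unfolding product_def by (intro mult_mono lower Q_nonneg) (use c in auto)
  then show ?thesis by (simp add: weight_def power2_eq_square mult_ac)
qed

lemma product_upper: "product a b x \<le> C\<^sup>2 * weight a b x"
proof -
  have "product a b x \<le> (C * jbracket (a - x) powr - s) * (C * jbracket (x - b) powr - s)"
    unfolding product_def by (intro mult_mono upper Q_nonneg) (use C in auto)
  then show ?thesis by (simp add: weight_def power2_eq_square mult_ac)
qed

lemma product_lipschitz:
  assumes xy: "norm (x - y) \<le> 1"
  shows "\<bar>product a b x - product a b y\<bar> \<le> norm (x - y) * (C\<^sup>2 * (1 + 2 powr s) * weight a b x)"
proof -
  let ?p = "jbracket (a - x) powr - s" and ?q = "jbracket (x - b) powr - s"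
  have "product a b x - product a b y = (Q (a - x) - Q (a - y)) * Q (x - b) + Q (a - y) * (Q (x - b) - Q (y - b))"
    by (simp add: product_def algebra_simps)
  also have "\<bar>\<dots>\<bar> \<le> \<bar>Q (a - x) - Q (a - y)\<bar> * Q (x - b) + Q (a - y) * \<bar>Q (x - b) - Q (y - b)\<bar>"
    by (rule order_trans[OF abs_triangle_ineq]) (simp add: abs_mult Q_nonneg)
  also have "\<dots> \<le> (C * norm (x - y) * ?p) * (C * ?q) + (C * (2 powr s * ?p)) * (C * norm (x - y) * ?q)"
  proof (intro add_mono mult_mono)
    show "\<bar>Q (a - x) - Q (a - y)\<bar> \<le> C * norm (x - y) * ?p"
      using lip[of "a - x" "a - y"] xy by (simp add: norm_minus_commute)
    show "\<bar>Q (x - b) - Q (y - b)\<bar> \<le> C * norm (x - y) * ?q" using lip[of "x - b" "y - b"] xy by simp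
    show "Q (x - b) \<le> C * ?q" by (rule upper)
    have "Q (a - y) \<le> C * jbracket (a - y) powr - s" by (rule upper)
    also have "\<dots> \<le> C * (2 powr s * ?p)"
      using xy C s_pos by (intro mult_left_mono jbracket_powr_shift) (auto simp: norm_minus_commute)
    finally show "Q (a - y) \<le> C * (2 powr s * ?p)" .
  qed (use C Q_nonneg in auto)
  also have "\<dots> = norm (x - y) * (C\<^sup>2 * (1 + 2 powr s) * weight a b x)"
    by (simp add: weight_def power2_eq_square algebra_simps)
  finally show ?thesis .
qed

lemma surface_pos: "0 < measure (surface_measure :: 'a measure) UNIV"
proof -
  have "emeasure (surface_measure :: 'a measure) UNIV = (\<integral>\<^sup>+\<omega>. 1 \<partial>(surface_measure :: 'a measure))" by simp
  also have "\<dots> = ennreal (real DIM('a)) * emeasure lborel (ball (0::'a) 1)"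
    by (subst nn_integral_surface_measure) auto
  also have "\<dots> = ennreal (real DIM('a) * measure lborel (ball (0::'a) 1))"
    using emeasure_lborel_ball_finite[of "0::'a" 1] by (simp add: emeasure_eq_ennreal_measure less_top ennreal_mult)
  finally have "measure (surface_measure :: 'a measure) UNIV = real DIM('a) * measure lborel (ball (0::'a) 1)"
    by (simp add: measure_def)
  then show ?thesis using content_ball_pos[of 1 "0::'a"] by simp
qed

text \<open>This is used with \<open>a = k\<theta>'\<close> and \<open>b = k\<theta>\<close>, so that \<open>a - b = \<eta>\<close>. The upper bounds are limiting
  absorption for the product of the kernels. For the first lower bound, all brackets on the
  sphere are at most \<open>3 k\<close> when \<open>k \<ge> 1\<close>. For the second one, the sphere is thickened to the
  shell \<open>k \<le> |\<zeta>| \<le> k + 1\<close>, which contains a ball of radius \<open>1/2\<close> next to \<open>b\<close>; there the bracket of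
  \<open>\<zeta> - b\<close> is at most 2 and that of \<open>a - \<zeta>\<close> at most twice that of \<open>a - b\<close>.\<close>

theorem born_limit:
  "\<exists>C1>0. \<exists>c1>0. \<forall>a b k. 0 < k \<longrightarrow> norm a = k \<longrightarrow> norm b = k \<longrightarrow>
    (\<exists>L. (damped_resolvent (product a b) k \<longlongrightarrow> L) (at_right 0) \<and>
      norm L \<le> C1 * (1 + 1 / k) \<and> Im L \<le> 0 \<and>
      (1 \<le> k \<longrightarrow> Im L \<le> - c1 * k powr (real DIM('a) - 2 - 2 * s) \<and> Im L \<le> - c1 * (jbracket (a - b) powr - s / k)))"
  (is "\<exists>C1>0. \<exists>c1>0. \<forall>a b k. _ \<longrightarrow> _ \<longrightarrow> _ \<longrightarrow> ?P C1 c1 a b k")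
proof -
  define A where "A = C\<^sup>2 * (1 + 2 powr s)"
  have A: "0 < A" "C\<^sup>2 \<le> A" using C by (auto simp: A_def add_pos_pos)
  define K where "K = (4::real) powr s"
  have K: "1 \<le> K" using s_pos by (simp add: K_def ge_one_powr_ge_zero)
  define C1 where "C1 = ((2 + 2 * K * (real (DIM('a) - 2) * 2 ^ (DIM('a) - 2))) + 3 * K) * (A * weight_mass) + 1"
  have weight_mass: "0 \<le> weight_mass" using weight_integrals(2)[of 0 0] Bochner_Integration.integral_nonneg[of lborel "weight 0 0"] weight_nonneg by fastforce
  have C1: "0 < C1" unfolding C1_def using K A weight_mass by (intro add_nonneg_pos mult_nonneg_nonneg add_nonneg_nonneg) auto
  define \<sigma> where "\<sigma> = measure (surface_measure :: 'a measure) UNIV"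
  have \<sigma>: "0 < \<sigma>" using surface_pos by (simp add: \<sigma>_def)
  have \<sigma>_eq: "emeasure (surface_measure :: 'a measure) UNIV = ennreal \<sigma>"
    using emeasure_surface_measure_finite[where 'a = 'a] by (simp add: \<sigma>_def emeasure_eq_ennreal_measure less_top)
  define V where "V = measure lborel (ball (0::'a) (1/2))"
  have V: "0 < V" by (simp add: V_def content_ball_pos)
  have V_eq: "emeasure lborel (ball (p::'a) (1/2)) = ennreal V" for p
  proof -
    have "measure lborel (ball p (1/2)) = V" unfolding V_def by (simp add: content_ball)
    then show ?thesis using emeasure_lborel_ball_finite[of p "1/2"] by (simp add: emeasure_eq_ennreal_measure less_top)
  qed
  define d1 where "d1 = pi / 2 * (c\<^sup>2 * 3 powr - (2 * s) * \<sigma>)"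
  define d2 where "d2 = pi / 2 * (c\<^sup>2 * (4 powr - s * V / (2 ^ (DIM('a) - 1) * K)))"
  have d: "0 < d1" "0 < d2" using c \<sigma> V K by (auto simp: d1_def d2_def)
  define c1 where "c1 = min d1 d2"
  have c1: "0 < c1" "c1 \<le> d1" "c1 \<le> d2" using d by (auto simp: c1_def)
  have main: "?P C1 c1 a b k"
    if k: "0 < k" and ab: "norm a = k" "norm b = k" for a b :: 'a and k
  proof -
    have int: "integrable lborel (\<lambda>x. A * weight a b x)" "(LINT x|lborel. A * weight a b x) \<le> A * weight_mass"
      using weight_integrals(1,2)[of a b] A by auto
    have "integrable lborel (\<lambda>x. A * (weight a b x / norm x))" by (intro integrable_mult_right weight_integrals)
    moreover have "(LINT x|lborel. A * (weight a b x / norm x)) \<le> A * weight_mass"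
      unfolding integral_mult_right_zero using A by (intro mult_left_mono weight_integrals) auto
    ultimately have intn: "integrable lborel (\<lambda>x. A * weight a b x / norm x)" "(LINT x|lborel. A * weight a b x / norm x) \<le> A * weight_mass"
      by (simp_all only: times_divide_eq_right)
    have "\<exists>S\<ge>0. sphere_integral (product a b) k = ennreal S \<and>
     (\<exists>L. (damped_resolvent (product a b) k \<longlongrightarrow> L) (at_right 0) \<and>
      Im L = - (pi / 2) * (S * k ^ (DIM('a) - 2)) \<and>
      norm L \<le> ((2 + 2 * K * (real (DIM('a) - 2) * 2 ^ (DIM('a) - 2))) + 3 * K) * (A * weight_mass) * (1 + 1 / k))"
    proof (rule limiting_absorption[OF dim _ _ _ _ _ K _ int intn k])
      show "0 \<le> product a b x" for x by (simp add: product_def Q_nonneg)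
      show "product a b x \<le> A * weight a b x" for x
        using product_upper[of a b x] mult_right_mono[OF A(2) weight_nonneg[of a b x]] by linarith
      show "\<bar>product a b x - product a b y\<bar> \<le> norm (x - y) * (A * weight a b x)" if "norm (x - y) \<le> 1" for x y
        using product_lipschitz[OF that] by (simp add: A_def)
      show "A * weight a b y \<le> K * (A * weight a b x)" if "norm (x - y) \<le> 1" for x y
        using mult_left_mono[OF weight_slow[OF that, of a b], of A] A by (simp add: K_def mult_ac)
    qed measurable
    then obtain S L where S: "0 \<le> S" "sphere_integral (product a b) k = ennreal S"
      and L: "(damped_resolvent (product a b) k \<longlongrightarrow> L) (at_right 0)"
      "Im L = - (pi / 2) * (S * k ^ (DIM('a) - 2))"
      "norm L \<le> ((2 + 2 * K * (real (DIM('a) - 2) * 2 ^ (DIM('a) - 2))) + 3 * K) * (A * weight_mass) * (1 + 1 / k)" by blast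
    have "norm L \<le> C1 * (1 + 1 / k)"
      by (rule order_trans[OF L(3)]) (use k in \<open>auto simp: C1_def intro!: mult_right_mono\<close>)
    moreover have "Im L \<le> 0" using S k by (simp add: L(2))
    moreover have "Im L \<le> - c1 * k powr (real DIM('a) - 2 - 2 * s)" if k1: "1 \<le> k"
    proof -
      have "ennreal (c\<^sup>2 * (3 * k) powr - (2 * s) * \<sigma>) = (\<integral>\<^sup>+\<omega>. ennreal (c\<^sup>2 * (3 * k) powr - (2 * s)) \<partial>(surface_measure :: 'a measure))"
        using \<sigma> by (simp add: \<sigma>_eq ennreal_mult'')
      also have "\<dots> \<le> sphere_integral (product a b) k"
      proof (rule nn_integral_mono_AE, use AE_surface_measure_sphere in eventually_elim)
        fix \<omega> :: 'a assume "norm \<omega> = 1"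
        then have nk: "norm (k *\<^sub>R \<omega>) = k" using k by simp
        have "norm (a - k *\<^sub>R \<omega>) \<le> 2 * k" "norm (k *\<^sub>R \<omega> - b) \<le> 2 * k"
          using norm_triangle_ineq4[of a "k *\<^sub>R \<omega>"] norm_triangle_ineq4[of "k *\<^sub>R \<omega>" b] unfolding nk ab by auto
        then have "jbracket (a - k *\<^sub>R \<omega>) \<le> 3 * k" "jbracket (k *\<^sub>R \<omega> - b) \<le> 3 * k"
          using jbracket_le[of "a - k *\<^sub>R \<omega>"] jbracket_le[of "k *\<^sub>R \<omega> - b"] k1 by linarith+
        then have "(3 * k) powr - s * (3 * k) powr - s \<le> weight a b (k *\<^sub>R \<omega>)"
          unfolding weight_def using s_pos by (intro mult_mono powr_mono2') auto
        then have "c\<^sup>2 * (3 * k) powr - (2 * s) \<le> c\<^sup>2 * weight a b (k *\<^sub>R \<omega>)"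
          by (intro mult_left_mono) (auto simp: powr_add[symmetric])
        then show "ennreal (c\<^sup>2 * (3 * k) powr - (2 * s)) \<le> ennreal (product a b (k *\<^sub>R \<omega>))"
          using product_lower[of a b "k *\<^sub>R \<omega>"] by (intro ennreal_leI) linarith
      qed
      finally have "c\<^sup>2 * (3 * k) powr - (2 * s) * \<sigma> \<le> S" unfolding S(2) using S(1) by simp
      then have "c\<^sup>2 * (3 * k) powr - (2 * s) * \<sigma> * k ^ (DIM('a) - 2) \<le> S * k ^ (DIM('a) - 2)"
        using k by (intro mult_right_mono) auto
      moreover have "(3 * k) powr - (2 * s) * k ^ (DIM('a) - 2) = 3 powr - (2 * s) * k powr (real DIM('a) - 2 - 2 * s)"
      proof -
        have "k ^ (DIM('a) - 2) = k powr (real DIM('a) - 2)" using k dim by (simp add: powr_realpow[symmetric] of_nat_diff)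
        then show ?thesis using k by (simp add: powr_mult powr_add[symmetric])
      qed
      ultimately have "c\<^sup>2 * 3 powr - (2 * s) * \<sigma> * k powr (real DIM('a) - 2 - 2 * s) \<le> S * k ^ (DIM('a) - 2)"
        by (simp add: mult_ac)
      then have "pi / 2 * (c\<^sup>2 * 3 powr - (2 * s) * \<sigma> * k powr (real DIM('a) - 2 - 2 * s)) \<le> pi / 2 * (S * k ^ (DIM('a) - 2))"
        by (intro mult_left_mono) auto
      then have "d1 * k powr (real DIM('a) - 2 - 2 * s) \<le> - Im L" unfolding L(2) d1_def by (simp add: mult_ac)
      moreover have "c1 * k powr (real DIM('a) - 2 - 2 * s) \<le> d1 * k powr (real DIM('a) - 2 - 2 * s)"
        using c1 by (intro mult_right_mono) auto
      ultimately show ?thesis by linarith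
    qed
    moreover have "Im L \<le> - c1 * (jbracket (a - b) powr - s / k)" if k1: "1 \<le> k"
    proof -
      define p where "p = ((k + 1/2) / k) *\<^sub>R b"
      have np: "norm p = k + 1/2" using k by (simp add: p_def ab)
      have pb: "norm (p - b) = 1/2"
      proof -
        have "p - b = (1 / (2 * k)) *\<^sub>R b" using k by (simp add: p_def add_divide_distrib scaleR_add_left)
        then show ?thesis using k by (simp add: ab)
      qed
      let ?J = "jbracket (a - b) powr - s"
      have "ennreal (4 powr - s * ?J * V) = (\<integral>\<^sup>+x. ennreal (4 powr - s * ?J) * indicator (ball p (1/2)) x \<partial>lborel)"
      proof -
        have [measurable]: "ball p (1/2) \<in> sets borel" by simp
        show ?thesis using V by (subst nn_integral_cmult) (auto simp: V_eq ennreal_mult'')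
      qed
      also have "\<dots> \<le> (\<integral>\<^sup>+x. ennreal (weight a b x) * indicator {x. norm x \<in> {k..k + 1}} x \<partial>lborel)"
      proof (rule nn_integral_mono)
        fix x :: 'a
        show "ennreal (4 powr - s * ?J) * indicator (ball p (1/2)) x \<le> ennreal (weight a b x) * indicator {x. norm x \<in> {k..k + 1}} x"
        proof (cases "x \<in> ball p (1/2)")
          case True
          then have xp: "norm (x - p) < 1/2" by (simp add: dist_norm norm_minus_commute)
          have nx: "norm x \<in> {k..k + 1}"
            using norm_triangle_ineq2[of x p] norm_triangle_ineq2[of p x] xp np by (auto simp: norm_minus_commute)
          have xb: "norm (x - b) \<le> 1" using norm_triangle_ineq[of "x - p" "p - b"] xp pb by simp
          have "jbracket (x - b) \<le> 2 * jbracket (0::'a)" by (rule jbracket_shift) (use xb in \<open>simp add: norm_minus_commute\<close>)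
          then have "jbracket (x - b) \<le> 2" by (simp add: jbracket_eq)
          moreover have "jbracket (a - x) \<le> 2 * jbracket (a - b)" by (rule jbracket_shift) (use xb in simp)
          ultimately have "(2 * jbracket (a - b)) powr - s * 2 powr - s \<le> weight a b x"
            unfolding weight_def using s_pos by (intro mult_mono powr_mono2') auto
          moreover have "(2 * jbracket (a - b)) powr - s * 2 powr - s = 4 powr - s * ?J"
          proof -
            have "(4::real) powr - s = 2 powr - s * 2 powr - s" by (simp add: powr_mult[symmetric])
            then show ?thesis by (simp add: powr_mult less_imp_le)
          qed
          ultimately show ?thesis using True nx by (simp add: ennreal_leI)
        qed simp
      qed
      also have "\<dots> \<le> ennreal (2 ^ (DIM('a) - 1) * K) * (ennreal (k ^ (DIM('a) - 1)) * sphere_integral (weight a b) k)"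
        by (rule sphere_integral_lower) (use weight_nonneg weight_slow K k1 in \<open>auto simp: K_def\<close>)
      finally have 1: "ennreal (4 powr - s * ?J * V) \<le> ennreal (2 ^ (DIM('a) - 1) * K) * (ennreal (k ^ (DIM('a) - 1)) * sphere_integral (weight a b) k)" .
      have 2: "ennreal (c\<^sup>2) * sphere_integral (weight a b) k \<le> ennreal S"
      proof -
        have "ennreal (c\<^sup>2) * sphere_integral (weight a b) k = (\<integral>\<^sup>+\<omega>. ennreal (c\<^sup>2 * weight a b (k *\<^sub>R \<omega>)) \<partial>surface_measure)"
          by (subst nn_integral_cmult[symmetric]) (auto simp: ennreal_mult'[symmetric])
        also have "\<dots> \<le> sphere_integral (product a b) k"
          by (intro nn_integral_mono ennreal_leI product_lower)
        finally show ?thesis unfolding S(2) .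
      qed
      define Z where "Z = 2 ^ (DIM('a) - 1) * K * k ^ (DIM('a) - 1)"
      have Z: "0 < Z" using K k by (simp add: Z_def)
      have "ennreal (c\<^sup>2 * (4 powr - s * ?J * V)) = ennreal (c\<^sup>2) * ennreal (4 powr - s * ?J * V)" by (simp add: ennreal_mult')
      also have "\<dots> \<le> ennreal (c\<^sup>2) * (ennreal Z * sphere_integral (weight a b) k)"
        using 1 K k by (intro mult_left_mono) (auto simp: Z_def ennreal_mult' mult.assoc)
      also have "\<dots> = ennreal Z * (ennreal (c\<^sup>2) * sphere_integral (weight a b) k)" by (simp only: mult_ac)
      also have "\<dots> \<le> ennreal Z * ennreal S" by (intro mult_left_mono 2) simp
      also have "\<dots> = ennreal (Z * S)" using Z S by (simp add: ennreal_mult')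
      finally have "c\<^sup>2 * (4 powr - s * ?J * V) \<le> Z * S" using Z S by (simp add: ennreal_le_iff)
      also have "Z * S = (2 ^ (DIM('a) - 1) * K * k) * (S * k ^ (DIM('a) - 2))"
      proof -
        have "DIM('a) - 1 = Suc (DIM('a) - 2)" using dim by simp
        then have "k ^ (DIM('a) - 1) = k * k ^ (DIM('a) - 2)" by simp
        then show ?thesis by (simp add: Z_def mult_ac)
      qed
      finally have "c\<^sup>2 * (4 powr - s * V / (2 ^ (DIM('a) - 1) * K)) * (?J / k) \<le> S * k ^ (DIM('a) - 2)"
        using K k by (simp add: field_simps)
      then have "pi / 2 * (c\<^sup>2 * (4 powr - s * V / (2 ^ (DIM('a) - 1) * K)) * (?J / k)) \<le> pi / 2 * (S * k ^ (DIM('a) - 2))"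
        by (intro mult_left_mono) auto
      then have "d2 * (?J / k) \<le> - Im L" unfolding L(2) d2_def by (simp add: mult_ac)
      moreover have "c1 * (?J / k) \<le> d2 * (?J / k)" using c1 k by (intro mult_right_mono) auto
      ultimately show ?thesis by linarith
    qed
    ultimately show ?thesis using L(1) by blast
  qed
  show ?thesis using main C1 c1(1) by blast
qed

end

section \<open>The double dispersion operators\<close>

text \<open>The lower bound for \<open>k\<close> is the Cauchy-Schwarz inequality for \<open>\<theta> \<bullet> \<eta>\<close>, and \<open>|\<eta> + k \<theta>| = k\<close> is
  the defining property of \<open>k\<close>.\<close>

lemma wave_number_bounds:
  fixes \<theta> \<eta> :: "'a::euclidean_space"
  assumes th: "norm \<theta> = 1" and eta: "\<eta> \<in> half_space \<theta>"
  shows "0 < wave_number \<eta> \<theta>" "norm \<eta> / 2 \<le> wave_number \<eta> \<theta>"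
    and "norm (wave_number \<eta> \<theta> *\<^sub>R out_direction \<eta> \<theta>) = wave_number \<eta> \<theta>"
    and "wave_number \<eta> \<theta> *\<^sub>R out_direction \<eta> \<theta> - wave_number \<eta> \<theta> *\<^sub>R \<theta> = \<eta>"
    and "\<theta> \<bullet> \<eta> \<le> - norm \<eta> / 2 \<Longrightarrow> wave_number \<eta> \<theta> \<le> norm \<eta>"
    and "0 < norm \<eta>"
proof -
  define k where "k = wave_number \<eta> \<theta>"
  define t where "t = - (\<theta> \<bullet> \<eta>)"
  have t: "0 < t" using eta by (simp add: t_def half_space_def inner_commute)
  have "t \<le> norm \<theta> * norm \<eta>" unfolding t_def using Cauchy_Schwarz_ineq2[of \<theta> \<eta>] by linarith
  then have tn: "t \<le> norm \<eta>" using th by simp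
  have n: "0 < norm \<eta>" using t tn by linarith
  have k_eq: "k = (norm \<eta>)\<^sup>2 / (2 * t)" by (simp add: k_def t_def wave_number_def)
  have k: "0 < k" using t n by (simp add: k_eq)
  have "norm \<eta> / 2 * (2 * t) \<le> (norm \<eta>)\<^sup>2" using tn n by (simp add: power2_eq_square mult_left_mono)
  then have "norm \<eta> / 2 \<le> k" using t unfolding k_eq by (simp add: pos_le_divide_eq)
  then show "0 < wave_number \<eta> \<theta>" "norm \<eta> / 2 \<le> wave_number \<eta> \<theta>" "0 < norm \<eta>" using k n unfolding k_def by blast+
  have kt: "k *\<^sub>R out_direction \<eta> \<theta> = \<eta> + k *\<^sub>R \<theta>" using k by (simp add: out_direction_def k_def[symmetric])
  then show "wave_number \<eta> \<theta> *\<^sub>R out_direction \<eta> \<theta> - wave_number \<eta> \<theta> *\<^sub>R \<theta> = \<eta>" by (simp add: k_def)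
  have "(norm (\<eta> + k *\<^sub>R \<theta>))\<^sup>2 = (norm \<eta>)\<^sup>2 - 2 * k * t + k\<^sup>2 * (norm \<theta>)\<^sup>2"
    unfolding power2_norm_eq_inner t_def by (simp add: inner_add_left inner_add_right inner_commute power2_eq_square algebra_simps)
  also have "2 * k * t = (norm \<eta>)\<^sup>2" using t by (simp add: k_eq)
  finally have "(norm (\<eta> + k *\<^sub>R \<theta>))\<^sup>2 = k\<^sup>2" using th by simp
  then have "norm (\<eta> + k *\<^sub>R \<theta>) = k" using k by (simp add: power2_eq_iff_nonneg)
  then show "norm (wave_number \<eta> \<theta> *\<^sub>R out_direction \<eta> \<theta>) = wave_number \<eta> \<theta>" using kt by (simp add: k_def)
  assume "\<theta> \<bullet> \<eta> \<le> - norm \<eta> / 2"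
  then have "norm \<eta> \<le> 2 * t" by (simp add: t_def)
  then have "(norm \<eta>)\<^sup>2 \<le> norm \<eta> * (2 * t)" using n by (simp add: power2_eq_square)
  then have "k \<le> norm \<eta>" using t unfolding k_eq by (simp add: pos_divide_le_eq)
  then show "wave_number \<eta> \<theta> \<le> norm \<eta>" by (simp add: k_def)
qed

context decaying_kernel
begin

definition resolvent_integral :: "'a \<Rightarrow> 'a \<Rightarrow> real \<Rightarrow> complex" where
  "resolvent_integral \<theta> \<eta> \<epsilon> = (let k = wave_number \<eta> \<theta> in
    damped_resolvent (product (k *\<^sub>R out_direction \<eta> \<theta>) (k *\<^sub>R \<theta>)) k \<epsilon>)"

text \<open>As \<open>k \<ge> |\<eta>|/2\<close>, a bound in terms of \<open>1 + 1/k\<close> is one in \<open>\<eta>\<close> alone, uniformly up to the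
  boundary of the half space, where \<open>k\<close> is unbounded. In the cone \<open>\<theta> \<bullet> \<eta> \<le> - |\<eta>|/2\<close> also
  \<open>k \<le> |\<eta>|\<close>, so powers of \<open>k\<close> become powers of \<open>|\<eta>|\<close>.\<close>

theorem B2_bounds:
  "\<exists>C2>0. \<exists>c2>0. \<forall>q. fourier q = (\<lambda>\<xi>. of_real (Q \<xi>)) \<longrightarrow> (\<forall>\<theta> \<eta>. norm \<theta> = 1 \<longrightarrow>
     (\<eta> \<in> half_space \<theta> \<longrightarrow> ((\<lambda>\<epsilon>. resolvent_integral \<theta> \<eta> \<epsilon> / of_real ((2 * pi) ^ DIM('a))) \<longlongrightarrow> B2 \<theta> q \<eta>) (at_right 0)) \<and>
     norm (B2 \<theta> q \<eta>) \<le> C2 * (1 + 1 / norm \<eta>) \<and> Im (B2 \<theta> q \<eta>) \<le> 0 \<and>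
     (2 \<le> norm \<eta> \<longrightarrow> \<theta> \<bullet> \<eta> \<le> - norm \<eta> / 2 \<longrightarrow>
        Im (B2 \<theta> q \<eta>) \<le> - c2 * norm \<eta> powr - (2 * s + 2 - real DIM('a)) \<and> Im (B2 \<theta> q \<eta>) \<le> - c2 * norm \<eta> powr - (1 + s)))"
  (is "\<exists>C2>0. \<exists>c2>0. \<forall>q. _ \<longrightarrow> (\<forall>\<theta> \<eta>. _ \<longrightarrow> ?P C2 c2 q \<theta> \<eta>)")
proof -
  obtain C1 c1 where C1: "0 < C1" "0 < c1" and born: "\<And>a b k. 0 < k \<Longrightarrow> norm a = k \<Longrightarrow> norm b = k \<Longrightarrow>
    (\<exists>L. (damped_resolvent (product a b) k \<longlongrightarrow> L) (at_right 0) \<and>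
      norm L \<le> C1 * (1 + 1 / k) \<and> Im L \<le> 0 \<and>
      (1 \<le> k \<longrightarrow> Im L \<le> - c1 * k powr (real DIM('a) - 2 - 2 * s) \<and> Im L \<le> - c1 * (jbracket (a - b) powr - s / k)))"
    using born_limit by blast
  define N where "N = (2 * pi) ^ DIM('a)"
  have N: "0 < N" by (simp add: N_def)
  define C2 where "C2 = 2 * C1 / N"
  define c2 where "c2 = c1 * 2 powr - s / N"
  have C2: "0 < C2" "0 < c2" using C1 N by (auto simp: C2_def c2_def)
  have main: "?P C2 c2 q \<theta> \<eta>"
    if q: "fourier q = (\<lambda>\<xi>. of_real (Q \<xi>))" and th: "norm \<theta> = 1" for q and \<theta> \<eta> :: 'a
  proof (cases "\<eta> \<in> half_space \<theta>")
    case False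
    then have B: "B2 \<theta> q \<eta> = 0" by (simp add: B2_def)
    have "\<not> (2 \<le> norm \<eta> \<and> \<theta> \<bullet> \<eta> \<le> - norm \<eta> / 2)" using False by (auto simp: half_space_def inner_commute)
    then show ?thesis using False B C2 by auto
  next
    case True
    define k where "k = wave_number \<eta> \<theta>"
    define a where "a = k *\<^sub>R out_direction \<eta> \<theta>"
    define b where "b = k *\<^sub>R \<theta>"
    note wb = wave_number_bounds[OF th True, folded k_def]
    have k: "0 < k" by (rule wb)
    have ab: "norm a = k" "norm b = k" "a - b = \<eta>" using wb(3,4) k th by (auto simp: a_def b_def)
    obtain L where L: "(damped_resolvent (product a b) k \<longlongrightarrow> L) (at_right 0)"
      "norm L \<le> C1 * (1 + 1 / k)" "Im L \<le> 0"
      "1 \<le> k \<Longrightarrow> Im L \<le> - c1 * k powr (real DIM('a) - 2 - 2 * s)"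
      "1 \<le> k \<Longrightarrow> Im L \<le> - c1 * (jbracket \<eta> powr - s / k)"
      using born[OF k ab(1,2)] unfolding ab(3) by blast
    have RI: "resolvent_integral \<theta> \<eta> = damped_resolvent (product a b) k"
      by (rule ext) (simp add: resolvent_integral_def a_def b_def k_def Let_def)
    have "B2 \<theta> q \<eta> = Lim (at_right 0) (damped_resolvent (product a b) k) / of_real N"
      using True unfolding B2_def q N_def
      by (simp add: Let_def k_def[symmetric] a_def b_def product_def damped_resolvent_def[abs_def])
    also have "Lim (at_right 0) (damped_resolvent (product a b) k) = L"
      by (rule tendsto_Lim[OF _ L(1)]) simp
    finally have B: "B2 \<theta> q \<eta> = L / of_real N" .
    have lim: "((\<lambda>\<epsilon>. resolvent_integral \<theta> \<eta> \<epsilon> / of_real ((2 * pi) ^ DIM('a))) \<longlongrightarrow> B2 \<theta> q \<eta>) (at_right 0)"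
      unfolding B RI N_def[symmetric] using N by (intro tendsto_divide L(1) tendsto_const) auto
    have n: "0 < norm \<eta>" by (rule wb)
    have "norm (B2 \<theta> q \<eta>) = norm L / N" using N by (simp add: B norm_divide)
    also have "\<dots> \<le> C1 * (1 + 1 / k) / N" using N L(2) by (intro divide_right_mono) auto
    also have "\<dots> \<le> C1 * (2 * (1 + 1 / norm \<eta>)) / N"
    proof -
      have "1 / k \<le> 1 / (norm \<eta> / 2)" using wb(2) n k by (intro divide_left_mono) auto
      then have "1 + 1 / k \<le> 2 * (1 + 1 / norm \<eta>)" by simp
      then show ?thesis using C1 N by (intro divide_right_mono mult_left_mono) auto
    qed
    finally have norm: "norm (B2 \<theta> q \<eta>) \<le> C2 * (1 + 1 / norm \<eta>)" by (simp add: C2_def algebra_simps)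
    have Im: "Im (B2 \<theta> q \<eta>) = Im L / N" using N by (simp add: B)
    have "Im (B2 \<theta> q \<eta>) \<le> - c2 * norm \<eta> powr - (2 * s + 2 - real DIM('a)) \<and> Im (B2 \<theta> q \<eta>) \<le> - c2 * norm \<eta> powr - (1 + s)"
      if eta: "2 \<le> norm \<eta>" "\<theta> \<bullet> \<eta> \<le> - norm \<eta> / 2"
    proof -
      have k1: "1 \<le> k" using wb(2) eta(1) by linarith
      have kn: "k \<le> norm \<eta>" by (rule wb(5)[OF eta(2)])
      have le1: "2 powr - s \<le> (1::real)" using s_pos powr_mono2'[of "- s" 1 2] by simp
      have "c1 * 2 powr - s * norm \<eta> powr - (2 * s + 2 - real DIM('a)) \<le> c1 * 1 * k powr - (2 * s + 2 - real DIM('a))"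
      proof (intro mult_mono)
        show "norm \<eta> powr - (2 * s + 2 - real DIM('a)) \<le> k powr - (2 * s + 2 - real DIM('a))"
          using s k kn by (intro powr_mono2') auto
      qed (use C1 le1 in auto)
      moreover have "real DIM('a) - 2 - 2 * s = - (2 * s + 2 - real DIM('a))" by simp
      then have "Im L \<le> - c1 * k powr - (2 * s + 2 - real DIM('a))" using L(4)[OF k1] by metis
      ultimately have 1: "c1 * 2 powr - s * norm \<eta> powr - (2 * s + 2 - real DIM('a)) \<le> - Im L"
        by linarith
      have "c1 * (2 powr - s * norm \<eta> powr - (1 + s)) \<le> c1 * (jbracket \<eta> powr - s / k)"
      proof (intro mult_left_mono)
        have "jbracket \<eta> \<le> 2 * norm \<eta>" using jbracket_le[of \<eta>] eta by linarith
        then have "(2 * norm \<eta>) powr - s \<le> jbracket \<eta> powr - s" using s_pos by (intro powr_mono2') auto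
        then have "(2 * norm \<eta>) powr - s / norm \<eta> \<le> jbracket \<eta> powr - s / k"
          using kn k by (intro frac_le) auto
        moreover have "(2 * norm \<eta>) powr - s / norm \<eta> = 2 powr - s * norm \<eta> powr - (1 + s)"
        proof -
          have "norm \<eta> powr - (1 + s) = norm \<eta> powr - s * norm \<eta> powr - 1" 
          proof -
            have "- (1 + s) = - s + - 1" by simp
            then show ?thesis by (simp only: powr_add)
          qed
          also have "norm \<eta> powr - 1 = 1 / norm \<eta>" using n by (simp add: powr_minus_divide)
          finally show ?thesis by (simp add: powr_mult)
        qed
        ultimately show "2 powr - s * norm \<eta> powr - (1 + s) \<le> jbracket \<eta> powr - s / k" by simp
      qed (use C1 in simp)
      then have 2: "c1 * (2 powr - s * norm \<eta> powr - (1 + s)) \<le> - Im L" using L(5)[OF k1] by simp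
      show ?thesis unfolding Im c2_def using 1 2 N by (simp add: field_simps)
    qed
    moreover have "Im (B2 \<theta> q \<eta>) \<le> 0" unfolding Im using N L(3) by (simp add: divide_nonpos_pos)
    ultimately show ?thesis using lim norm by blast
  qed
  show ?thesis using main C2 by blast
qed

text \<open>The limit is taken along \<open>\<epsilon> = 1/(i + 1)\<close>, which exhibits it as a pointwise limit of
  measurable functions. Only unit vectors \<open>\<theta>\<close> are considered because the existence of the
  limit is known for these.\<close>

lemma B2_measurable:
  assumes q: "fourier q = (\<lambda>\<xi>. of_real (Q \<xi>))"
  shows "(\<lambda>p. if norm (fst p) = 1 then B2 (fst p) q (snd p) else 0) \<in> borel_measurable (borel \<Otimes>\<^sub>M borel)"
proof (rule borel_measurable_LIMSEQ_metric)
  let ?h = "\<lambda>i p. if norm (fst p) = 1 \<and> snd p \<bullet> fst p < 0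
     then resolvent_integral (fst p) (snd p) (1 / real (Suc i)) / of_real ((2 * pi) ^ DIM('a)) else 0"
  have [measurable]: "(\<lambda>p. resolvent_integral (fst p) (snd p) \<epsilon>) \<in> borel_measurable (borel \<Otimes>\<^sub>M borel)" for \<epsilon>
    unfolding resolvent_integral_def damped_resolvent_def Let_def product_def wave_number_def out_direction_def by measurable
  show "?h i \<in> borel_measurable (borel \<Otimes>\<^sub>M borel)" for i by measurable
  fix p :: "'a \<times> 'a"
  show "(\<lambda>i. ?h i p) \<longlonglongrightarrow> (if norm (fst p) = 1 then B2 (fst p) q (snd p) else 0)"
  proof (cases "norm (fst p) = 1 \<and> snd p \<bullet> fst p < 0")
    case True
    have fl: "filterlim (\<lambda>i. 1 / real (Suc i)) (at_right 0) sequentially"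
      unfolding filterlim_at using LIMSEQ_inverse_real_of_nat by (simp add: inverse_eq_divide)
    have "((\<lambda>\<epsilon>. resolvent_integral (fst p) (snd p) \<epsilon> / of_real ((2 * pi) ^ DIM('a))) \<longlongrightarrow> B2 (fst p) q (snd p)) (at_right 0)"
      using B2_bounds q True by (auto simp: half_space_def)
    from filterlim_compose[OF this fl] show ?thesis using True by simp
  next
    case False
    then show ?thesis by (auto simp: B2_def half_space_def)
  qed
qed

text \<open>For \<open>s = \<beta> + n/2\<close> this is \<open>\<alpha>\<^sub>0 + n/2\<close>.\<close>

definition decay_exponent :: real where
  "decay_exponent = min (1 + s) (2 * s + 2 - real DIM('a))"

text \<open>The contributions of \<open>\<theta>\<close> and \<open>-\<theta>\<close> have the same sign, so one of them may be dropped from a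
  lower bound for the size.\<close>

theorem Q_fixed_hat_bounds:
  assumes q: "fourier q = (\<lambda>\<xi>. of_real (Q \<xi>))"
  shows "\<exists>C3>0. \<exists>c3>0. (\<forall>\<theta> \<eta>. norm \<theta> = 1 \<longrightarrow> norm (Q_fixed_hat \<theta> q \<eta>) \<le> C3 * (1 + 1 / norm \<eta>) \<and> Im (Q_fixed_hat \<theta> q \<eta>) \<le> 0 \<and>
     (2 \<le> norm \<eta> \<longrightarrow> norm \<eta> / 2 \<le> \<bar>\<theta> \<bullet> \<eta>\<bar> \<longrightarrow> Im (Q_fixed_hat \<theta> q \<eta>) \<le> - c3 * norm \<eta> powr - decay_exponent))"
proof -
  obtain C2 c2 where C2: "0 < C2" "0 < c2" and B: "\<And>\<theta> \<eta>. norm \<theta> = 1 \<Longrightarrow> norm (B2 \<theta> q \<eta>) \<le> C2 * (1 + 1 / norm \<eta>)"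
    "\<And>\<theta> \<eta>. norm \<theta> = 1 \<Longrightarrow> Im (B2 \<theta> q \<eta>) \<le> 0"
    "\<And>\<theta> \<eta>. norm \<theta> = 1 \<Longrightarrow> 2 \<le> norm \<eta> \<Longrightarrow> \<theta> \<bullet> \<eta> \<le> - norm \<eta> / 2 \<Longrightarrow>
        Im (B2 \<theta> q \<eta>) \<le> - c2 * norm \<eta> powr - (2 * s + 2 - real DIM('a)) \<and> Im (B2 \<theta> q \<eta>) \<le> - c2 * norm \<eta> powr - (1 + s)"
    using B2_bounds q by (metis (no_types, lifting))
  have low: "Im (B2 \<theta> q \<eta>) \<le> - c2 * norm \<eta> powr - decay_exponent"
    if "norm \<theta> = 1" "2 \<le> norm \<eta>" "\<theta> \<bullet> \<eta> \<le> - norm \<eta> / 2" for \<theta> \<eta>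
    using B(3)[OF that] unfolding decay_exponent_def min_def by auto
  have "norm (Q_fixed_hat \<theta> q \<eta>) \<le> (2 * C2) * (1 + 1 / norm \<eta>)" if "norm \<theta> = 1" for \<theta> \<eta>
    unfolding Q_fixed_hat_def
    by (rule order_trans[OF norm_triangle_ineq]) (use B(1)[OF that, of \<eta>] B(1)[of "- \<theta>" \<eta>] that in simp)
  moreover have "Im (Q_fixed_hat \<theta> q \<eta>) \<le> 0" if "norm \<theta> = 1" for \<theta> \<eta>
    unfolding Q_fixed_hat_def using B(2)[OF that, of \<eta>] B(2)[of "- \<theta>" \<eta>] that by simp
  moreover have "Im (Q_fixed_hat \<theta> q \<eta>) \<le> - c2 * norm \<eta> powr - decay_exponent"
    if "norm \<theta> = 1" "2 \<le> norm \<eta>" "norm \<eta> / 2 \<le> \<bar>\<theta> \<bullet> \<eta>\<bar>" for \<theta> \<eta>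
  proof (cases "\<theta> \<bullet> \<eta> \<le> 0")
    case True
    then have "\<theta> \<bullet> \<eta> \<le> - norm \<eta> / 2" using that by simp
    from low[OF that(1,2) this] show ?thesis unfolding Q_fixed_hat_def using B(2)[of "- \<theta>" \<eta>] that by simp
  next
    case False
    then have "(- \<theta>) \<bullet> \<eta> \<le> - norm \<eta> / 2" using that by simp
    from low[of "- \<theta>", OF _ that(2) this] show ?thesis unfolding Q_fixed_hat_def using B(2)[of \<theta> \<eta>] that by simp
  qed
  ultimately show ?thesis using C2 by (intro exI[of _ "2 * C2"] conjI exI[of _ c2]) auto
qed

lemma Q_fixed_hat_measurable:
  assumes q: "fourier q = (\<lambda>\<xi>. of_real (Q \<xi>))"
  shows "(\<lambda>p. indicator (sphere 0 1) (fst p) *\<^sub>R Q_fixed_hat (fst p) q (snd p)) \<in> borel_measurable (borel \<Otimes>\<^sub>M borel)"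
proof -
  note [measurable] = B2_measurable[OF q]
  have [measurable]: "(\<lambda>p. (- fst p, snd p)) \<in> (borel \<Otimes>\<^sub>M borel) \<rightarrow>\<^sub>M ((borel :: 'a measure) \<Otimes>\<^sub>M (borel :: 'a measure))" by measurable
  have "(\<lambda>p. (if norm (fst p) = 1 then B2 (fst p) q (snd p) else 0) + (if norm (fst (- fst p, snd p)) = 1 then B2 (fst (- fst p, snd p)) q (snd (- fst p, snd p)) else 0)) \<in> borel_measurable (borel \<Otimes>\<^sub>M borel)"
    by (rule borel_measurable_add[OF B2_measurable[OF q]]) (rule measurable_compose[OF _ B2_measurable[OF q]], measurable)
  also have "(\<lambda>p. (if norm (fst p) = 1 then B2 (fst p) q (snd p) else 0) + (if norm (fst (- fst p, snd p)) = 1 then B2 (fst (- fst p, snd p)) q (snd (- fst p, snd p)) else 0))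
     = (\<lambda>p. indicator (sphere 0 1) (fst p) *\<^sub>R Q_fixed_hat (fst p) q (snd p))"
    by (auto simp: Q_fixed_hat_def fun_eq_iff split: split_indicator)
  finally show ?thesis .
qed

lemma Q_fixed_hat_measurable_fixed:
  assumes q: "fourier q = (\<lambda>\<xi>. of_real (Q \<xi>))" and th: "norm \<theta> = 1"
  shows "Q_fixed_hat \<theta> q \<in> borel_measurable borel"
proof -
  have "(\<lambda>\<eta>. (\<lambda>p. indicator (sphere 0 1) (fst p) *\<^sub>R Q_fixed_hat (fst p) q (snd p)) (\<theta>, \<eta>)) \<in> borel_measurable borel"
    by (rule measurable_compose[OF _ Q_fixed_hat_measurable[OF q]]) measurable
  then show ?thesis using th by simp
qed

lemma Q_full_hat_measurable:
  assumes q: "fourier q = (\<lambda>\<xi>. of_real (Q \<xi>))"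
  shows "Q_full_hat q \<in> borel_measurable borel"
proof -
  interpret surf: finite_measure "surface_measure :: 'a measure" by (rule finite_surface_measure)
  have "(\<lambda>p. indicator (sphere 0 1) (snd p) *\<^sub>R Q_fixed_hat (snd p) q (fst p)) \<in> borel_measurable (borel \<Otimes>\<^sub>M (surface_measure :: 'a measure))"
  proof -
    have "(\<lambda>p. (snd p, fst p)) \<in> (borel \<Otimes>\<^sub>M (surface_measure :: 'a measure)) \<rightarrow>\<^sub>M ((borel :: 'a measure) \<Otimes>\<^sub>M (borel :: 'a measure))" by measurable
    from measurable_compose[OF this Q_fixed_hat_measurable[OF q]] show ?thesis by simp
  qed
  then have "(\<lambda>\<eta>. LINT \<theta>|(surface_measure :: 'a measure). indicator (sphere 0 1) \<theta> *\<^sub>R Q_fixed_hat \<theta> q \<eta>) \<in> borel_measurable borel"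
    by (intro surf.borel_measurable_lebesgue_integral) (simp add: case_prod_beta')
  then show ?thesis unfolding Q_full_hat_def set_lebesgue_integral_def by measurable
qed

text \<open>The cone over the cap contains a small ball around \<open>e/2\<close>.\<close>

lemma surface_measure_cap_pos:
  fixes e :: 'a
  assumes e: "norm e = 1"
  shows "0 < measure (surface_measure :: 'a measure) {\<theta>. norm (\<theta> - e) < 1 / 4}"
proof -
  interpret surf: finite_measure "surface_measure :: 'a measure" by (rule finite_surface_measure)
  let ?A = "{\<theta>::'a. norm (\<theta> - e) < 1 / 4}" and ?B = "ball ((1 / 2) *\<^sub>R e) (1 / 32)"
  have "ennreal (real DIM('a)) * emeasure lborel ?B = ennreal (real DIM('a)) * (\<integral>\<^sup>+x. indicator ?B x \<partial>lborel)" by simp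
  also have "\<dots> \<le> ennreal (real DIM('a)) * (\<integral>\<^sup>+x. indicator ?A (sgn x) * indicator (ball 0 1) x \<partial>lborel)"
  proof (intro mult_left_mono nn_integral_mono)
    fix x :: 'a
    show "indicator ?B x \<le> (indicator ?A (sgn x) * indicator (ball 0 1) x :: ennreal)"
    proof (cases "x \<in> ?B")
      case True
      then have d: "norm (x - (1 / 2) *\<^sub>R e) < 1 / 32" by (simp add: dist_norm norm_minus_commute)
      have ne: "norm ((1 / 2) *\<^sub>R e) = 1 / 2" using e by simp
      have n: "\<bar>norm x - 1 / 2\<bar> < 1 / 32" using norm_triangle_ineq3[of x "(1 / 2) *\<^sub>R e"] d ne by linarith
      then have nx: "15 / 32 < norm x" "norm x < 1" by (auto simp: abs_if split: if_splits)
      have "x - norm x *\<^sub>R e = (x - (1 / 2) *\<^sub>R e) + (1 / 2 - norm x) *\<^sub>R e" by (simp add: algebra_simps)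
      then have "norm (x - norm x *\<^sub>R e) \<le> norm (x - (1 / 2) *\<^sub>R e) + norm ((1 / 2 - norm x) *\<^sub>R e)"
        by (metis norm_triangle_ineq)
      then have "norm (x - norm x *\<^sub>R e) < 1 / 16" using d n e by (simp add: abs_minus_commute)
      moreover have "x \<noteq> 0" using nx by auto
      then have "norm x *\<^sub>R (sgn x - e) = x - norm x *\<^sub>R e" by (simp add: scaleR_diff_right sgn_div_norm)
      then have "norm x * norm (sgn x - e) = norm (x - norm x *\<^sub>R e)" by (metis norm_scaleR abs_norm_cancel)
      ultimately have "norm x * norm (sgn x - e) < norm x * (1 / 4)" using nx by linarith
      then have "norm (sgn x - e) < 1 / 4" using nx by (simp only: mult_less_cancel_left_pos)
      then have "indicator ?A (sgn x) * indicator (ball 0 1) x = (1 :: ennreal)" using nx by simp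
      then show ?thesis by (simp only:) (auto split: split_indicator)
    qed simp
  qed simp
  also have "\<dots> = (\<integral>\<^sup>+\<theta>. indicator ?A \<theta> \<partial>surface_measure)" by (subst nn_integral_surface_measure) auto
  also have "\<dots> = emeasure surface_measure ?A" by (rule nn_integral_indicator) simp
  finally have le: "ennreal (real DIM('a)) * emeasure lborel ?B \<le> emeasure surface_measure ?A" .
  have "0 < emeasure lborel ?B" using content_ball_pos[of "1 / 32" "(1 / 2) *\<^sub>R e"] by (auto simp: measure_def zero_less_iff_neq_zero)
  then have "0 < emeasure surface_measure ?A" using le by (metis DIM_positive ennreal_less_zero_iff ennreal_zero_less_mult_iff of_nat_0_less_iff order_less_le_trans)
  then show ?thesis by (simp add: surf.emeasure_eq_measure)
qed

lemma cap_inner_lower: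
  fixes e \<theta> \<eta> :: 'a
  assumes "norm e = 1" "norm (\<theta> - e) < 1 / 4" "norm \<theta> = 1" "norm (\<eta> - norm \<eta> *\<^sub>R e) \<le> norm \<eta> / 8"
  shows "norm \<eta> / 2 \<le> \<theta> \<bullet> \<eta>"
proof -
  have "e \<bullet> e = 1" using assms(1) by (simp add: norm_eq_1)
  then have "\<theta> \<bullet> \<eta> = norm \<eta> + norm \<eta> * ((\<theta> - e) \<bullet> e) + \<theta> \<bullet> (\<eta> - norm \<eta> *\<^sub>R e)"
    by (simp add: inner_diff_left inner_diff_right algebra_simps)
  moreover have "\<bar>(\<theta> - e) \<bullet> e\<bar> \<le> 1 / 4" using Cauchy_Schwarz_ineq2[of "\<theta> - e" e] assms by simp
  then have "norm \<eta> * (- 1 / 4) \<le> norm \<eta> * ((\<theta> - e) \<bullet> e)" by (intro mult_left_mono) auto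
  moreover have "\<bar>\<theta> \<bullet> (\<eta> - norm \<eta> *\<^sub>R e)\<bar> \<le> norm \<eta> / 8" using Cauchy_Schwarz_ineq2[of \<theta> "\<eta> - norm \<eta> *\<^sub>R e"] assms by simp
  moreover have "0 \<le> norm \<eta>" by simp
  ultimately show ?thesis by linarith
qed

text \<open>Every direction contributes with the same sign, and the directions in a fixed cap
  around \<open>e\<close> all obey the lower bound of \<open>Q_fixed_hat_bounds\<close>, simultaneously for all \<open>\<eta>\<close> in a
  cone around \<open>e\<close>.\<close>

theorem Q_full_hat_bounds:
  assumes q: "fourier q = (\<lambda>\<xi>. of_real (Q \<xi>))" and e: "norm e = 1"
  shows "\<exists>C3>0. \<exists>c3>0. (\<forall>\<eta>. norm (Q_full_hat q \<eta>) \<le> C3 * (1 + 1 / norm \<eta>) \<and> Im (Q_full_hat q \<eta>) \<le> 0 \<and>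
     (2 \<le> norm \<eta> \<longrightarrow> norm (\<eta> - norm \<eta> *\<^sub>R e) \<le> norm \<eta> / 8 \<longrightarrow> Im (Q_full_hat q \<eta>) \<le> - c3 * norm \<eta> powr - decay_exponent))"
proof -
  interpret surf: finite_measure "surface_measure :: 'a measure" by (rule finite_surface_measure)
  obtain C3 c3 where C3: "0 < C3" "0 < c3" and Qf: "\<And>\<theta> \<eta>. norm \<theta> = 1 \<Longrightarrow> norm (Q_fixed_hat \<theta> q \<eta>) \<le> C3 * (1 + 1 / norm \<eta>)"
     "\<And>\<theta> \<eta>. norm \<theta> = 1 \<Longrightarrow> Im (Q_fixed_hat \<theta> q \<eta>) \<le> 0"
     "\<And>\<theta> \<eta>. norm \<theta> = 1 \<Longrightarrow> 2 \<le> norm \<eta> \<Longrightarrow> norm \<eta> / 2 \<le> \<bar>\<theta> \<bullet> \<eta>\<bar> \<Longrightarrow> Im (Q_fixed_hat \<theta> q \<eta>) \<le> - c3 * norm \<eta> powr - decay_exponent"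
    using Q_fixed_hat_bounds[OF q] by (metis (no_types, lifting))
  define \<sigma> where "\<sigma> = measure (surface_measure :: 'a measure) UNIV"
  have \<sigma>: "0 < \<sigma>" using surface_pos by (simp add: \<sigma>_def)
  have sph: "measure (surface_measure :: 'a measure) (sphere 0 1) = \<sigma>"
    unfolding \<sigma>_def by (rule measure_eq_AE) (use AE_surface_measure_sphere in \<open>auto elim!: eventually_mono\<close>)
  define A where "A = {\<theta>::'a. norm (\<theta> - e) < 1 / 4}"
  have A_meas [measurable]: "A \<in> sets borel" unfolding A_def by measurable
  define d where "d = measure (surface_measure :: 'a measure) A"
  have d: "0 < d" using surface_measure_cap_pos[OF e] by (simp add: d_def A_def)
  let ?g = "\<lambda>\<eta> \<theta>. indicator (sphere 0 1) \<theta> *\<^sub>R Q_fixed_hat \<theta> q \<eta>"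
  have gm: "?g \<eta> \<in> borel_measurable surface_measure" for \<eta>
  proof -
    have "(\<lambda>\<theta>. (\<theta>, \<eta>)) \<in> (surface_measure :: 'a measure) \<rightarrow>\<^sub>M ((borel :: 'a measure) \<Otimes>\<^sub>M (borel :: 'a measure))" by measurable
    from measurable_compose[OF this Q_fixed_hat_measurable[OF q]] show ?thesis by simp
  qed
  have gb: "norm (?g \<eta> \<theta>) \<le> C3 * (1 + 1 / norm \<eta>)" for \<eta> \<theta>
  proof -
    have "0 \<le> C3 * (1 + 1 / norm \<eta>)" using C3 by simp
    then show ?thesis using Qf(1)[of \<theta> \<eta>] by (auto split: split_indicator)
  qed
  have gi: "integrable surface_measure (?g \<eta>)" for \<eta>
    by (rule surf.integrable_const_bound[OF _ gm]) (use gb in auto)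
  have full: "Q_full_hat q \<eta> = (LINT \<theta>|surface_measure. ?g \<eta> \<theta>) / of_real \<sigma>" for \<eta>
    unfolding Q_full_hat_def set_lebesgue_integral_def sph ..
  have Imf: "Im (Q_full_hat q \<eta>) = (LINT \<theta>|surface_measure. Im (?g \<eta> \<theta>)) / \<sigma>" for \<eta>
    unfolding full integral_Im[OF gi] using \<sigma> by simp
  have Im_g: "Im (?g \<eta> \<theta>) \<le> 0" for \<eta> \<theta> using Qf(2)[of \<theta> \<eta>] by (auto split: split_indicator)
  have "norm (Q_full_hat q \<eta>) \<le> C3 * (1 + 1 / norm \<eta>)" for \<eta>
  proof -
    have "norm (LINT \<theta>|surface_measure. ?g \<eta> \<theta>) \<le> (LINT \<theta>|(surface_measure::'a measure). C3 * (1 + 1 / norm \<eta>))"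
      by (rule Bochner_Integration.integral_norm_bound_integral[OF gi]) (use gb in auto)
    then show ?thesis unfolding full using \<sigma> by (simp add: norm_divide \<sigma>_def[symmetric] pos_divide_le_eq mult_ac)
  qed
  moreover have "Im (Q_full_hat q \<eta>) \<le> 0" for \<eta>
  proof -
    have "(LINT \<theta>|surface_measure. Im (?g \<eta> \<theta>)) \<le> (LINT \<theta>|(surface_measure::'a measure). 0)"
      by (rule integral_mono) (use integrable_Im[OF gi] Im_g in auto)
    then show ?thesis unfolding Imf using \<sigma> by (simp add: divide_nonpos_pos)
  qed
  moreover have "Im (Q_full_hat q \<eta>) \<le> - (c3 * d / \<sigma>) * norm \<eta> powr - decay_exponent"
    if "2 \<le> norm \<eta>" "norm (\<eta> - norm \<eta> *\<^sub>R e) \<le> norm \<eta> / 8" for \<eta>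
  proof -
    let ?X = "c3 * norm \<eta> powr - decay_exponent"
    have "(LINT \<theta>|surface_measure. Im (?g \<eta> \<theta>)) \<le> (LINT \<theta>|surface_measure. (- ?X) * indicator A \<theta>)"
    proof (rule integral_mono_AE)
      show "integrable surface_measure (\<lambda>\<theta>. Im (?g \<eta> \<theta>))" using gi by (rule integrable_Im)
      show "integrable surface_measure (\<lambda>\<theta>. (- ?X) * indicator A \<theta>)"
        by (intro integrable_mult_right integrable_real_indicator) (auto simp: less_top[symmetric])
      show "AE \<theta> in surface_measure. Im (?g \<eta> \<theta>) \<le> (- ?X) * indicator A \<theta>"
        using AE_surface_measure_sphere
      proof eventually_elim
        fix \<theta> :: 'a assume th: "norm \<theta> = 1"
        show "Im (?g \<eta> \<theta>) \<le> (- ?X) * indicator A \<theta>"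
        proof (cases "\<theta> \<in> A")
          case True
          then have "norm \<eta> / 2 \<le> \<theta> \<bullet> \<eta>" using cap_inner_lower[OF e _ th that(2)] by (simp add: A_def)
          then have "norm \<eta> / 2 \<le> \<bar>\<theta> \<bullet> \<eta>\<bar>" by linarith
          from Qf(3)[OF th that(1) this] show ?thesis using True th by simp
        qed (use Im_g in simp)
      qed
    qed
    also have "\<dots> = - ?X * d" unfolding d_def by simp
    finally have "(LINT \<theta>|surface_measure. Im (?g \<eta> \<theta>)) / \<sigma> \<le> - ?X * d / \<sigma>"
      using \<sigma> by (intro divide_right_mono) auto
    then show ?thesis unfolding Imf by (simp add: mult_ac)
  qed
  moreover have "0 < c3 * d / \<sigma>" using C3 d \<sigma> by simp
  ultimately show ?thesis using C3(1) by blast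
qed

end

section \<open>Sobolev regularity\<close>

lemma schwartz_continuous: "\<phi> \<in> schwartz \<Longrightarrow> continuous_on UNIV \<phi>"
proof -
  assume "\<phi> \<in> schwartz"
  then have "\<forall>bs \<in> lists Basis. partial_deriv bs \<phi> differentiable_on UNIV" by (simp add: schwartz_def smooth_def)
  then have "partial_deriv [] \<phi> differentiable_on UNIV" by (rule bspec) simp
  then show ?thesis by (simp add: differentiable_imp_continuous_on)
qed

lemma schwartz_decay:
  fixes \<phi> :: "'a::euclidean_space \<Rightarrow> complex"
  assumes "\<phi> \<in> schwartz" shows "\<exists>B. \<forall>x. jbracket x ^ N * norm (\<phi> x) \<le> B"
proof -
  have "\<forall>bs \<in> lists Basis. \<forall>N::nat. bounded (range (\<lambda>x. of_real (jbracket x ^ N) * partial_deriv bs \<phi> x))"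
    using assms by (simp add: schwartz_def)
  then have "bounded (range (\<lambda>x. of_real (jbracket x ^ N) * partial_deriv [] \<phi> x))" by blast
  then obtain B where "\<And>x. norm (of_real (jbracket x ^ N) * \<phi> x) \<le> B" by (auto simp: bounded_iff)
  then have "jbracket x ^ N * norm (\<phi> x) \<le> B" for x
    by (metis abs_of_pos jbracket_pos norm_mult norm_of_real zero_less_power)
  then show ?thesis by blast
qed

lemma norm_le_schwartz_norm:
  fixes \<phi> :: "'a::euclidean_space \<Rightarrow> complex"
  assumes "\<phi> \<in> schwartz" shows "norm (\<phi> x) \<le> schwartz_norm 0 \<phi>"
proof -
  obtain B where B: "\<And>x. jbracket x ^ 0 * norm (\<phi> x) \<le> B" using schwartz_decay[OF assms, of 0] by blast
  have "{bs. set bs \<subseteq> (Basis :: 'a set) \<and> length bs \<le> 0} = {[]}" by auto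
  then have "schwartz_norm 0 \<phi> = (SUP x. norm (\<phi> x))" by (simp add: schwartz_norm_def)
  moreover have "norm (\<phi> x) \<le> (SUP x. norm (\<phi> x))"
    by (rule cSUP_upper) (use B in \<open>auto intro!: bdd_aboveI[of _ B]\<close>)
  ultimately show ?thesis by simp
qed

lemma integrable_jbracket_schwartz:
  fixes \<phi> :: "'a::euclidean_space \<Rightarrow> complex"
  assumes "\<phi> \<in> schwartz" shows "integrable lborel (\<lambda>x. of_real (jbracket x powr \<gamma>) * \<phi> x)"
proof -
  define n where "n = real DIM('a) + 1"
  obtain N :: nat where N: "\<gamma> + n \<le> real N" using real_arch_simple by blast
  obtain B where B: "\<And>x. jbracket x ^ N * norm (\<phi> x) \<le> B" using schwartz_decay[OF assms, of N] by blast
  have [measurable]: "\<phi> \<in> borel_measurable borel" by (rule borel_measurable_continuous_onI[OF schwartz_continuous[OF assms]])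
  have "integrable lborel (\<lambda>x::'a. jbracket x powr - (2 * (n / 2)))"
    by (rule integrable_jbracket_powr) (simp add: n_def)
  then have int: "integrable lborel (\<lambda>x::'a. B * jbracket x powr - (2 * (n / 2)))" by (rule integrable_mult_right)
  show ?thesis
  proof (rule Bochner_Integration.integrable_bound[OF int])
    show "AE x in lborel. norm (of_real (jbracket x powr \<gamma>) * \<phi> x) \<le> norm (B * jbracket x powr - (2 * (n / 2)))"
    proof (rule AE_I2)
      fix x :: 'a
      have "jbracket x powr \<gamma> \<le> jbracket x powr (real N + - n)" using N jbracket_ge_1[of x] by (intro powr_mono) auto
      also have "\<dots> = jbracket x ^ N * jbracket x powr - n" by (simp only: powr_add) (simp add: powr_realpow)
      finally have "jbracket x powr \<gamma> * norm (\<phi> x) \<le> (jbracket x ^ N * jbracket x powr - n) * norm (\<phi> x)"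
        by (intro mult_right_mono) auto
      also have "\<dots> = (jbracket x ^ N * norm (\<phi> x)) * jbracket x powr - n" by simp
      also have "\<dots> \<le> B * jbracket x powr - n" by (intro mult_right_mono B) auto
      also have "\<dots> \<le> norm (B * jbracket x powr - (2 * (n / 2)))" by simp
      finally show "norm (of_real (jbracket x powr \<gamma>) * \<phi> x) \<le> norm (B * jbracket x powr - (2 * (n / 2)))"
        by (simp add: norm_mult)
    qed
  qed measurable
qed

lemma character_measurable [measurable]:
  "(\<lambda>x::'a::euclidean_space. exp (- (\<i> * complex_of_real (x \<bullet> \<xi>)))) \<in> borel_measurable borel"
  by (intro borel_measurable_continuous_onI continuous_intros)

lemma fourier_multiplication_formula:
  fixes f g :: "'a::euclidean_space \<Rightarrow> complex"
  assumes f: "integrable lborel f" and g: "integrable lborel g"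
  shows "(LINT x|lborel. f x * fourier g x) = (LINT \<xi>|lborel. fourier f \<xi> * g \<xi>)"
proof -
  note [measurable] = borel_measurable_integrable[OF f] borel_measurable_integrable[OF g]
  let ?F = "\<lambda>x \<xi>. exp (- (\<i> * complex_of_real (x \<bullet> \<xi>))) * f x * g \<xi>"
  have em [measurable]: "(\<lambda>p::'a \<times> 'a. exp (- (\<i> * complex_of_real (fst p \<bullet> snd p)))) \<in> borel_measurable (borel \<Otimes>\<^sub>M borel)"
    unfolding borel_prod by (intro borel_measurable_continuous_onI continuous_intros)
  have int: "integrable (lborel \<Otimes>\<^sub>M lborel) (\<lambda>(x, \<xi>). ?F x \<xi>)"
  proof (rule lborel_pair.Fubini_integrable)
    show "integrable lborel (\<lambda>x. LINT \<xi>|lborel. norm (case (x, \<xi>) of (x, \<xi>) \<Rightarrow> ?F x \<xi>))"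
      using f by (simp add: norm_mult)
    show "AE x in lborel. integrable lborel (\<lambda>\<xi>. case (x, \<xi>) of (x, \<xi>) \<Rightarrow> ?F x \<xi>)"
    proof (rule AE_I2)
      fix x :: 'a
      have "integrable lborel (\<lambda>\<xi>. (exp (- (\<i> * complex_of_real (\<xi> \<bullet> x))) * f x) * g \<xi>)"
        by (rule integrable_bounded_mult[where L = "norm (f x)", OF _ _ g]) (measurable, simp add: norm_mult)
      then show "integrable lborel (\<lambda>\<xi>. case (x, \<xi>) of (x, \<xi>) \<Rightarrow> ?F x \<xi>)" by (simp add: inner_commute)
    qed
    have "(\<lambda>p. exp (- (\<i> * complex_of_real (fst p \<bullet> snd p))) * f (fst p) * g (snd p)) \<in> borel_measurable (lborel \<Otimes>\<^sub>M (lborel :: 'a measure))"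
      using em by measurable
    then show "(\<lambda>(x, \<xi>). ?F x \<xi>) \<in> borel_measurable (lborel \<Otimes>\<^sub>M (lborel :: 'a measure))" by (simp add: case_prod_beta')
  qed
  have "(LINT x|lborel. f x * fourier g x) = (LINT x|lborel. LINT \<xi>|lborel. ?F x \<xi>)"
  proof (rule Bochner_Integration.integral_cong)
    fix x :: 'a
    have "f x * fourier g x = (LINT \<xi>|lborel. f x * (exp (- (\<i> * complex_of_real (\<xi> \<bullet> x))) * g \<xi>))"
      unfolding fourier_def by (rule integral_mult_right_zero[symmetric])
    also have "\<dots> = (LINT \<xi>|lborel. ?F x \<xi>)" by (simp add: inner_commute mult_ac)
    finally show "f x * fourier g x = (LINT \<xi>|lborel. ?F x \<xi>)" .
  qed simp
  also have "\<dots> = (LINT \<xi>|lborel. LINT x|lborel. ?F x \<xi>)" by (rule lborel_pair.Fubini_integral[OF int, symmetric])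
  also have "\<dots> = (LINT \<xi>|lborel. fourier f \<xi> * g \<xi>)" unfolding fourier_def by (simp only: integral_mult_left_zero)
  finally show ?thesis .
qed

text \<open>By the multiplication formula the weighted Fourier transform is the function
  \<open>G \<xi> * jbracket \<xi> powr \<gamma>\<close>, which is square integrable since \<open>2 (s - \<gamma>) > n\<close>.\<close>

theorem sobolev_fun_of_fourier_decay:
  fixes g :: "'a::euclidean_space \<Rightarrow> real"
  assumes g: "integrable lborel g" and G: "fourier (\<lambda>x. of_real (g x)) = (\<lambda>\<xi>. of_real (G \<xi>))"
    and [measurable]: "G \<in> borel_measurable borel" and dec: "\<And>\<xi>. \<bar>G \<xi>\<bar> \<le> C * jbracket \<xi> powr - s"
    and \<gamma>: "\<gamma> < s - real DIM('a) / 2"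
  shows "(\<lambda>x. complex_of_real (g x)) \<in> sobolev_fun \<gamma>"
proof -
  let ?f = "\<lambda>x. complex_of_real (g x)"
  have f: "integrable lborel ?f" using g by simp
  have bd: "integrable lborel (\<lambda>x. ?f x * \<phi> x)" if "\<phi> \<in> schwartz" for \<phi>
  proof -
    have "integrable lborel (\<lambda>x. \<phi> x * ?f x)"
      by (rule integrable_bounded_mult[OF _ norm_le_schwartz_norm[OF that] f])
         (rule borel_measurable_continuous_onI[OF schwartz_continuous[OF that]])
    then show ?thesis by (simp add: mult.commute)
  qed
  have "fun_dist ?f \<in> tempered_distributions"
    unfolding tempered_distributions_def
  proof (intro CollectI conjI ballI allI)
    fix \<phi> \<psi> :: "'a \<Rightarrow> complex" assume "\<phi> \<in> schwartz" "\<psi> \<in> schwartz"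
    then show "fun_dist ?f (\<lambda>x. \<phi> x + \<psi> x) = fun_dist ?f \<phi> + fun_dist ?f \<psi>"
      unfolding fun_dist_def distrib_left by (intro Bochner_Integration.integral_add bd) auto
  next
    fix c :: complex and \<phi> :: "'a \<Rightarrow> complex" assume "\<phi> \<in> schwartz"
    have "(LINT x|lborel. ?f x * (c * \<phi> x)) = (LINT x|lborel. c * (?f x * \<phi> x))" by (simp add: mult_ac)
    then show "fun_dist ?f (\<lambda>x. c * \<phi> x) = c * fun_dist ?f \<phi>" unfolding fun_dist_def by simp
  next
    show "\<exists>C N. \<forall>\<phi>\<in>schwartz. norm (fun_dist ?f \<phi>) \<le> C * schwartz_norm N \<phi>"
    proof (intro exI ballI)
      fix \<phi> :: "'a \<Rightarrow> complex" assume phi: "\<phi> \<in> schwartz"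
      have "norm (fun_dist ?f \<phi>) \<le> (LINT x|lborel. norm (?f x) * schwartz_norm 0 \<phi>)"
        unfolding fun_dist_def
        by (rule Bochner_Integration.integral_norm_bound_integral[OF bd[OF phi] integrable_mult_left[OF integrable_norm[OF f]]])
           (simp add: norm_mult mult_left_mono norm_le_schwartz_norm[OF phi])
      also have "\<dots> = (LINT x|lborel. norm (?f x)) * schwartz_norm 0 \<phi>" by (rule integral_mult_left_zero)
      finally show "norm (fun_dist ?f \<phi>) \<le> (LINT x|lborel. norm (?f x)) * schwartz_norm 0 \<phi>" .
    qed
  qed
  moreover have "is_L2_dist (mult_dist (\<lambda>\<xi>. of_real (jbracket \<xi> powr \<gamma>)) (fourier_dist (fun_dist ?f)))"
    unfolding is_L2_dist_def
  proof (intro exI conjI ballI)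
    let ?u = "\<lambda>\<xi>. complex_of_real (G \<xi> * jbracket \<xi> powr \<gamma>)"
    show "?u \<in> borel_measurable lborel" by measurable
    show "integrable lborel (\<lambda>x. (norm (?u x))\<^sup>2)"
    proof (rule Bochner_Integration.integrable_bound)
      show "integrable lborel (\<lambda>x::'a. C\<^sup>2 * jbracket x powr - (2 * (s - \<gamma>)))"
        by (intro integrable_mult_right integrable_jbracket_powr) (use \<gamma> in simp)
      show "AE x in lborel. norm ((norm (?u x))\<^sup>2) \<le> norm (C\<^sup>2 * jbracket x powr - (2 * (s - \<gamma>)))"
      proof (rule AE_I2)
        fix x :: 'a
        have "\<bar>G x\<bar> * jbracket x powr \<gamma> \<le> (C * jbracket x powr - s) * jbracket x powr \<gamma>"
          by (intro mult_right_mono dec) auto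
        also have "\<dots> = C * jbracket x powr - (s - \<gamma>)" by (simp add: powr_add[symmetric])
        finally have "(\<bar>G x\<bar> * jbracket x powr \<gamma>)\<^sup>2 \<le> (C * jbracket x powr - (s - \<gamma>))\<^sup>2"
          by (intro power_mono) auto
        also have "\<dots> = C\<^sup>2 * jbracket x powr - (2 * (s - \<gamma>))"
          by (simp add: power_mult_distrib power2_eq_square[of "_ powr _"] powr_add[symmetric])
        finally show "norm ((norm (?u x))\<^sup>2) \<le> norm (C\<^sup>2 * jbracket x powr - (2 * (s - \<gamma>)))"
          by (simp add: norm_mult abs_mult)
      qed
    qed measurable
    fix \<phi> :: "'a \<Rightarrow> complex" assume phi: "\<phi> \<in> schwartz"
    have "mult_dist (\<lambda>\<xi>. of_real (jbracket \<xi> powr \<gamma>)) (fourier_dist (fun_dist ?f)) \<phi>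
       = (LINT x|lborel. ?f x * fourier (\<lambda>\<xi>. of_real (jbracket \<xi> powr \<gamma>) * \<phi> \<xi>) x)"
      by (simp add: mult_dist_def fourier_dist_def fun_dist_def)
    also have "\<dots> = (LINT \<xi>|lborel. fourier ?f \<xi> * (of_real (jbracket \<xi> powr \<gamma>) * \<phi> \<xi>))"
      by (rule fourier_multiplication_formula[OF f integrable_jbracket_schwartz[OF phi]])
    also have "\<dots> = fun_dist ?u \<phi>" unfolding G fun_dist_def by (simp add: mult_ac)
    finally show "mult_dist (\<lambda>\<xi>. of_real (jbracket \<xi> powr \<gamma>)) (fourier_dist (fun_dist ?f)) \<phi> = fun_dist ?u \<phi>" .
  qed
  ultimately show ?thesis using bd unfolding sobolev_fun_def sobolev_def by blast
qed

text \<open>Multiplication by the test function is, on the Fourier side, convolution with the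
  nonnegative function \<open>(bump_hat y)\<^sup>2\<close>.\<close>

lemma inv_fourier_bump_square_times_fourier:
  fixes m :: "'a::euclidean_space \<Rightarrow> complex"
  assumes m: "integrable lborel m"
  shows "inv_fourier (\<lambda>x. of_real (bump_square x) * fourier m x) \<xi>
    = (LINT y|lborel. of_real ((bump_hat (y - \<xi>))\<^sup>2) * m y) / of_real ((2 * pi) ^ DIM('a))"
proof -
  let ?f = "\<lambda>x. exp (\<i> * of_real (x \<bullet> \<xi>)) * complex_of_real (bump_square x)"
  have f: "integrable lborel ?f"
    by (rule integrable_compact_support[of _ 2])
       (auto intro!: continuous_intros continuous_on_of_real continuous_on_bump_square simp: bump_square_eq_0)
  have ff: "fourier ?f y = of_real ((bump_hat (y - \<xi>))\<^sup>2)" for y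
  proof -
    have "exp (- (\<i> * complex_of_real (x \<bullet> y))) * exp (\<i> * of_real (x \<bullet> \<xi>)) = exp (- (\<i> * of_real (x \<bullet> (y - \<xi>))))" for x
      by (simp add: exp_add[symmetric] inner_diff_right right_diff_distrib)
    then have "fourier ?f y = fourier (\<lambda>x. complex_of_real (bump_square x)) (y - \<xi>)"
      unfolding fourier_def by (simp only: mult.assoc[symmetric])
    then show ?thesis by (simp only: fourier_bump_square)
  qed
  have "(LINT x|lborel. exp (\<i> * of_real (\<xi> \<bullet> x)) * (of_real (bump_square x) * fourier m x)) = (LINT x|lborel. ?f x * fourier m x)"
    by (simp add: mult.assoc inner_commute[of \<xi>])
  also have "\<dots> = (LINT y|lborel. fourier ?f y * m y)" by (rule fourier_multiplication_formula[OF f m])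
  finally show ?thesis unfolding inv_fourier_def ff by simp
qed

lemma bump_hat_square_integrable:
  "integrable lborel (\<lambda>\<xi>::'a::euclidean_space. (bump_hat \<xi>)\<^sup>2)" "\<exists>B>0. \<forall>\<xi>::'a. (bump_hat \<xi>)\<^sup>2 \<le> B"
proof -
  obtain K where K: "K > 0" "\<And>\<xi>::'a. (bump_hat \<xi>)\<^sup>2 \<le> K / jbracket \<xi> ^ (DIM('a) + 1)"
    using bump_hat_square_decay[of "DIM('a) + 1", where 'a = 'a] by blast
  have j: "1 / jbracket \<xi> ^ (DIM('a) + 1) = jbracket \<xi> powr - (2 * (real (DIM('a) + 1) / 2))" for \<xi> :: 'a
  proof -
    have "2 * (real (DIM('a) + 1) / 2) = real (DIM('a) + 1)" by simp
    then show ?thesis by (simp only: powr_minus powr_realpow[OF jbracket_pos] inverse_eq_divide)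
  qed
  have "integrable lborel (\<lambda>\<xi>::'a. K * jbracket \<xi> powr - (2 * (real (DIM('a) + 1) / 2)))"
    by (intro integrable_mult_right integrable_jbracket_powr) simp
  then show "integrable lborel (\<lambda>\<xi>::'a. (bump_hat \<xi>)\<^sup>2)"
  proof (rule Bochner_Integration.integrable_bound)
    show "AE \<xi> in lborel. norm ((bump_hat \<xi>)\<^sup>2) \<le> norm (K * jbracket (\<xi>::'a) powr - (2 * (real (DIM('a) + 1) / 2)))"
    proof (rule AE_I2)
      fix \<xi> :: 'a
      show "norm ((bump_hat \<xi>)\<^sup>2) \<le> norm (K * jbracket (\<xi>::'a) powr - (2 * (real (DIM('a) + 1) / 2)))"
        unfolding j[symmetric] using K(1) K(2)[of \<xi>] by (simp add: less_imp_le abs_mult)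
    qed
  qed measurable
  have "(bump_hat \<xi>)\<^sup>2 \<le> K" for \<xi> :: 'a
  proof -
    have "K / jbracket \<xi> ^ (DIM('a) + 1) \<le> K / 1"
      using K(1) one_le_power[OF jbracket_ge_1[of \<xi>], of "DIM('a) + 1"] by (intro divide_left_mono) auto
    then show ?thesis using K(2)[of \<xi>] by simp
  qed
  then show "\<exists>B>0. \<forall>\<xi>::'a. (bump_hat \<xi>)\<^sup>2 \<le> B" using K(1) by blast
qed

lemma powr_comparable_lower:
  fixes x R \<alpha> :: real
  assumes "0 < R" "R / 2 \<le> x" "x \<le> 4 * R"
  shows "min ((1 / 2) powr \<alpha>) (4 powr \<alpha>) * R powr \<alpha> \<le> x powr \<alpha>"
proof -
  define t where "t = x / R"
  have t: "1 / 2 \<le> t" "t \<le> 4" using assms by (auto simp: t_def field_simps)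
  have "min ((1 / 2) powr \<alpha>) (4 powr \<alpha>) \<le> t powr \<alpha>"
  proof (cases "0 \<le> \<alpha>")
    case True
    then have "(1 / 2) powr \<alpha> \<le> t powr \<alpha>" using t by (intro powr_mono2) auto
    then show ?thesis by (simp add: min_le_iff_disj)
  next
    case False
    then have "4 powr \<alpha> \<le> t powr \<alpha>" using t by (intro powr_mono2') auto
    then show ?thesis by (simp add: min_le_iff_disj)
  qed
  then have "min ((1 / 2) powr \<alpha>) (4 powr \<alpha>) * R powr \<alpha> \<le> t powr \<alpha> * R powr \<alpha>" by (intro mult_right_mono) auto
  also have "\<dots> = x powr \<alpha>" using assms t by (simp add: powr_mult[symmetric] t_def)
  finally show ?thesis .
qed

lemma tail_integral_tendsto_0:
  fixes f :: "'a::euclidean_space \<Rightarrow> real"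
  assumes f: "integrable lborel f"
  shows "((\<lambda>R. LINT x|lborel. indicator {x. R / 2 \<le> norm x} x * f x) \<longlongrightarrow> 0) at_top"
proof -
  note [measurable] = borel_measurable_integrable[OF f]
  have "((\<lambda>R. LINT x|lborel. indicator {x. R / 2 \<le> norm x} x * f x) \<longlongrightarrow> (LINT x|(lborel :: 'a measure). 0)) at_top"
  proof (rule integral_dominated_convergence_at_top)
    show "integrable lborel (\<lambda>x. \<bar>f x\<bar>)" using f by simp
    show "\<forall>\<^sub>F R in at_top. AE x in lborel. norm (indicator {x. R / 2 \<le> norm x} x * f x) \<le> \<bar>f x\<bar>"
      by (rule always_eventually) (auto split: split_indicator)
    show "AE x in lborel. ((\<lambda>R. indicator {x. R / 2 \<le> norm x} x * f x) \<longlongrightarrow> 0) at_top"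
    proof (rule AE_I2)
      fix x :: 'a
      have "\<forall>\<^sub>F R in at_top. indicator {x. R / 2 \<le> norm x} x * f x = 0"
        using eventually_gt_at_top[of "2 * norm x"] by eventually_elim auto
      then show "((\<lambda>R. indicator {x. R / 2 \<le> norm x} x * f x) \<longlongrightarrow> 0) at_top" by (rule tendsto_eventually)
    qed
  qed measurable
  then show ?thesis by simp
qed

text \<open>Let \<open>u\<close> be the \<open>L\<^sup>2\<close> function that represents the localised distribution, and pair it with
  a bump of size \<open>R/8\<close> at \<open>R e\<close>. On one side the pairing is the integral of \<open>Qh\<close> against a
  nonnegative function \<open>W\<close>, which is at least a multiple of \<open>R powr \<alpha>\<close> on a ball of radius \<open>R/32\<close>
  inside the cone around \<open>e\<close>; as \<open>Im Qh\<close> has a constant sign, the rest of the integral can only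
  help. On the other side it is at most the \<open>L\<^sup>2\<close> norm of \<open>u\<close> on \<open>|x| \<ge> R/2\<close> times a multiple of
  \<open>R\<^sup>n\<^sup>/\<^sup>2\<close>. That norm tends to 0, so even the borderline exponent is excluded.\<close>

theorem not_in_sobolev_loc:
  fixes Qh :: "'a::euclidean_space \<Rightarrow> complex" and e :: 'a
  assumes n: "2 \<le> DIM('a)" and Qm [measurable]: "Qh \<in> borel_measurable borel"
    and C: "0 < C" "\<And>\<eta>. norm (Qh \<eta>) \<le> C * (1 + 1 / norm \<eta>)" and Im0: "\<And>\<eta>. Im (Qh \<eta>) \<le> 0"
    and e: "norm e = 1" and c: "0 < c" and p: "0 \<le> p"
    and low: "\<And>\<eta>. 2 \<le> norm \<eta> \<Longrightarrow> norm (\<eta> - norm \<eta> *\<^sub>R e) \<le> norm \<eta> / 8 \<Longrightarrow> Im (Qh \<eta>) \<le> - c * norm \<eta> powr - p"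
    and sob: "inv_fourier_dist (fun_dist Qh) \<in> sobolev_loc \<alpha>"
  shows "\<alpha> < p - real DIM('a) / 2"
proof (rule ccontr)
  assume "\<not> \<alpha> < p - real DIM('a) / 2"
  then have \<alpha>: "p - real DIM('a) / 2 \<le> \<alpha>" by simp
  let ?T = "inv_fourier_dist (fun_dist Qh)"
  let ?H = "\<lambda>x::'a. (bump_hat x)\<^sup>2"
  define N where "N = (2 * pi) ^ DIM('a)"
  have N: "0 < N" by (simp add: N_def)
  have "mult_dist (\<lambda>x. complex_of_real (bump_square x)) ?T \<in> sobolev \<alpha>"
    using sob bump_square_test unfolding sobolev_loc_def by blast
  then have "is_L2_dist (mult_dist (\<lambda>\<xi>. of_real (jbracket \<xi> powr \<alpha>)) (fourier_dist (mult_dist (\<lambda>x. complex_of_real (bump_square x)) ?T)))"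
    unfolding sobolev_def by blast
  then obtain u where um [measurable]: "u \<in> borel_measurable lborel" and u2: "integrable lborel (\<lambda>x. (norm (u x))\<^sup>2)"
    and u: "\<And>\<phi>. \<phi> \<in> schwartz \<Longrightarrow> mult_dist (\<lambda>\<xi>. of_real (jbracket \<xi> powr \<alpha>)) (fourier_dist (mult_dist (\<lambda>x. complex_of_real (bump_square x)) ?T)) \<phi> = fun_dist u \<phi>"
    unfolding is_L2_dist_def by blast
  obtain h0 \<rho> where h0: "0 < h0" "0 < \<rho>" "\<rho> \<le> 1" "\<And>x::'a. norm x \<le> \<rho> \<Longrightarrow> h0 \<le> ?H x"
    using bump_hat_square_lower[where 'a = 'a] by blast
  obtain HB where HB: "0 < HB" "\<And>x::'a. ?H x \<le> HB" using bump_hat_square_integrable(2)[where 'a = 'a] by blast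
  have Hint: "integrable lborel ?H" by (rule bump_hat_square_integrable)
  have inorm: "integrable lborel (\<lambda>x::'a. indicator (ball 0 1) x / norm x)" by (rule integrable_inverse_norm_ball[OF n])
  define \<kappa> where "\<kappa> = min ((1 / 2) powr \<alpha>) (4 powr \<alpha>)"
  have \<kappa>: "0 < \<kappa>" by (simp add: \<kappa>_def)
  define V where "V = measure lborel (ball (0::'a) \<rho>)"
  have V: "0 < V" using h0 by (simp add: V_def content_ball_pos)
  define V1 where "V1 = unit_ball_vol (real DIM('a))"
  have V1: "0 < V1" by (simp add: V1_def)
  define w1 where "w1 = \<kappa> * exp (- 2) * h0 * V"
  have w1: "0 < w1" using \<kappa> h0 V by (simp add: w1_def)
  define A where "A = c * 2 powr - p * w1 * V1 * (1 / 32) ^ DIM('a) / N"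
  have A: "0 < A" using c w1 V1 N by (simp add: A_def)
  \<comment> \<open>Lower bound for the pairing with a bump of size \<open>R / 8\<close> at \<open>R e\<close>.\<close>
  have key: "A * R powr (real DIM('a) / 2) \<le> (LINT x|lborel. norm (u x) * bump (R *\<^sub>R e) (R / 8) x)" if R: "32 \<le> R" for R
  proof -
    have R0: "0 < R" using R by simp
    define \<psi> where "\<psi> = bump (R *\<^sub>R e) (R / 8)"
    have \<psi>0: "0 \<le> \<psi> x" "\<psi> x \<le> 1" for x by (auto simp: \<psi>_def bump_bounds)
    have \<psi>m [measurable]: "\<psi> \<in> borel_measurable borel" by (simp add: \<psi>_def)
    have schw: "(\<lambda>x. complex_of_real (\<psi> x)) \<in> schwartz" unfolding \<psi>_def by (rule bump_schwartz) (use R0 in simp)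
    define M where "M y = jbracket y powr \<alpha> * \<psi> y" for y
    have M0: "0 \<le> M y" for y by (simp add: M_def \<psi>0)
    have [measurable]: "M \<in> borel_measurable borel" unfolding M_def by measurable
    have Mc: "integrable lborel (\<lambda>y. complex_of_real (M y))"
      using integrable_jbracket_schwartz[OF schw, of \<alpha>] by (simp add: M_def)
    then have Mi: "integrable lborel M" using integrable_Re[OF Mc] by simp
    define W where "W \<xi> = (LINT y|lborel. ?H (y - \<xi>) * M y)" for \<xi>
    have HMi: "integrable lborel (\<lambda>y. ?H (y - \<xi>) * M y)" for \<xi>
    proof (rule Bochner_Integration.integrable_bound)
      show "integrable lborel (\<lambda>y. HB * M y)" using Mi by simp
      show "AE y in lborel. norm (?H (y - \<xi>) * M y) \<le> norm (HB * M y)"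
        using HB M0 by (auto simp: abs_mult intro!: mult_right_mono)
    qed measurable
    have W0: "0 \<le> W \<xi>" for \<xi> unfolding W_def by (rule Bochner_Integration.integral_nonneg) (use M0 in auto)
    have WB: "W \<xi> \<le> HB * (LINT y|lborel. M y)" for \<xi>
    proof -
      have "W \<xi> \<le> (LINT y|lborel. HB * M y)" unfolding W_def
        by (rule integral_mono[OF HMi]) (use Mi HB M0 in \<open>auto intro!: mult_right_mono\<close>)
      then show ?thesis by simp
    qed
    have pair: "integrable (lborel \<Otimes>\<^sub>M lborel) (\<lambda>(y, \<xi>). ?H (y - \<xi>) * M y)"
    proof (rule lborel_pair.Fubini_integrable)
      have refl: "(LINT \<xi>|lborel. ?H (y - \<xi>)) = (LINT \<xi>|lborel. ?H \<xi>)" for y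
        by (rule integral_reflect) measurable
      have "(LINT \<xi>|lborel. norm (?H (y - \<xi>) * M y)) = (LINT \<xi>|lborel. ?H \<xi>) * M y" for y
        using M0[of y] by (simp add: abs_mult refl)
      then show "integrable lborel (\<lambda>y. LINT \<xi>|lborel. norm (case (y, \<xi>) of (y, \<xi>) \<Rightarrow> ?H (y - \<xi>) * M y))"
        using Mi by simp
      show "AE y in lborel. integrable lborel (\<lambda>\<xi>. case (y, \<xi>) of (y, \<xi>) \<Rightarrow> ?H (y - \<xi>) * M y)"
      proof (rule AE_I2)
        fix y :: 'a
        have "integrable lborel (\<lambda>\<xi>. ?H (y + (- 1) *\<^sub>R \<xi>))" by (rule integral_lborel_affine(1)[OF Hint]) simp
        then show "integrable lborel (\<lambda>\<xi>. case (y, \<xi>) of (y, \<xi>) \<Rightarrow> ?H (y - \<xi>) * M y)" by simp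
      qed
    qed measurable
    have Wi: "integrable lborel W" unfolding W_def using lborel_pair.integrable_snd[OF pair] by simp
    note [measurable] = borel_measurable_integrable[OF Wi]
    have QWi: "integrable lborel (\<lambda>\<xi>. Qh \<xi> * of_real (W \<xi>))"
    proof (rule Bochner_Integration.integrable_bound)
      let ?B = "HB * (LINT y|lborel. M y)"
      show "integrable lborel (\<lambda>\<xi>. 2 * C * W \<xi> + C * ?B * (indicator (ball 0 1) \<xi> / norm \<xi>))"
        by (intro Bochner_Integration.integrable_add integrable_mult_right Wi inorm)
      show "AE \<xi> in lborel. norm (Qh \<xi> * of_real (W \<xi>)) \<le> norm (2 * C * W \<xi> + C * ?B * (indicator (ball 0 1) \<xi> / norm \<xi>))"
      proof (rule AE_I2)
        fix \<xi> :: 'a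
        have "1 / norm \<xi> * W \<xi> \<le> W \<xi> + ?B * (indicator (ball 0 1) \<xi> / norm \<xi>)"
        proof (cases "norm \<xi> < 1")
          case True
          have "1 / norm \<xi> * W \<xi> \<le> 1 / norm \<xi> * ?B" by (intro mult_left_mono WB) auto
          then show ?thesis using True W0[of \<xi>] by simp
        next
          case False
          then have "1 / norm \<xi> * W \<xi> \<le> 1 * W \<xi>" using W0 by (intro mult_right_mono) (auto simp: divide_le_eq)
          then show ?thesis using False by simp
        qed
        then have "(1 + 1 / norm \<xi>) * W \<xi> \<le> 2 * W \<xi> + ?B * (indicator (ball 0 1) \<xi> / norm \<xi>)" by (simp add: distrib_right)
        then have "C * ((1 + 1 / norm \<xi>) * W \<xi>) \<le> C * (2 * W \<xi> + ?B * (indicator (ball 0 1) \<xi> / norm \<xi>))"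
          using C(1) by (intro mult_left_mono) auto
        moreover have "norm (Qh \<xi>) * W \<xi> \<le> C * (1 + 1 / norm \<xi>) * W \<xi>" using W0 by (intro mult_right_mono C(2))
        ultimately have "norm (Qh \<xi>) * W \<xi> \<le> 2 * C * W \<xi> + C * ?B * (indicator (ball 0 1) \<xi> / norm \<xi>)"
          by (simp add: algebra_simps)
        then show "norm (Qh \<xi> * of_real (W \<xi>)) \<le> norm (2 * C * W \<xi> + C * ?B * (indicator (ball 0 1) \<xi> / norm \<xi>))"
          using W0[of \<xi>] by (simp add: norm_mult)
      qed
    qed measurable
    have inv: "inv_fourier (\<lambda>x. complex_of_real (bump_square x) * fourier (\<lambda>\<xi>. of_real (jbracket \<xi> powr \<alpha>) * of_real (\<psi> \<xi>)) x) \<xi> = of_real (W \<xi> / N)" for \<xi>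
    proof -
      have "(\<lambda>\<xi>. complex_of_real (jbracket \<xi> powr \<alpha>) * of_real (\<psi> \<xi>)) = (\<lambda>y. complex_of_real (M y))" by (simp add: M_def)
      then have "inv_fourier (\<lambda>x. complex_of_real (bump_square x) * fourier (\<lambda>\<xi>. of_real (jbracket \<xi> powr \<alpha>) * of_real (\<psi> \<xi>)) x) \<xi>
        = (LINT y|lborel. of_real (?H (y - \<xi>)) * complex_of_real (M y)) / of_real N"
        using inv_fourier_bump_square_times_fourier[OF Mc, of \<xi>] by (simp add: N_def)
      also have "(LINT y|lborel. of_real (?H (y - \<xi>)) * complex_of_real (M y)) = of_real (W \<xi>)"
        unfolding W_def of_real_mult[symmetric] by (rule integral_complex_of_real)
      finally show ?thesis by simp
    qed
    have "fun_dist u (\<lambda>x. complex_of_real (\<psi> x)) = (LINT \<xi>|lborel. Qh \<xi> * of_real (W \<xi> / N))"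
      unfolding u[OF schw, symmetric]
      by (simp only: mult_dist_def fourier_dist_def inv_fourier_dist_def fun_dist_def inv)
    also have "\<dots> = (LINT \<xi>|lborel. Qh \<xi> * of_real (W \<xi>)) / of_real N"
      by (simp only: of_real_divide times_divide_eq_right integral_divide_zero)
    finally have T: "Im (fun_dist u (\<lambda>x. complex_of_real (\<psi> x))) = (LINT \<xi>|lborel. Im (Qh \<xi>) * W \<xi>) / N"
      using N integral_Im[OF QWi] by simp
    have Wlow: "w1 * R powr \<alpha> \<le> W \<xi>" if xi: "norm (\<xi> - R *\<^sub>R e) < R / 32" for \<xi>
    proof -
      have "w1 * R powr \<alpha> = (LINT y|lborel. (h0 * (\<kappa> * R powr \<alpha> * exp (- 2))) * indicator (ball \<xi> \<rho>) y)"
        using h0 by (simp add: w1_def V_def content_ball mult_ac)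
      also have "\<dots> \<le> W \<xi>"
        unfolding W_def
      proof (rule integral_mono[OF _ HMi])
        show "integrable lborel (\<lambda>y. (h0 * (\<kappa> * R powr \<alpha> * exp (- 2))) * indicator (ball \<xi> \<rho>) y)"
          using emeasure_lborel_ball_finite[of \<xi> \<rho>] by (intro integrable_mult_right integrable_real_indicator) auto
        fix y :: 'a
        show "(h0 * (\<kappa> * R powr \<alpha> * exp (- 2))) * indicator (ball \<xi> \<rho>) y \<le> ?H (y - \<xi>) * M y"
        proof (cases "y \<in> ball \<xi> \<rho>")
          case True
          then have yx: "norm (y - \<xi>) < \<rho>" by (simp add: dist_norm norm_minus_commute)
          have yR: "norm (y - R *\<^sub>R e) \<le> R / 16"
            using norm_triangle_ineq[of "y - \<xi>" "\<xi> - R *\<^sub>R e"] yx xi h0(3) R by simp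
          have nR: "norm (R *\<^sub>R e) = R" using e R0 by simp
          have "\<bar>norm y - R\<bar> \<le> R / 16" using norm_triangle_ineq3[of y "R *\<^sub>R e"] yR nR by linarith
          then have ny: "R / 2 \<le> norm y" "norm y \<le> 2 * R" using R0 unfolding abs_le_iff by linarith+
          have "\<kappa> * R powr \<alpha> \<le> jbracket y powr \<alpha>"
            unfolding \<kappa>_def
          proof (rule powr_comparable_lower[OF R0])
            show "R / 2 \<le> jbracket y" using ny norm_le_jbracket[of y] by linarith
            show "jbracket y \<le> 4 * R" using ny jbracket_le[of y] R by linarith
          qed
          moreover have "exp (- 2) \<le> \<psi> y" unfolding \<psi>_def by (rule bump_lower) (use R0 yR in auto)
          ultimately have "\<kappa> * R powr \<alpha> * exp (- 2) \<le> M y" unfolding M_def using \<kappa> by (intro mult_mono) auto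
          moreover have "h0 \<le> ?H (y - \<xi>)" using yx by (intro h0(4)) simp
          ultimately show ?thesis using True h0 \<kappa> by (auto intro!: mult_mono)
        qed (use M0 in simp)
      qed
      finally show ?thesis .
    qed
    have "(LINT \<xi>|lborel. Im (Qh \<xi>) * W \<xi>) \<le> (LINT \<xi>|lborel. (- (c * (2 * R) powr - p * (w1 * R powr \<alpha>))) * indicator (ball (R *\<^sub>R e) (R / 32)) \<xi>)"
    proof (rule integral_mono)
      show "integrable lborel (\<lambda>\<xi>. Im (Qh \<xi>) * W \<xi>)" using integrable_Im[OF QWi] by simp
      show "integrable lborel (\<lambda>\<xi>. (- (c * (2 * R) powr - p * (w1 * R powr \<alpha>))) * indicator (ball (R *\<^sub>R e) (R / 32)) \<xi>)"
        using emeasure_lborel_ball_finite[of "R *\<^sub>R e" "R / 32"] by (intro integrable_mult_right integrable_real_indicator) auto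
      fix \<xi> :: 'a
      show "Im (Qh \<xi>) * W \<xi> \<le> (- (c * (2 * R) powr - p * (w1 * R powr \<alpha>))) * indicator (ball (R *\<^sub>R e) (R / 32)) \<xi>"
      proof (cases "\<xi> \<in> ball (R *\<^sub>R e) (R / 32)")
        case True
        then have xi: "norm (\<xi> - R *\<^sub>R e) < R / 32" by (simp add: dist_norm norm_minus_commute)
        have nR: "norm (R *\<^sub>R e) = R" using e R0 by simp
        have d: "\<bar>norm \<xi> - R\<bar> < R / 32" using norm_triangle_ineq3[of \<xi> "R *\<^sub>R e"] xi nR by linarith
        then have nx: "R / 2 \<le> norm \<xi>" "norm \<xi> \<le> 2 * R" using R0 unfolding abs_less_iff by linarith+
        have eq: "\<xi> - norm \<xi> *\<^sub>R e = (\<xi> - R *\<^sub>R e) + (R - norm \<xi>) *\<^sub>R e" by (simp add: algebra_simps)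
        have "norm (\<xi> - norm \<xi> *\<^sub>R e) \<le> norm (\<xi> - R *\<^sub>R e) + \<bar>R - norm \<xi>\<bar>"
          unfolding eq by (rule order_trans[OF norm_triangle_ineq]) (use e in simp)
        then have cone: "norm (\<xi> - norm \<xi> *\<^sub>R e) \<le> norm \<xi> / 8" using xi d nx by linarith
        have "Im (Qh \<xi>) \<le> - c * norm \<xi> powr - p" using nx R cone by (intro low) auto
        moreover have "c * (2 * R) powr - p \<le> c * norm \<xi> powr - p"
          using c p nx R0 by (intro mult_left_mono powr_mono2') auto
        ultimately have "c * (2 * R) powr - p \<le> - Im (Qh \<xi>)" by simp
        then have "c * (2 * R) powr - p * (w1 * R powr \<alpha>) \<le> - Im (Qh \<xi>) * W \<xi>"
          using c w1 W0 Im0[of \<xi>] by (intro mult_mono Wlow[OF xi]) auto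
        then show ?thesis using True by simp
      next
        case False
        then show ?thesis using Im0[of \<xi>] W0[of \<xi>] by (simp add: mult_nonpos_nonneg)
      qed
    qed
    also have "\<dots> = - (c * (2 * R) powr - p * (w1 * R powr \<alpha>)) * (V1 * (R / 32) ^ DIM('a))"
      using R0 by (simp add: content_ball V1_def)
    finally have "c * (2 * R) powr - p * (w1 * R powr \<alpha>) * (V1 * (R / 32) ^ DIM('a)) \<le> - (LINT \<xi>|lborel. Im (Qh \<xi>) * W \<xi>)" by simp
    then have le: "c * (2 * R) powr - p * (w1 * R powr \<alpha>) * (V1 * (R / 32) ^ DIM('a)) / N \<le> - Im (fun_dist u (\<lambda>x. complex_of_real (\<psi> x)))"
      unfolding T minus_divide_left using N by (intro divide_right_mono) auto
    have "A * R powr (real DIM('a) / 2) \<le> A * R powr (- p + \<alpha> + real DIM('a))"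
      using A R \<alpha> by (intro mult_left_mono powr_mono) auto
    also have "\<dots> = A * (R powr - p * R powr \<alpha> * R powr real DIM('a))" by (simp only: powr_add)
    also have "\<dots> = c * (2 * R) powr - p * (w1 * R powr \<alpha>) * (V1 * (R / 32) ^ DIM('a)) / N"
      using R0 by (simp add: A_def powr_mult powr_realpow power_divide)
    also note le
    also have "- Im (fun_dist u (\<lambda>x. complex_of_real (\<psi> x))) \<le> norm (fun_dist u (\<lambda>x. complex_of_real (\<psi> x)))"
      using abs_Im_le_cmod[of "fun_dist u (\<lambda>x. complex_of_real (\<psi> x))"] by linarith
    also have "\<dots> \<le> (LINT x|lborel. norm (u x * complex_of_real (\<psi> x)))" unfolding fun_dist_def by (rule integral_norm_bound)
    also have "\<dots> = (LINT x|lborel. norm (u x) * \<psi> x)" by (simp add: norm_mult \<psi>0)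
    finally show ?thesis by (simp add: \<psi>_def)
  qed
  \<comment> \<open>\<open>t\<close> balances the two terms of Young's inequality, so that their sum is below \<open>A * r\<close> once \<open>E R\<close> is small.\<close>
  define t where "t = V1 / A"
  have t: "0 < t" using V1 A by (simp add: t_def)
  define E where "E R = (LINT x|lborel. indicator {x. R / 2 \<le> norm x} x * (norm (u x))\<^sup>2)" for R
  have "(E \<longlongrightarrow> 0) at_top" unfolding E_def by (rule tail_integral_tendsto_0[OF u2])
  then have "\<forall>\<^sub>F R in at_top. E R < A / (2 * t)" by (rule order_tendstoD) (use A t in simp)
  then have "\<forall>\<^sub>F R in at_top. E R < A / (2 * t) \<and> 32 \<le> R" by (intro eventually_conj eventually_ge_at_top)
  then obtain R where R: "E R < A / (2 * t)" "32 \<le> R" using eventually_happens by fastforce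
  have R0: "0 < R" using R by simp
  define r where "r = R powr (real DIM('a) / 2)"
  have r: "0 < r" "r * r = R ^ DIM('a)" using R0 by (auto simp: r_def powr_add[symmetric] powr_realpow)
  let ?B = "ball (R *\<^sub>R e) (R / 8)"
  have "A * r \<le> (LINT x|lborel. norm (u x) * bump (R *\<^sub>R e) (R / 8) x)" unfolding r_def by (rule key[OF R(2)])
  also have "\<dots> \<le> (LINT x|lborel. (t * r / 2) * (indicator {x. R / 2 \<le> norm x} x * (norm (u x))\<^sup>2) + (1 / (2 * t * r)) * indicator ?B x)"
  proof (rule integral_mono')
    have "integrable lborel (\<lambda>x. indicator {x. R / 2 \<le> norm x} x *\<^sub>R (norm (u x))\<^sup>2)"
      by (rule integrable_mult_indicator[OF _ u2]) measurable
    then show "integrable lborel (\<lambda>x. (t * r / 2) * (indicator {x. R / 2 \<le> norm x} x * (norm (u x))\<^sup>2) + (1 / (2 * t * r)) * indicator ?B x)"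
      using emeasure_lborel_ball_finite[of "R *\<^sub>R e" "R / 8"]
      by (intro Bochner_Integration.integrable_add integrable_mult_right integrable_real_indicator) auto
    fix x :: 'a
    show "0 \<le> (t * r / 2) * (indicator {x. R / 2 \<le> norm x} x * (norm (u x))\<^sup>2) + (1 / (2 * t * r)) * indicator ?B x"
      using t r by (intro add_nonneg_nonneg mult_nonneg_nonneg) auto
    show "norm (u x) * bump (R *\<^sub>R e) (R / 8) x \<le> (t * r / 2) * (indicator {x. R / 2 \<le> norm x} x * (norm (u x))\<^sup>2) + (1 / (2 * t * r)) * indicator ?B x"
    proof (cases "x \<in> ?B")
      case True
      then have "norm (x - R *\<^sub>R e) < R / 8" by (simp add: dist_norm norm_minus_commute)
      moreover have "norm (R *\<^sub>R e) = R" using e R0 by simp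
      ultimately have nx: "R / 2 \<le> norm x" using norm_triangle_ineq2[of "R *\<^sub>R e" x] R0 by (simp add: norm_minus_commute)
      have "norm (u x) * bump (R *\<^sub>R e) (R / 8) x \<le> norm (u x) * 1" by (intro mult_left_mono bump_bounds) auto
      also have "\<dots> \<le> (t * r / 2) * (norm (u x))\<^sup>2 + 1 / (2 * t * r)"
      proof -
        define q where "q = t * r"
        have q: "0 < q" using t r by (simp add: q_def)
        have "0 \<le> (q * norm (u x) - 1)\<^sup>2 / (2 * q)" using q by simp
        also have "\<dots> = (q / 2) * (norm (u x))\<^sup>2 + 1 / (2 * q) - norm (u x)"
          using q by (simp add: power2_eq_square field_simps)
        finally show ?thesis by (simp add: q_def mult.assoc)
      qed
      finally show ?thesis using True nx by simp
    next
      case False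
      then have "bump (R *\<^sub>R e) (R / 8) x = 0" by (intro bump_eq_0) (use R0 in \<open>auto simp: dist_norm norm_minus_commute\<close>)
      then show ?thesis using t r by simp
    qed
  qed
  also have "\<dots> = (t * r / 2) * E R + (1 / (2 * t * r)) * (V1 * (R / 8) ^ DIM('a))"
  proof -
    have i1: "integrable lborel (\<lambda>x. indicator {x. R / 2 \<le> norm x} x * (norm (u x))\<^sup>2)"
      using integrable_mult_indicator[OF _ u2, of "{x. R / 2 \<le> norm x}"] by simp
    have i2: "integrable lborel (indicator ?B :: 'a \<Rightarrow> real)"
      using emeasure_lborel_ball_finite[of "R *\<^sub>R e" "R / 8"] by (intro integrable_real_indicator) auto
    have "measure lborel ?B = V1 * (R / 8) ^ DIM('a)" using R0 by (simp add: content_ball V1_def)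
    then show ?thesis unfolding E_def
      by (subst Bochner_Integration.integral_add[OF integrable_mult_right[OF i1] integrable_mult_right[OF i2]]) simp
  qed
  also have "\<dots> < (t * r / 2) * (A / (2 * t)) + (1 / (2 * t * r)) * (V1 * (r * r))"
  proof (rule add_less_le_mono)
    show "(t * r / 2) * E R < (t * r / 2) * (A / (2 * t))" using t r R by (intro mult_strict_left_mono) auto
    have "(R / 8) ^ DIM('a) \<le> r * r" unfolding r(2) using R0 by (intro power_mono) auto
    then show "(1 / (2 * t * r)) * (V1 * (R / 8) ^ DIM('a)) \<le> (1 / (2 * t * r)) * (V1 * (r * r))"
      using t r V1 by (intro mult_left_mono) auto
  qed
  also have "\<dots> = 3 / 4 * A * r" using t r A V1 by (simp add: t_def field_simps)
  finally show False using A r by simp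
qed

lemma potential_hat_measurable [measurable]: "potential_hat s \<in> borel_measurable (borel :: 'a::euclidean_space measure)"
  unfolding potential_hat_def by measurable

theorem theorem5p1:
  fixes \<theta> :: "real ^ 'n" and \<beta> \<alpha>\<^sub>0 :: real
  assumes "CARD('n) \<ge> 2"
    and "\<theta> \<in> sphere 0 1"
    and "0 < \<beta>"
    and "\<alpha>\<^sub>0 = min (\<beta> + 1) (2 * \<beta> - (real CARD('n) - 4) / 2)"
  shows "\<exists>g :: real ^ 'n \<Rightarrow> real.
      radial g \<and> compactly_supported g \<and>
      (\<forall>\<gamma><\<beta>. (\<lambda>x. complex_of_real (g x)) \<in> sobolev_fun \<gamma>) \<and>
      (\<forall>\<alpha>. Q_fixed \<theta> (\<lambda>x. complex_of_real (g x)) \<in> sobolev_loc \<alpha> \<longrightarrow> \<alpha> < \<alpha>\<^sub>0) \<and>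
      (\<forall>\<alpha>. Q_full (\<lambda>x. complex_of_real (g x)) \<in> sobolev_loc \<alpha> \<longrightarrow> \<alpha> < \<alpha>\<^sub>0)"
proof -
  define s where "s = \<beta> + real CARD('n) / 2"
  have dimc: "DIM(real ^ 'n) = CARD('n)" by simp
  have dim2: "2 \<le> DIM(real ^ 'n)" using assms(1) by simp
  have spos: "0 < s" "real DIM(real ^ 'n) < 2 * s" using assms(3) by (auto simp: s_def)
  let ?g = "potential s :: real ^ 'n \<Rightarrow> real"
  let ?q = "\<lambda>x. complex_of_real (?g x)"
  obtain c C where cC: "0 < c" "0 < C" and b: "\<And>\<xi> :: real ^ 'n. c * jbracket \<xi> powr - s \<le> potential_hat s \<xi>"
    "\<And>\<xi> :: real ^ 'n. potential_hat s \<xi> \<le> C * jbracket \<xi> powr - s"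
    "\<And>\<xi> \<eta> :: real ^ 'n. norm (\<xi> - \<eta>) \<le> 1 \<Longrightarrow> \<bar>potential_hat s \<xi> - potential_hat s \<eta>\<bar> \<le> C * norm (\<xi> - \<eta>) * jbracket \<xi> powr - s"
    using potential_hat_bounds[OF spos(1), where 'a = "real ^ 'n"] by blast
  interpret decaying_kernel "potential_hat s :: real ^ 'n \<Rightarrow> real" c C s
    by unfold_locales (use assms(1) spos cC b in auto)
  have q: "fourier ?q = (\<lambda>\<xi>. of_real (potential_hat s \<xi>))"
    by (rule ext) (rule potential_fourier(2)[OF spos(1)])
  have th: "norm \<theta> = 1" using assms(2) by simp
  have p: "0 \<le> decay_exponent" using spos by (simp add: decay_exponent_def)
  have a0: "\<alpha>\<^sub>0 = decay_exponent - real DIM(real ^ 'n) / 2"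
    unfolding assms(4) decay_exponent_def dimc unfolding s_def by (simp add: min_def field_simps)
  have "?q \<in> sobolev_fun \<gamma>" if "\<gamma> < \<beta>" for \<gamma>
  proof (rule sobolev_fun_of_fourier_decay[OF potential_fourier(1)[OF spos(1)] q])
    show "\<bar>potential_hat s \<xi>\<bar> \<le> C * jbracket \<xi> powr - s" for \<xi> :: "real ^ 'n"
      using b(2)[of \<xi>] Q_nonneg[of \<xi>] by simp
  qed (use that in \<open>auto simp: s_def\<close>)
  moreover have "\<alpha> < \<alpha>\<^sub>0" if "Q_fixed \<theta> ?q \<in> sobolev_loc \<alpha>" for \<alpha>
  proof -
    obtain C3 c3 where C3: "0 < C3" "0 < c3" and Qf: "\<And>\<theta> \<eta>. norm \<theta> = 1 \<Longrightarrow> norm (Q_fixed_hat \<theta> ?q \<eta>) \<le> C3 * (1 + 1 / norm \<eta>)"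
      "\<And>\<theta> \<eta>. norm \<theta> = 1 \<Longrightarrow> Im (Q_fixed_hat \<theta> ?q \<eta>) \<le> 0"
      "\<And>\<theta> \<eta>. norm \<theta> = 1 \<Longrightarrow> 2 \<le> norm \<eta> \<Longrightarrow> norm \<eta> / 2 \<le> \<bar>\<theta> \<bullet> \<eta>\<bar> \<Longrightarrow> Im (Q_fixed_hat \<theta> ?q \<eta>) \<le> - c3 * norm \<eta> powr - decay_exponent"
      using Q_fixed_hat_bounds[OF q] by (metis (no_types, lifting))
    show ?thesis unfolding a0
    proof (rule not_in_sobolev_loc[OF dim2 Q_fixed_hat_measurable_fixed[OF q th] C3(1) Qf(1,2)[OF th] th C3(2) p])
      show "inv_fourier_dist (fun_dist (Q_fixed_hat \<theta> ?q)) \<in> sobolev_loc \<alpha>" using that by (simp add: Q_fixed_def)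
      fix \<eta> assume eta: "2 \<le> norm \<eta>" "norm (\<eta> - norm \<eta> *\<^sub>R \<theta>) \<le> norm \<eta> / 8"
      have "norm \<eta> / 2 \<le> \<theta> \<bullet> \<eta>" by (rule cap_inner_lower[OF th _ th eta(2)]) simp
      then have "norm \<eta> / 2 \<le> \<bar>\<theta> \<bullet> \<eta>\<bar>" by linarith
      from Qf(3)[OF th eta(1) this] show "Im (Q_fixed_hat \<theta> ?q \<eta>) \<le> - c3 * norm \<eta> powr - decay_exponent" .
    qed
  qed
  moreover have "\<alpha> < \<alpha>\<^sub>0" if "Q_full ?q \<in> sobolev_loc \<alpha>" for \<alpha>
  proof -
    obtain C3 c3 where C3: "0 < C3" "0 < c3" and Qf: "\<And>\<eta>. norm (Q_full_hat ?q \<eta>) \<le> C3 * (1 + 1 / norm \<eta>)"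
      "\<And>\<eta>. Im (Q_full_hat ?q \<eta>) \<le> 0"
      "\<And>\<eta>. 2 \<le> norm \<eta> \<Longrightarrow> norm (\<eta> - norm \<eta> *\<^sub>R \<theta>) \<le> norm \<eta> / 8 \<Longrightarrow> Im (Q_full_hat ?q \<eta>) \<le> - c3 * norm \<eta> powr - decay_exponent"
      using Q_full_hat_bounds[OF q th] by (metis (no_types, lifting))
    show ?thesis unfolding a0
      by (rule not_in_sobolev_loc[OF dim2 Q_full_hat_measurable[OF q] C3(1) Qf(1,2) th C3(2) p Qf(3)])
         (use that in \<open>auto simp: Q_full_def\<close>)
  qed
  ultimately show ?thesis
    using radial_potential compactly_supported_potential[OF spos(1)] by (intro exI[of _ ?g]) auto
qed

end
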